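(* The Positivity problem is polynomial-time reducible to the following problem: given a finite MDP $\mathcal{M}=(S,\mathit{Act},P,s_{\mathit{init}},\mathit{wgt}_{\mathit{goal}},\mathit{wgt}_{\mathit{fail}},\mathit{goal},\mathit{fail})$ with two terminal states $\mathit{goal},\mathit{fail}$, two weight functions $\mathit{wgt}_{\mathit{goal}},\mathit{wgt}_{\mathit{fail}}\colon S\times\mathit{Act}\to\mathbb{N}$, and $\Pr^{\min}_{\mathcal{M},s_{\mathit{init}}}(\lozenge\{\mathit{goal},\mathit{fail}\})=1$, and a rational $\vartheta$, decide whether $\mathbb{E}^{\max}_{\mathcal{M},s_{\mathit{init}}}(X)>\vartheta$.
   Context: Positivity problem: given $k\ge 2$ and rationals $\alpha_1,\dots,\alpha_k,\beta_0,\dots,\beta_{k-1}$, let $u_j=\beta_j$ for $0\le j<k$ and $u_{n+k}=\alpha_1u_{n+k-1}+\dots+\alpha_ku_n$; decide whether $u_n\ge0$ for all $n$. The MDP has finite states and actions and rational transition probabilities; schedulers are randomized history-dependent, and $\Pr^{\min}$ is the infimum over schedulers. For a weight function $w$ and a path, $w(\zeta)$ is the sum of $w$ over its state–action pairs. The random variable $X$ on maximal paths is $X(\zeta)=\mathit{wgt}_{\mathit{goal}}(\zeta)$ if $\zeta$ reaches $\mathit{goal}$ and $X(\zeta)=\mathit{wgt}_{\mathit{fail}}(\zeta)$ if $\zeta$ reaches $\mathit{fail}$. $\mathbb{E}^{\max}(X)=\sup_{\mathfrak{S}}\mathbb{E}^{\mathfrak{S}}(X)$ (two-sided partial expectation).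 *)

theory Defs
  imports
    "HOL-Probability.Probability"
    "HOL-Computational_Algebra.Polynomial"
    "HOL-Library.Log_Nat"
begin

section \<open>Polynomial-time reducibility\<close>

text \<open>
  The machine model is a random access machine with integer arithmetic and indirect addressing
  under the logarithmic cost criterion: every instruction costs the total bit length of the integers
  it handles.  Up to a polynomial, this is Turing machine time (Cook and Reckhow; Aho, Hopcroft and
  Ullman).  Control flow is structured.  A machine has finitely many registers with fixed names and
  an unbounded memory.  Inputs and oracle queries are finite words of integers, whose length is
  measured in bits.
\<close>

definition int_size :: "int \<Rightarrow> nat" where
  "int_size x = floorlog 2 (nat \<bar>x\<bar>) + 1"

definition word_size :: "int list \<Rightarrow> nat" where
  "word_size w = sum_list (map int_size w)"

datatype arith = Add | Sub | Mul | Div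

primrec arith_op :: "arith \<Rightarrow> int \<Rightarrow> int \<Rightarrow> int" where
  "arith_op Add x y = x + y"
| "arith_op Sub x y = x - y"
| "arith_op Mul x y = x * y"
| "arith_op Div x y = x div y"

datatype program =
    Skip
  | Const nat int
  | Arith nat arith nat nat
  | Load nat nat
  | Store nat nat
  | Query nat nat nat
  | Seq program program
  | IfPos nat program program
  | WhilePos nat program

type_synonym store = "(nat \<Rightarrow> int) \<times> (int \<Rightarrow> int)"

text \<open>
  \<open>exec A c s t s'\<close>: with oracle \<open>A\<close>, program \<open>c\<close> started in store \<open>s\<close> (registers and memory)
  terminates in store \<open>s'\<close> at total cost \<open>t\<close>.  \<open>Query r a n\<close> asks the oracle for the word of length
  \<open>R n\<close> that begins at memory cell \<open>R a\<close>.
\<close>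

inductive exec :: "int list set \<Rightarrow> program \<Rightarrow> store \<Rightarrow> nat \<Rightarrow> store \<Rightarrow> bool" for A where
  Skip: "exec A Skip s 1 s"
| Const: "exec A (Const r c) (R, M) (int_size c) (R(r := c), M)"
| Arith: "exec A (Arith r f a b) (R, M) (int_size (R a) + int_size (R b))
    (R(r := arith_op f (R a) (R b)), M)"
| Load: "exec A (Load r a) (R, M) (int_size (R a) + int_size (M (R a))) (R(r := M (R a)), M)"
| Store: "exec A (Store a r) (R, M) (int_size (R a) + int_size (R r)) (R, M(R a := R r))"
| Query: "w = map (\<lambda>i. M (R a + int i)) [0..<nat (R n)] \<Longrightarrow>
    exec A (Query r a n) (R, M) (int_size (R a) + int_size (R n) + word_size w)
      (R(r := of_bool (w \<in> A)), M)"
| Seq: "exec A c1 s t1 s1 \<Longrightarrow> exec A c2 s1 t2 s2 \<Longrightarrow> exec A (Seq c1 c2) s (t1 + t2) s2"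
| IfTrue: "0 < R r \<Longrightarrow> exec A c1 (R, M) t s \<Longrightarrow>
    exec A (IfPos r c1 c2) (R, M) (int_size (R r) + t) s"
| IfFalse: "\<not> 0 < R r \<Longrightarrow> exec A c2 (R, M) t s \<Longrightarrow>
    exec A (IfPos r c1 c2) (R, M) (int_size (R r) + t) s"
| WhileFalse: "\<not> 0 < R r \<Longrightarrow> exec A (WhilePos r c) (R, M) (int_size (R r)) (R, M)"
| WhileTrue: "0 < R r \<Longrightarrow> exec A c (R, M) t1 s1 \<Longrightarrow> exec A (WhilePos r c) s1 t2 s2 \<Longrightarrow>
    exec A (WhilePos r c) (R, M) (int_size (R r) + t1 + t2) s2"

definition input_store :: "int list \<Rightarrow> store" where
  "input_store w =
    ((\<lambda>_. 0)(0 := int (length w)),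
     \<lambda>i. if 0 \<le> i \<and> i < int (length w) then w ! nat i else 0)"

text \<open>
  A decision problem is given by the words encoding its yes-instances and those encoding its
  no-instances; all other words are outside of its domain.
\<close>

type_synonym problem = "int list set \<times> int list set"

definition decision_problem :: "('i \<Rightarrow> int list) \<Rightarrow> 'i set \<Rightarrow> ('i \<Rightarrow> bool) \<Rightarrow> problem" where
  "decision_problem enc I Q = (enc ` {x \<in> I. Q x}, enc ` {x \<in> I. \<not> Q x})"

text \<open>
  Polynomial-time (Turing) reducibility.  The oracle has to be correct on the instances of the second
  problem only, so the reduction cannot rely on answers for words that are not instances.
\<close>

definition poly_time_reducible :: "problem \<Rightarrow> problem \<Rightarrow> bool" where
  "poly_time_reducible X Y \<longleftrightarrow>
    (\<exists>c (p :: nat poly). \<forall>A. fst Y \<subseteq> A \<and> snd Y \<inter> A = {} \<longrightarrow>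
      (\<forall>w \<in> fst X \<union> snd X. \<exists>t R M.
        exec A c (input_store w) t (R, M) \<and> t \<le> poly p (word_size w) \<and>
        (0 < R 0 \<longleftrightarrow> w \<in> fst X)))"

definition rat_word :: "rat \<Rightarrow> int list" where
  "rat_word q = [fst (quotient_of q), snd (quotient_of q)]"


section \<open>The Positivity problem\<close>

definition linear_recurrence :: "rat list \<Rightarrow> rat list \<Rightarrow> (nat \<Rightarrow> rat) \<Rightarrow> bool" where
  "linear_recurrence \<alpha> \<beta> u \<longleftrightarrow>
    (\<forall>j < length \<beta>. u j = \<beta> ! j) \<and>
    (\<forall>n. u (n + length \<alpha>) = (\<Sum>i = 1..length \<alpha>. \<alpha> ! (i - 1) * u (n + length \<alpha> - i)))"

definition positivity_instances :: "(rat list \<times> rat list) set" where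
  "positivity_instances = {(\<alpha>, \<beta>). 2 \<le> length \<alpha> \<and> length \<beta> = length \<alpha>}"

definition positive :: "rat list \<times> rat list \<Rightarrow> bool" where
  "positive = (\<lambda>(\<alpha>, \<beta>). \<exists>u. linear_recurrence \<alpha> \<beta> u \<and> (\<forall>n. 0 \<le> u n))"

definition positivity_word :: "rat list \<times> rat list \<Rightarrow> int list" where
  "positivity_word =
    (\<lambda>(\<alpha>, \<beta>). int (length \<alpha>) # concat (map rat_word \<alpha>) @ concat (map rat_word \<beta>))"

definition positivity_problem :: problem where
  "positivity_problem = decision_problem positivity_word positivity_instances positive"


section \<open>Markov decision processes\<close>

record ('s, 'a) mdp =
  states :: "'s set"
  actions :: "'a set"
  prob :: "'s \<Rightarrow> 'a \<Rightarrow> 's \<Rightarrow> rat"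
  init :: 's
  wgt_goal :: "'s \<Rightarrow> 'a \<Rightarrow> nat"
  wgt_fail :: "'s \<Rightarrow> 'a \<Rightarrow> nat"
  goal :: 's
  fail :: 's

definition enabled :: "('s, 'a) mdp \<Rightarrow> 's \<Rightarrow> 'a set" where
  "enabled M s = {a \<in> actions M. (\<Sum>t\<in>states M. prob M s a t) = 1}"

text \<open>Functions on \<open>S \<times> Act \<times> S\<close> and \<open>S \<times> Act\<close> are extended by \<open>0\<close> to total functions.\<close>

definition is_mdp :: "('s, 'a) mdp \<Rightarrow> bool" where
  "is_mdp M \<longleftrightarrow>
    finite (states M) \<and> finite (actions M) \<and>
    (\<forall>s a t. 0 \<le> prob M s a t) \<and>
    (\<forall>s\<in>states M. \<forall>a\<in>actions M. (\<Sum>t\<in>states M. prob M s a t) \<in> {0, 1}) \<and>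
    (\<forall>s a t. s \<notin> states M \<or> a \<notin> actions M \<or> t \<notin> states M \<longrightarrow> prob M s a t = 0) \<and>
    (\<forall>s a. s \<notin> states M \<or> a \<notin> actions M \<longrightarrow> wgt_goal M s a = 0 \<and> wgt_fail M s a = 0) \<and>
    init M \<in> states M \<and> goal M \<in> states M \<and> fail M \<in> states M \<and> goal M \<noteq> fail M \<and>
    enabled M (goal M) = {} \<and> enabled M (fail M) = {}"

text \<open>
  A scheduler maps a history, i.e. the state-action pairs taken so far and the current state, to a
  distribution over enabled actions.
\<close>

type_synonym ('s, 'a) scheduler = "('s \<times> 'a) list \<Rightarrow> 's \<Rightarrow> 'a pmf"

definition schedulers :: "('s, 'a) mdp \<Rightarrow> ('s, 'a) scheduler set" where
  "schedulers M = {\<sigma>. \<forall>h. \<forall>s\<in>states M. enabled M s \<noteq> {} \<longrightarrow> set_pmf (\<sigma> h s) \<subseteq> enabled M s}"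

text \<open>
  A maximal path is a sequence \<open>\<omega>\<close> of pairs of a state and the action chosen there.  A path that ends
  in a terminal state \<open>s\<close> is prolonged by repeating \<open>(s, None)\<close>.
\<close>

type_synonym ('s, 'a) path = "nat \<Rightarrow> 's \<times> 'a option"

definition choose_action ::
  "('s, 'a) mdp \<Rightarrow> ('s, 'a) scheduler \<Rightarrow> ('s \<times> 'a) list \<Rightarrow> 's \<Rightarrow> ('s \<times> 'a option) pmf" where
  "choose_action M \<sigma> h s =
    (if enabled M s = {} then return_pmf (s, None) else map_pmf (\<lambda>a. (s, Some a)) (\<sigma> h s))"

definition next_state :: "('s, 'a) mdp \<Rightarrow> 's \<Rightarrow> 'a \<Rightarrow> 's pmf" where
  "next_state M s a = embed_pmf (\<lambda>t. real_of_rat (prob M s a t))"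

lemma pmf_next_state:
  assumes "is_mdp M" "s \<in> states M" "a \<in> enabled M s"
  shows "pmf (next_state M s a) t = real_of_rat (prob M s a t)"
  unfolding next_state_def
proof (rule pmf_embed_pmf)
  have fin: "finite (states M)" and nonneg: "\<And>t. 0 \<le> real_of_rat (prob M s a t)"
    and zero: "\<And>t. t \<notin> states M \<Longrightarrow> prob M s a t = 0"
    using assms(1) by (auto simp: is_mdp_def)
  show "\<And>t. 0 \<le> real_of_rat (prob M s a t)"
    by (rule nonneg)
  have "(\<integral>\<^sup>+ t. ennreal (real_of_rat (prob M s a t)) \<partial>count_space UNIV) =
      (\<Sum>t\<in>states M. ennreal (real_of_rat (prob M s a t)))"
    using fin zero by (intro nn_integral_count_space'[of "states M"]) auto
  also have "\<dots> = ennreal (real_of_rat (\<Sum>t\<in>states M. prob M s a t))"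
    using nonneg by (simp add: sum_ennreal of_rat_sum)
  finally show "(\<integral>\<^sup>+ t. ennreal (real_of_rat (prob M s a t)) \<partial>count_space UNIV) = 1"
    using assms(3) by (simp add: enabled_def)
qed

primrec history :: "('s, 'a) path \<Rightarrow> nat \<Rightarrow> ('s \<times> 'a) list" where
  "history \<omega> 0 = []"
| "history \<omega> (Suc n) = history \<omega> n @ [(fst (\<omega> n), the (snd (\<omega> n)))]"

fun path_step ::
  "('s, 'a) mdp \<Rightarrow> ('s, 'a) scheduler \<Rightarrow> nat \<Rightarrow> ('s, 'a) path \<Rightarrow> ('s \<times> 'a option) pmf" where
  "path_step M \<sigma> 0 \<omega> = choose_action M \<sigma> [] (init M)"
| "path_step M \<sigma> (Suc n) \<omega> =
    (case \<omega> n of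
      (s, None) \<Rightarrow> return_pmf (s, None)
    | (s, Some a) \<Rightarrow> bind_pmf (next_state M s a) (choose_action M \<sigma> (history \<omega> (Suc n))))"

definition path_kernel ::
  "('s, 'a) mdp \<Rightarrow> ('s, 'a) scheduler \<Rightarrow> nat \<Rightarrow> ('s, 'a) path \<Rightarrow> ('s \<times> 'a option) measure" where
  "path_kernel M \<sigma> n \<omega> = measure_pmf (path_step M \<sigma> n \<omega>)"

definition path_measure :: "('s, 'a) mdp \<Rightarrow> ('s, 'a) scheduler \<Rightarrow> ('s, 'a) path measure" where
  "path_measure M \<sigma> =
    projective_family.lim UNIV
      (Ionescu_Tulcea.CI (path_kernel M \<sigma>) (\<lambda>_. count_space UNIV)) (\<lambda>_. count_space UNIV)"

lemma Ionescu_Tulcea_path_kernel: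
  fixes M :: "('s :: countable, 'a :: countable) mdp"
  shows "Ionescu_Tulcea (path_kernel M \<sigma>) (\<lambda>_. count_space UNIV)"
proof (rule Ionescu_Tulcea.intro)
  fix n
  have PiM: "Pi\<^sub>M {0..<n} (\<lambda>_. count_space UNIV) =
      (count_space (PiE {0..<n} (\<lambda>_. UNIV)) :: (nat \<Rightarrow> 's \<times> 'a option) measure)"
    by (intro count_space_PiM_finite) auto
  show "path_kernel M \<sigma> n
      \<in> measurable (Pi\<^sub>M {0..<n} (\<lambda>_. count_space UNIV)) (subprob_algebra (count_space UNIV))"
    by (auto simp: PiM path_kernel_def space_subprob_algebra
        intro!: prob_space_imp_subprob_space measure_pmf.prob_space_axioms)
qed (simp add: path_kernel_def measure_pmf.prob_space_axioms)

definition reaches :: "('s, 'a) path \<Rightarrow> 's set \<Rightarrow> bool" where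
  "reaches \<omega> T \<longleftrightarrow> (\<exists>i. fst (\<omega> i) \<in> T)"

definition min_reach_prob :: "('s, 'a) mdp \<Rightarrow> 's set \<Rightarrow> real" where
  "min_reach_prob M T =
    (INF \<sigma>\<in>schedulers M.
      measure (path_measure M \<sigma>) {\<omega> \<in> space (path_measure M \<sigma>). reaches \<omega> T})"

definition path_weight :: "('s \<Rightarrow> 'a \<Rightarrow> nat) \<Rightarrow> ('s, 'a) path \<Rightarrow> ennreal" where
  "path_weight w \<omega> =
    (\<Sum>i. case \<omega> i of (s, None) \<Rightarrow> 0 | (s, Some a) \<Rightarrow> of_nat (w s a))"

text \<open>
  The value \<open>0\<close> on paths that reach neither of the two states is immaterial: below, these paths form a
  null set under every scheduler.
\<close>

definition payoff :: "('s, 'a) mdp \<Rightarrow> ('s, 'a) path \<Rightarrow> ennreal" where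
  "payoff M \<omega> =
    (if reaches \<omega> {goal M} then path_weight (wgt_goal M) \<omega>
     else if reaches \<omega> {fail M} then path_weight (wgt_fail M) \<omega>
     else 0)"

definition max_expectation :: "('s, 'a) mdp \<Rightarrow> ereal" where
  "max_expectation M =
    (SUP \<sigma>\<in>schedulers M. enn2ereal (\<integral>\<^sup>+ \<omega>. payoff M \<omega> \<partial>path_measure M \<sigma>))"


section \<open>The threshold problem\<close>

text \<open>To write an MDP down as a word, its states and actions are numbered.\<close>

definition threshold_instances :: "((nat, nat) mdp \<times> rat) set" where
  "threshold_instances =
    {(M, \<theta>). is_mdp M \<and> (\<exists>n m. states M = {..<n} \<and> actions M = {..<m}) \<and>
      min_reach_prob M {goal M, fail M} = 1}"

definition exceeds_threshold :: "(nat, nat) mdp \<times> rat \<Rightarrow> bool" where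
  "exceeds_threshold = (\<lambda>(M, \<theta>). max_expectation M > ereal (real_of_rat \<theta>))"

definition row_word :: "(nat, nat) mdp \<Rightarrow> nat \<Rightarrow> nat \<Rightarrow> int list" where
  "row_word M s a =
    int (wgt_goal M s a) # int (wgt_fail M s a) #
      concat (map (\<lambda>t. rat_word (prob M s a t)) [0..<card (states M)])"

definition threshold_word :: "(nat, nat) mdp \<times> rat \<Rightarrow> int list" where
  "threshold_word = (\<lambda>(M, \<theta>).
    rat_word \<theta> @
    [int (card (states M)), int (card (actions M)), int (init M), int (goal M), int (fail M)] @
    concat (map (\<lambda>s. concat (map (row_word M s) [0..<card (actions M)])) [0..<card (states M)]))"

text \<open>
  The encoding is injective, hence yes- and no-instances are disjoint and
  poly_time_reducible does not quantify over an empty set of oracles.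
\<close>

lemma concat_map_upt_inject:
  assumes "concat (map f [0..<n]) @ u = concat (map g [0..<n]) @ v"
    and "\<And>i. i < n \<Longrightarrow> length (f i) = length (g i)"
  shows "u = v \<and> (\<forall>i<n. f i = g i)"
  using assms
proof (induction n arbitrary: u v)
  case (Suc n)
  have "concat (map f [0..<n]) @ (f n @ u) = concat (map g [0..<n]) @ (g n @ v)"
    using Suc.prems(1) by simp
  moreover have "length (f i) = length (g i)" if "i < n" for i
    by (rule Suc.prems(2)) (rule less_SucI[OF that])
  ultimately have "f n @ u = g n @ v \<and> (\<forall>i<n. f i = g i)"
    by (rule Suc.IH)
  moreover have "length (f n) = length (g n)"
    by (rule Suc.prems(2)) (rule lessI)
  ultimately have "f n = g n" "u = v" "\<forall>i<n. f i = g i"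
    by (metis append_eq_append_conv)+
  then show ?case
    by (metis less_SucE)
next
  case 0
  from 0(1) show ?case
    by (simp only: upt_0 list.map concat.simps append_Nil not_less0 simp_thms)
qed

lemma rat_word_inject: "rat_word p = rat_word q \<longleftrightarrow> p = q"
  unfolding rat_word_def list.inject by (metis prod.expand quotient_of_inject)

lemma length_rat_word [simp]: "length (rat_word q) = 2"
  by (simp add: rat_word_def)

lemma inj_on_threshold_word: "inj_on threshold_word threshold_instances"
proof (rule inj_onI, clarify)
  fix M M' :: "(nat, nat) mdp" and \<theta> \<theta>' :: rat
  assume I: "(M, \<theta>) \<in> threshold_instances" and I': "(M', \<theta>') \<in> threshold_instances"
    and eq: "threshold_word (M, \<theta>) = threshold_word (M', \<theta>')"
  obtain n m where nm: "states M = {..<n}" "actions M = {..<m}" and M: "is_mdp M"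
    using I by (auto simp: threshold_instances_def)
  obtain n' m' where nm': "states M' = {..<n'}" "actions M' = {..<m'}" and M': "is_mdp M'"
    using I' by (auto simp: threshold_instances_def)
  have \<theta>: "\<theta> = \<theta>'"
    and n: "n' = n" and m: "m' = m"
    and fields: "init M = init M'" "goal M = goal M'" "fail M = fail M'"
    and tables: "concat (map (\<lambda>s. concat (map (row_word M s) [0..<m])) [0..<n]) =
      concat (map (\<lambda>s. concat (map (row_word M' s) [0..<m])) [0..<n])"
    using eq by (auto simp: threshold_word_def nm nm' rat_word_inject)
  have len: "length (row_word N s a) = 2 + 2 * card (states N)" for N s a
    by (simp add: row_word_def length_concat comp_def sum_list_triv)
  have "\<forall>s<n. concat (map (row_word M s) [0..<m]) = concat (map (row_word M' s) [0..<m])"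
    using tables by (intro concat_map_upt_inject[of _ n "[]" _ "[]", THEN conjunct2])
      (simp_all add: length_concat comp_def len nm nm' n)
  then have rows: "row_word M s a = row_word M' s a" if "s < n" "a < m" for s a
    using concat_map_upt_inject[of "row_word M s" m "[]" "row_word M' s" "[]"] that
    by (auto simp: len nm nm' n)
  have prob: "prob M s a t = prob M' s a t" if "s < n" "a < m" "t < n" for s a t
  proof -
    have "\<forall>t<n. rat_word (prob M s a t) = rat_word (prob M' s a t)"
      using rows[OF that(1,2)]
      by (intro concat_map_upt_inject[of _ n "[]" _ "[]", THEN conjunct2])
        (auto simp: row_word_def nm nm' n)
    with \<open>t < n\<close> show ?thesis
      by (simp add: rat_word_inject)
  qed
  have "prob M s a t = prob M' s a t" for s a t
  proof (cases "s < n \<and> a < m \<and> t < n")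
    case False
    then have "s \<notin> states M \<or> a \<notin> actions M \<or> t \<notin> states M"
      "s \<notin> states M' \<or> a \<notin> actions M' \<or> t \<notin> states M'"
      by (auto simp: nm nm' n m)
    then have "prob M s a t = 0" "prob M' s a t = 0"
      using M M' unfolding is_mdp_def by presburger+
    then show ?thesis
      by simp
  qed (use prob in blast)
  then have "prob M = prob M'"
    by (intro ext)
  moreover have wgt: "wgt_goal M s a = wgt_goal M' s a \<and> wgt_fail M s a = wgt_fail M' s a" for s a
  proof (cases "s < n \<and> a < m")
    case True
    then show ?thesis
      using rows[of s a] by (simp add: row_word_def)
  next
    case False
    then have "s \<notin> states M \<or> a \<notin> actions M" "s \<notin> states M' \<or> a \<notin> actions M'"
      by (auto simp: nm nm' n m)
    then have "wgt_goal M s a = 0 \<and> wgt_fail M s a = 0" "wgt_goal M' s a = 0 \<and> wgt_fail M' s a = 0"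
      using M M' unfolding is_mdp_def by presburger+
    then show ?thesis
      by simp
  qed
  then have "wgt_goal M = wgt_goal M'" "wgt_fail M = wgt_fail M'"
    by (intro ext; simp)+
  ultimately have "M = M'"
    using fields by (intro mdp.equality) (simp_all add: nm nm' n m)
  with \<theta> show "M = M' \<and> \<theta> = \<theta>'"
    by blast
qed

definition threshold_problem :: problem where
  "threshold_problem = decision_problem threshold_word threshold_instances exceeds_threshold"

lemma threshold_problem_disjoint: "fst threshold_problem \<inter> snd threshold_problem = {}"
  unfolding threshold_problem_def decision_problem_def fst_conv snd_conv
  by (subst inj_on_image_Int[OF inj_on_threshold_word, symmetric]) auto

end

theory Submission
  imports Defs
begin

text \<open>
  Let \<open>d\<close> be the accumulated goal weight minus the accumulated fail weight.  A choice between moving to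
  goal and moving to fail is worth \<open>max d 0\<close> in excess of the fail weight, and the second difference
  \<open>max (d + 1) 0 - 2 * max d 0 + max (d - 1) 0\<close> of this function is the indicator of \<open>d = 0\<close>.  So an
  outcome with sign \<open>+\<close>, where \<open>d\<close> is shifted by \<open>1\<close> or \<open>- 1\<close> with probability \<open>1 / 2\<close> each, is worth
  \<open>1 / 2\<close> more than an outcome with sign \<open>-\<close>, where \<open>d\<close> is not shifted, if \<open>d = 0\<close>, and exactly as much
  if \<open>d \<noteq> 0\<close>.

  A chain of \<open>k\<close> states, each with two signs, decrements \<open>d\<close> in every step and stops with
  probability \<open>1 / 2\<close> in every step.  Its signed transition probabilities are proportional to the
  companion matrix of the recurrence and its signed stopping probabilities to the negated initial
  values, so its signed probability to stop in step \<open>n\<close> is a negative multiple of \<open>u n\<close>.  The initial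
  state generates \<open>d = n\<close> with probability \<open>1 / 2 ^ n\<close> and chooses between this chain and
  a fair copy of it whose sign is a fair coin.  The chain is strictly better for some \<open>n\<close> iff some
  \<open>u n\<close> is negative, and always taking the fair copy yields exactly \<open>15 / 4\<close>, whatever the input is.

  The upper bound for all schedulers is a supermartingale argument with the explicit value function,
  the lower bound for one scheduler uses in addition that a potential linear in the weights contracts
  by the factor \<open>3 / 4\<close> in every step.
\<close>

section \<open>Expectations over paths\<close>

text \<open>A recurrence has coefficients of either sign, a Markov chain has not; so every chain
  state is doubled and a coefficient becomes a difference of two probabilities. Weights are natural
  numbers, so \<open>d\<close> can only be lowered by paying fail weight. Therefore the outcome
  without shift pays goal and fail weight 1 each, while the outcome with shift pays fail weight 1
  and gets goal weight 2 in half of the cases. Multiplying coefficients and initial values by a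
  common denominator \<open>L\<close> and dividing by the normalizer \<open>Q\<close> changes the
  signed stopping probabilities only by powers of \<open>L / Q\<close>, which is positive, so signs
  survive. A yes-instance of Positivity becomes a no-instance of the threshold problem: the
  reduction asks one query and negates the answer. The oracle is constrained only on encodings of
  instances, with fractions in lowest terms. Hence the machine has to write the canonical encoding
  literally, and this dictates the shape of the probabilities.\<close>

lemma history_cong: "(\<And>i. i < n \<Longrightarrow> \<omega> i = \<omega>' i) \<Longrightarrow> history \<omega> n = history \<omega>' n"
  by (induction n) auto

lemma path_step_cong:
  assumes "\<And>i. i < n \<Longrightarrow> \<omega> i = \<omega>' i"
  shows "path_step M \<sigma> n \<omega> = path_step M \<sigma> n \<omega>'"
proof (cases n)
  case (Suc m)
  then have "\<omega> m = \<omega>' m" "history \<omega> (Suc m) = history \<omega>' (Suc m)"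
    using assms by (auto intro!: history_cong simp del: history.simps)
  then show ?thesis
    using Suc by (simp del: history.simps)
qed auto

lemma PiM_count_space_lessThan:
  "Pi\<^sub>M {0..<n} (\<lambda>_. count_space UNIV) =
    (count_space (PiE {0..<n} (\<lambda>_. UNIV)) :: (nat \<Rightarrow> 's :: countable) measure)"
  by (intro count_space_PiM_finite) auto

text \<open>A finite product of countable discrete spaces is again discrete, so measurability is
  automatic once a function factors through the restriction to the first \<open>n\<close>
  coordinates.\<close>

lemma measurable_finitely_many_coordinates:
  fixes F :: "(nat \<Rightarrow> 's :: countable) \<Rightarrow> 'b"
  assumes F: "\<And>\<omega> \<omega>'. (\<And>i. i < n \<Longrightarrow> \<omega> i = \<omega>' i) \<Longrightarrow> F \<omega> = F \<omega>'" and N: "F ` UNIV \<subseteq> space N"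
  shows "F \<in> measurable (Pi\<^sub>M UNIV (\<lambda>_. count_space UNIV)) N"
proof -
  have "F = F \<circ> (\<lambda>\<omega>. restrict \<omega> {0..<n})"
    by (intro ext) (auto intro: F)
  moreover have "F \<in> measurable (Pi\<^sub>M {0..<n} (\<lambda>_. count_space UNIV)) N"
    using N by (auto simp: PiM_count_space_lessThan)
  moreover have "(\<lambda>\<omega>. restrict \<omega> {0..<n}) \<in>
      measurable (Pi\<^sub>M UNIV (\<lambda>_. count_space UNIV :: 's measure)) (Pi\<^sub>M {0..<n} (\<lambda>_. count_space UNIV))"
    by (intro measurable_restrict_subset) auto
  ultimately show ?thesis
    by (metis measurable_comp)
qed

context
  fixes M :: "('s :: countable, 'a :: countable) mdp" and \<sigma> :: "('s, 'a) scheduler"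
begin

interpretation Ionescu_Tulcea "path_kernel M \<sigma>" "\<lambda>_. count_space UNIV"
  by (rule Ionescu_Tulcea_path_kernel)

lemma sets_path_measure [measurable_cong]:
  "sets (path_measure M \<sigma>) = sets (Pi\<^sub>M UNIV (\<lambda>_. count_space UNIV))"
  by (simp add: path_measure_def)

lemma space_path_measure [simp]: "space (path_measure M \<sigma>) = UNIV"
  using sets_eq_imp_space_eq[OF sets_path_measure] by (simp add: space_PiM)

lemma measurable_path_measure:
  assumes "\<And>\<omega> \<omega>'. (\<And>i. i < n \<Longrightarrow> \<omega> i = \<omega>' i) \<Longrightarrow> F \<omega> = F \<omega>'" and "F ` UNIV \<subseteq> space N"
  shows "F \<in> measurable (path_measure M \<sigma>) N"
  unfolding measurable_cong_sets[OF sets_path_measure refl]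
  using assms by (rule measurable_finitely_many_coordinates)

text \<open>Such a function sees only a finite marginal of the projective limit, and that marginal
  is the iterated kernel \<open>C 0 n\<close>. The starting point
  \<open>\<lambda>_. undefined\<close> is the only element of the empty product.\<close>

lemma nn_integral_path_measure_C:
  fixes F :: "('s, 'a) path \<Rightarrow> ennreal"
  assumes F: "\<And>\<omega> \<omega>'. (\<And>i. i < n \<Longrightarrow> \<omega> i = \<omega>' i) \<Longrightarrow> F \<omega> = F \<omega>'"
  shows "(\<integral>\<^sup>+ \<omega>. F \<omega> \<partial>path_measure M \<sigma>) = (\<integral>\<^sup>+ \<omega>. F \<omega> \<partial>C 0 n (\<lambda>_. undefined))"
proof -
  have Fr: "F (restrict \<omega> {0..<n}) = F \<omega>" for \<omega>
    by (rule F) auto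
  have mF: "F \<in> borel_measurable (Pi\<^sub>M {0..<n} (\<lambda>_. count_space UNIV))"
    by (simp add: PiM_count_space_lessThan)
  have "(\<lambda>\<omega>. restrict \<omega> {0..<n}) \<in> measurable (Pi\<^sub>M I (\<lambda>_. count_space UNIV :: ('s \<times> 'a option) measure))
      (Pi\<^sub>M {0..<n} (\<lambda>_. count_space UNIV))" if "{0..<n} \<subseteq> I" for I
    using that by (rule measurable_restrict_subset)
  then have restr: "(\<lambda>\<omega>. restrict \<omega> {0..<n}) \<in> measurable (path_measure M \<sigma>) (Pi\<^sub>M {0..<n} (\<lambda>_. count_space UNIV))"
    and restrC: "(\<lambda>\<omega>. restrict \<omega> {0..<n}) \<in> measurable (C 0 n (\<lambda>_. undefined)) (Pi\<^sub>M {0..<n} (\<lambda>_. count_space UNIV))"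
    by (simp_all add: measurable_cong_sets[OF sets_path_measure refl] measurable_cong_sets[OF sets_C refl] del: restrict_apply)
  \<comment> \<open>\<open>CI\<close> composes the kernels up to the least bound of its index set;
    for an initial segment this bound is the length.\<close>
  have up: "up_to {0..<n} = n"
    using up_to[of "{0..<n}"] up_to_iff[of "{0..<n}" n] by (auto simp: intro!: antisym)
  have "(\<integral>\<^sup>+ \<omega>. F \<omega> \<partial>path_measure M \<sigma>) = (\<integral>\<^sup>+ \<omega>. F (restrict \<omega> {0..<n}) \<partial>path_measure M \<sigma>)"
    by (simp add: Fr)
  also have "\<dots> = (\<integral>\<^sup>+ \<omega>. F \<omega> \<partial>distr (path_measure M \<sigma>) (Pi\<^sub>M {0..<n} (\<lambda>_. count_space UNIV)) (\<lambda>\<omega>. restrict \<omega> {0..<n}))"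
    by (rule nn_integral_distr[OF restr, symmetric]) (simp add: mF)
  also have "\<dots> = (\<integral>\<^sup>+ \<omega>. F \<omega> \<partial>CI {0..<n})"
    unfolding path_measure_def by (subst distr_lim) auto
  also have "\<dots> = (\<integral>\<^sup>+ \<omega>. F (restrict \<omega> {0..<n}) \<partial>C 0 n (\<lambda>_. undefined))"
    unfolding CI_def up
    by (rule nn_integral_distr[OF restrC]) (simp add: mF)
  finally show ?thesis
    by (simp add: Fr)
qed

lemma prob_space_path_measure: "prob_space (path_measure M \<sigma>)"
proof
  have "emeasure (path_measure M \<sigma>) UNIV = (\<integral>\<^sup>+ \<omega>. 1 \<partial>path_measure M \<sigma>)"
    by simp
  also have "\<dots> = (\<integral>\<^sup>+ \<omega>. 1 \<partial>C 0 0 (\<lambda>_. undefined))"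
    by (rule nn_integral_path_measure_C) simp
  also have "\<dots> = 1"
    by (simp add: emeasure_return space_PiM PiM_empty)
  finally show "emeasure (path_measure M \<sigma>) (space (path_measure M \<sigma>)) = 1"
    by simp
qed

text \<open>The last coordinate on which \<open>F\<close> depends is integrated out with its own
  kernel. Replacing that coordinate inside a full path keeps both sides integrals over
  \<open>path_measure\<close>, so finite marginals need not be mentioned again.\<close>

lemma nn_integral_path_step:
  fixes F :: "('s, 'a) path \<Rightarrow> ennreal"
  assumes F: "\<And>\<omega> \<omega>'. (\<And>i. i \<le> n \<Longrightarrow> \<omega> i = \<omega>' i) \<Longrightarrow> F \<omega> = F \<omega>'"
  shows "(\<integral>\<^sup>+ \<omega>. F \<omega> \<partial>path_measure M \<sigma>) =
    (\<integral>\<^sup>+ \<omega>. (\<integral>\<^sup>+ x. F (fun_upd \<omega> n x) \<partial>path_step M \<sigma> n \<omega>) \<partial>path_measure M \<sigma>)"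
proof -
  let ?G = "\<lambda>\<omega>. \<integral>\<^sup>+ x. F (fun_upd \<omega> n x) \<partial>path_step M \<sigma> n \<omega>"
  have G: "?G \<omega> = ?G \<omega>'" if "\<And>i. i < n \<Longrightarrow> \<omega> i = \<omega>' i" for \<omega> \<omega>'
  proof -
    have "F (fun_upd \<omega> n x) = F (fun_upd \<omega>' n x)" for x
      using that by (intro F) auto
    then show ?thesis
      using path_step_cong[OF that] by simp
  qed
  have mF: "F \<in> borel_measurable (Pi\<^sub>M {0..<Suc n} (\<lambda>_. count_space UNIV))"
    by (simp only: PiM_count_space_lessThan) simp
  have "(\<integral>\<^sup>+ \<omega>. F \<omega> \<partial>path_measure M \<sigma>) = (\<integral>\<^sup>+ \<omega>. F \<omega> \<partial>C 0 (Suc n) (\<lambda>_. undefined))"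
    by (intro nn_integral_path_measure_C F) auto
  also have "\<dots> = (\<integral>\<^sup>+ \<omega>. \<integral>\<^sup>+ \<omega>'. F \<omega>' \<partial>eP n \<omega> \<partial>C 0 n (\<lambda>_. undefined))"
    using mF measurable_eP[of n]
    by (simp, subst nn_integral_bind[where B="Pi\<^sub>M {0..<Suc n} (\<lambda>_. count_space UNIV)"])
      (auto simp: measurable_cong_sets[OF sets_C refl])
  also have "\<dots> = (\<integral>\<^sup>+ \<omega>. ?G \<omega> \<partial>C 0 n (\<lambda>_. undefined))"
    by (intro nn_integral_cong) (simp add: space_C nn_integral_eP[OF _ mF] path_kernel_def)
  also have "\<dots> = (\<integral>\<^sup>+ \<omega>. ?G \<omega> \<partial>path_measure M \<sigma>)"
    by (intro nn_integral_path_measure_C[symmetric] G)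
  finally show ?thesis .
qed

end

section \<open>Almost sure structure of paths and one-step expectations\<close>

definition valid_path :: "('s, 'a) mdp \<Rightarrow> ('s, 'a) scheduler \<Rightarrow> ('s, 'a) path \<Rightarrow> bool" where
  "valid_path M \<sigma> \<omega> \<longleftrightarrow>
    (\<forall>n. fst (\<omega> n) \<in> states M \<and>
      (case snd (\<omega> n) of
        None \<Rightarrow> enabled M (fst (\<omega> n)) = {} \<and> \<omega> (Suc n) = \<omega> n
      | Some a \<Rightarrow> a \<in> enabled M (fst (\<omega> n)) \<and> a \<in> set_pmf (\<sigma> (history \<omega> n) (fst (\<omega> n)))))"

lemma valid_path_state: "valid_path M \<sigma> \<omega> \<Longrightarrow> \<omega> n = (s, x) \<Longrightarrow> s \<in> states M"
  by (auto simp: valid_path_def dest: spec[of _ n])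

lemma valid_path_None:
  "valid_path M \<sigma> \<omega> \<Longrightarrow> \<omega> n = (s, None) \<Longrightarrow> enabled M s = {} \<and> \<omega> (Suc n) = (s, None)"
  by (auto simp: valid_path_def dest: spec[of _ n])

lemma valid_path_Some:
  "valid_path M \<sigma> \<omega> \<Longrightarrow> \<omega> n = (s, Some a) \<Longrightarrow> a \<in> enabled M s \<and> a \<in> set_pmf (\<sigma> (history \<omega> n) s)"
  by (auto simp: valid_path_def dest: spec[of _ n])

definition history_weight :: "('s \<Rightarrow> 'a \<Rightarrow> nat) \<Rightarrow> ('s \<times> 'a) list \<Rightarrow> nat" where
  "history_weight w h = sum_list (map (\<lambda>(s, a). w s a) h)"

lemma history_weight_Nil [simp]: "history_weight w [] = 0"
  and history_weight_snoc [simp]: "history_weight w (h @ [(s, a)]) = history_weight w h + w s a"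
  by (simp_all add: history_weight_def)

lemma set_pmf_next_state:
  assumes "is_mdp M" "s \<in> states M" "a \<in> enabled M s"
  shows "set_pmf (next_state M s a) \<subseteq> states M"
proof
  fix t
  assume "t \<in> set_pmf (next_state M s a)"
  then have "prob M s a t \<noteq> 0"
    using pmf_next_state[OF assms] by (simp add: set_pmf_iff)
  moreover have "t \<notin> states M \<longrightarrow> prob M s a t = 0"
    using assms(1) unfolding is_mdp_def by blast
  ultimately show "t \<in> states M"
    by blast
qed

lemma nn_integral_next_state:
  assumes "is_mdp M" "s \<in> states M" "a \<in> enabled M s"
  shows "(\<integral>\<^sup>+ t. f t \<partial>next_state M s a) =
    (\<Sum>t\<in>states M. ennreal (real_of_rat (prob M s a t)) * f t)"
proof -
  have "finite (states M)"
    using assms(1) by (simp add: is_mdp_def)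
  then show ?thesis
    using set_pmf_next_state[OF assms] pmf_next_state[OF assms]
    by (subst nn_integral_measure_pmf_support[of "states M"]) (auto simp: mult.commute)
qed

lemma set_pmf_choose_action:
  assumes "\<sigma> \<in> schedulers M" "s \<in> states M" "x \<in> set_pmf (choose_action M \<sigma> h s)"
  shows "fst x = s \<and> (case snd x of None \<Rightarrow> enabled M s = {}
    | Some a \<Rightarrow> a \<in> enabled M s \<and> a \<in> set_pmf (\<sigma> h s))"
proof -
  have "enabled M s \<noteq> {} \<Longrightarrow> set_pmf (\<sigma> h s) \<subseteq> enabled M s"
    using assms(1,2) by (simp add: schedulers_def)
  then show ?thesis
    using assms(3) by (cases "enabled M s = {}") (auto simp: choose_action_def)
qed

lemma fst_choose_action: "x \<in> set_pmf (choose_action M \<sigma> h s) \<Longrightarrow> fst x = s"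
  by (auto simp: choose_action_def split: if_splits)

lemma history_fun_upd [simp]: "history (fun_upd \<omega> n x) n = history \<omega> n"
  by (rule history_cong) simp

lemma history_fun_upd' [simp]: "history (fun_upd \<omega> (Suc n) x) n = history \<omega> n"
  by (rule history_cong) simp

context
  fixes M :: "('s :: countable, 'a :: countable) mdp" and \<sigma> :: "('s, 'a) scheduler"
  assumes M: "is_mdp M" and \<sigma>: "\<sigma> \<in> schedulers M"
begin

text \<open>The indicator of the failure of \<open>P\<close> depends on finitely many coordinates;
  integrating out coordinate \<open>n\<close> shows that its integral is zero.\<close>

lemma AE_path_step:
  assumes P: "\<And>\<omega> \<omega>'. (\<And>i. i \<le> n \<Longrightarrow> \<omega> i = \<omega>' i) \<Longrightarrow> P \<omega> = P \<omega>'"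
    and AE: "AE \<omega> in path_measure M \<sigma>. \<forall>x\<in>set_pmf (path_step M \<sigma> n \<omega>). P (fun_upd \<omega> n x)"
  shows "AE \<omega> in path_measure M \<sigma>. P \<omega>"
proof -
  let ?F = "\<lambda>\<omega>. indicator {\<omega>. \<not> P \<omega>} \<omega> :: ennreal"
  have "?F \<omega> = ?F \<omega>'" if "\<And>i. i < Suc n \<Longrightarrow> \<omega> i = \<omega>' i" for \<omega> \<omega>'
    using P[of \<omega> \<omega>'] that by (simp add: indicator_def)
  then have meas: "?F \<in> borel_measurable (path_measure M \<sigma>)"
    by (rule measurable_path_measure) auto
  have "(\<integral>\<^sup>+ \<omega>. ?F \<omega> \<partial>path_measure M \<sigma>) =
      (\<integral>\<^sup>+ \<omega>. (\<integral>\<^sup>+ x. ?F (fun_upd \<omega> n x) \<partial>path_step M \<sigma> n \<omega>) \<partial>path_measure M \<sigma>)"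
  proof (rule nn_integral_path_step)
    show "?F \<omega> = ?F \<omega>'" if "\<And>i. i \<le> n \<Longrightarrow> \<omega> i = \<omega>' i" for \<omega> \<omega>'
      using P[OF that] by (simp add: indicator_def)
  qed
  also have "\<dots> = (\<integral>\<^sup>+ \<omega>. 0 \<partial>path_measure M \<sigma>)"
    using AE by (intro nn_integral_cong_AE)
      (auto elim!: eventually_mono simp: nn_integral_0_iff_AE AE_measure_pmf_iff)
  finally have "AE \<omega> in path_measure M \<sigma>. ?F \<omega> = 0"
    using meas by (simp add: nn_integral_0_iff_AE)
  then show ?thesis
    by (auto elim!: eventually_mono simp: indicator_def split: if_splits)
qed

text \<open>With all null sets collected here, later comparisons are pointwise statements about a
  single valid path. Validity includes membership in the support of \<open>\<sigma>\<close>, because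
  the lower bound holds only along actions that the scheduler really chooses.\<close>

lemma AE_valid_path: "AE \<omega> in path_measure M \<sigma>. valid_path M \<sigma> \<omega>"
proof -
  define ok where "ok n \<omega> \<longleftrightarrow> fst (\<omega> n) \<in> states M \<and> (case snd (\<omega> n) of None \<Rightarrow> enabled M (fst (\<omega> n)) = {}
    | Some a \<Rightarrow> a \<in> enabled M (fst (\<omega> n)) \<and> a \<in> set_pmf (\<sigma> (history \<omega> n) (fst (\<omega> n))))"
    for n and \<omega> :: "('s, 'a) path"
  have ok_cong: "ok n \<omega> = ok n \<omega>'" if "\<And>i. i \<le> n \<Longrightarrow> \<omega> i = \<omega>' i" for n \<omega> \<omega>'
  proof -
    have "\<omega> n = \<omega>' n" "history \<omega> n = history \<omega>' n"
      using that by (auto intro: history_cong)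
    then show ?thesis
      by (simp only: ok_def)
  qed
  have ok: "AE \<omega> in path_measure M \<sigma>. ok n \<omega>" for n
  proof (induction n)
    case 0
    have "init M \<in> states M"
      using M by (simp add: is_mdp_def)
    then have "ok 0 (fun_upd \<omega> 0 x)" if "x \<in> set_pmf (path_step M \<sigma> 0 \<omega>)" for \<omega> x
      using set_pmf_choose_action[OF \<sigma>, of "init M" x "[]"] that by (auto simp: ok_def split: option.splits)
    then have "AE \<omega> in path_measure M \<sigma>. \<forall>x\<in>set_pmf (path_step M \<sigma> 0 \<omega>). ok 0 (fun_upd \<omega> 0 x)"
      by (intro always_eventually allI ballI)
    with ok_cong show ?case
      by (rule AE_path_step)
  next
    case (Suc n)
    have "ok (Suc n) (fun_upd \<omega> (Suc n) x)"
      if "ok n \<omega>" and x: "x \<in> set_pmf (path_step M \<sigma> (Suc n) \<omega>)" for \<omega> x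
    proof (cases "snd (\<omega> n)")
      case None
      then show ?thesis
        using \<open>ok n \<omega>\<close> x by (cases "\<omega> n") (simp add: ok_def)
    next
      case (Some a)
      then obtain t where t: "t \<in> set_pmf (next_state M (fst (\<omega> n)) a)"
        and xt: "x \<in> set_pmf (choose_action M \<sigma> (history \<omega> (Suc n)) t)"
        using x by (cases "\<omega> n") auto
      have "t \<in> states M"
        using set_pmf_next_state[OF M, of "fst (\<omega> n)" a] \<open>ok n \<omega>\<close> Some t by (auto simp: ok_def)
      from set_pmf_choose_action[OF \<sigma> this xt] this show ?thesis
        unfolding ok_def by (simp only: history_fun_upd fun_upd_same)
    qed
    with Suc have "AE \<omega> in path_measure M \<sigma>. \<forall>x\<in>set_pmf (path_step M \<sigma> (Suc n) \<omega>). ok (Suc n) (fun_upd \<omega> (Suc n) x)"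
      by (auto elim!: eventually_mono)
    with ok_cong show ?case
      by (rule AE_path_step)
  qed
  \<comment> \<open>Staying in a terminal state concerns two consecutive coordinates; it is read off
    directly from the step at \<open>Suc n\<close>, without induction.\<close>
  have stop: "AE \<omega> in path_measure M \<sigma>. snd (\<omega> n) = None \<longrightarrow> \<omega> (Suc n) = \<omega> n" for n
  proof (rule AE_path_step[of "Suc n"])
    have "snd (fun_upd \<omega> (Suc n) x n) = None \<longrightarrow> fun_upd \<omega> (Suc n) x (Suc n) = fun_upd \<omega> (Suc n) x n"
      if "x \<in> set_pmf (path_step M \<sigma> (Suc n) \<omega>)" for x \<omega>
      using that by (cases "\<omega> n") auto
    then show "AE \<omega> in path_measure M \<sigma>. \<forall>x\<in>set_pmf (path_step M \<sigma> (Suc n) \<omega>).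
        snd (fun_upd \<omega> (Suc n) x n) = None \<longrightarrow> fun_upd \<omega> (Suc n) x (Suc n) = fun_upd \<omega> (Suc n) x n"
      by (intro always_eventually allI ballI)
  qed auto
  have "AE \<omega> in path_measure M \<sigma>. \<forall>n. ok n \<omega> \<and> (snd (\<omega> n) = None \<longrightarrow> \<omega> (Suc n) = \<omega> n)"
    using ok stop by (simp add: AE_all_countable)
  then show ?thesis
  proof (rule eventually_mono)
    fix \<omega>
    assume *: "\<forall>n. ok n \<omega> \<and> (snd (\<omega> n) = None \<longrightarrow> \<omega> (Suc n) = \<omega> n)"
    show "valid_path M \<sigma> \<omega>"
      unfolding valid_path_def
    proof
      fix n
      show "fst (\<omega> n) \<in> states M \<and>
          (case snd (\<omega> n) of
            None \<Rightarrow> enabled M (fst (\<omega> n)) = {} \<and> \<omega> (Suc n) = \<omega> n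
          | Some a \<Rightarrow> a \<in> enabled M (fst (\<omega> n)) \<and> a \<in> set_pmf (\<sigma> (history \<omega> n) (fst (\<omega> n))))"
        using *[rule_format, of n] by (cases "snd (\<omega> n)") (simp_all add: ok_def)
    qed
  qed
qed

text \<open>The Markov property for functionals of history and current state. A stopped path keeps
  extending its history by entries whose action is \<open>the None\<close>; the hypothesis
  \<open>stop\<close> makes \<open>\<Phi>\<close> blind to them.\<close>

lemma nn_integral_path_Suc:
  fixes \<Phi> :: "('s \<times> 'a) list \<Rightarrow> 's \<Rightarrow> ennreal"
  assumes stop: "\<And>h s a. s \<in> states M \<Longrightarrow> enabled M s = {} \<Longrightarrow> \<Phi> (h @ [(s, a)]) s = \<Phi> h s"
  shows "(\<integral>\<^sup>+ \<omega>. \<Phi> (history \<omega> (Suc n)) (fst (\<omega> (Suc n))) \<partial>path_measure M \<sigma>) =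
    (\<integral>\<^sup>+ \<omega>. (case \<omega> n of (s, None) \<Rightarrow> \<Phi> (history \<omega> n) s
      | (s, Some a) \<Rightarrow> \<Sum>t\<in>states M. ennreal (real_of_rat (prob M s a t)) * \<Phi> (history \<omega> n @ [(s, a)]) t)
      \<partial>path_measure M \<sigma>)"
proof -
  have "(\<integral>\<^sup>+ \<omega>. \<Phi> (history \<omega> (Suc n)) (fst (\<omega> (Suc n))) \<partial>path_measure M \<sigma>) =
    (\<integral>\<^sup>+ \<omega>. \<integral>\<^sup>+ x. \<Phi> (history (fun_upd \<omega> (Suc n) x) (Suc n)) (fst (fun_upd \<omega> (Suc n) x (Suc n)))
      \<partial>path_step M \<sigma> (Suc n) \<omega> \<partial>path_measure M \<sigma>)"
  proof (rule nn_integral_path_step)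
    fix \<omega> \<omega>' :: "('s, 'a) path"
    assume "\<And>i. i \<le> Suc n \<Longrightarrow> \<omega> i = \<omega>' i"
    then show "\<Phi> (history \<omega> (Suc n)) (fst (\<omega> (Suc n))) = \<Phi> (history \<omega>' (Suc n)) (fst (\<omega>' (Suc n)))"
      using history_cong[of "Suc n" \<omega> \<omega>'] by simp
  qed
  also have "\<dots> = (\<integral>\<^sup>+ \<omega>. (case \<omega> n of (s, None) \<Rightarrow> \<Phi> (history \<omega> n) s
      | (s, Some a) \<Rightarrow> \<Sum>t\<in>states M. ennreal (real_of_rat (prob M s a t)) * \<Phi> (history \<omega> n @ [(s, a)]) t)
      \<partial>path_measure M \<sigma>)"
  proof (rule nn_integral_cong_AE, use AE_valid_path in eventually_elim)
    fix \<omega>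
    assume v: "valid_path M \<sigma> \<omega>"
    obtain s oa where \<omega>n: "\<omega> n = (s, oa)"
      by (cases "\<omega> n")
    have s: "s \<in> states M"
      using v \<omega>n by (rule valid_path_state)
    show "(\<integral>\<^sup>+ x. \<Phi> (history (fun_upd \<omega> (Suc n) x) (Suc n)) (fst (fun_upd \<omega> (Suc n) x (Suc n)))
        \<partial>path_step M \<sigma> (Suc n) \<omega>) =
      (case \<omega> n of (s, None) \<Rightarrow> \<Phi> (history \<omega> n) s
      | (s, Some a) \<Rightarrow> \<Sum>t\<in>states M. ennreal (real_of_rat (prob M s a t)) * \<Phi> (history \<omega> n @ [(s, a)]) t)"
    proof (cases oa)
      case None
      then have "enabled M s = {}"
        using valid_path_None[OF v] \<omega>n by blast
      then show ?thesis
        using None \<omega>n s stop by simp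
    next
      case (Some a)
      then have a: "a \<in> enabled M s"
        using valid_path_Some[OF v] \<omega>n by blast
      have "(\<integral>\<^sup>+ x. \<Phi> (history (fun_upd \<omega> (Suc n) x) (Suc n)) (fst (fun_upd \<omega> (Suc n) x (Suc n)))
          \<partial>path_step M \<sigma> (Suc n) \<omega>) =
        (\<integral>\<^sup>+ t. \<integral>\<^sup>+ x. \<Phi> (history \<omega> n @ [(s, a)]) (fst x) \<partial>choose_action M \<sigma> (history \<omega> (Suc n)) t
          \<partial>next_state M s a)"
        using \<omega>n Some by simp
      also have "\<dots> = (\<integral>\<^sup>+ t. \<integral>\<^sup>+ x. \<Phi> (history \<omega> n @ [(s, a)]) t \<partial>choose_action M \<sigma> (history \<omega> (Suc n)) t
          \<partial>next_state M s a)"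
        by (intro nn_integral_cong nn_integral_cong_AE) (auto simp: AE_measure_pmf_iff dest: fst_choose_action)
      also have "\<dots> = (\<Sum>t\<in>states M. ennreal (real_of_rat (prob M s a t)) * \<Phi> (history \<omega> n @ [(s, a)]) t)"
        by (simp add: nn_integral_next_state[OF M s a] measure_pmf.emeasure_space_1[simplified])
      finally show ?thesis
        using \<omega>n Some by simp
    qed
  qed
  finally show ?thesis .
qed

lemma measurable_history_state:
  "(\<lambda>\<omega>. F (history \<omega> n) (\<omega> n)) \<in> borel_measurable (path_measure M \<sigma>)"
proof (rule measurable_path_measure[of "Suc n"])
  fix \<omega> \<omega>' :: "('s, 'a) path"
  assume "\<And>i. i < Suc n \<Longrightarrow> \<omega> i = \<omega>' i"
  then show "F (history \<omega> n) (\<omega> n) = F (history \<omega>' n) (\<omega>' n)"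
    using history_cong[of n \<omega> \<omega>'] by simp
qed auto

lemma nn_integral_path_0:
  "(\<integral>\<^sup>+ \<omega>. \<Phi> (history \<omega> 0) (fst (\<omega> 0)) \<partial>path_measure M \<sigma>) = \<Phi> [] (init M)"
proof -
  interpret prob_space "path_measure M \<sigma>"
    by (rule prob_space_path_measure)
  have "AE \<omega> in path_measure M \<sigma>. fst (\<omega> 0) = init M"
    by (rule AE_path_step[of 0]) (auto dest: fst_choose_action)
  then have "(\<integral>\<^sup>+ \<omega>. \<Phi> (history \<omega> 0) (fst (\<omega> 0)) \<partial>path_measure M \<sigma>) = (\<integral>\<^sup>+ \<omega>. \<Phi> [] (init M) \<partial>path_measure M \<sigma>)"
    by (intro nn_integral_cong_AE) (auto elim!: eventually_mono)
  also have "\<dots> = \<Phi> [] (init M)"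
    by (simp add: emeasure_space_1[simplified])
  finally show ?thesis .
qed

text \<open>One induction serves two purposes: \<open>\<rho> = 1\<close> is the supermartingale
  inequality of the upper bound, \<open>\<rho> < 1\<close> the geometric decay behind termination
  and the error term of the lower bound. In the second case \<open>stop'\<close> forces finite
  values at terminal states to vanish.\<close>

lemma nn_integral_path_contraction:
  fixes \<Phi> :: "('s \<times> 'a) list \<Rightarrow> 's \<Rightarrow> ennreal"
  assumes stop: "\<And>h s a. s \<in> states M \<Longrightarrow> enabled M s = {} \<Longrightarrow> \<Phi> (h @ [(s, a)]) s = \<Phi> h s"
    and stop': "\<And>h s. s \<in> states M \<Longrightarrow> enabled M s = {} \<Longrightarrow> \<Phi> h s \<le> \<rho> * \<Phi> h s"
    and step: "\<And>h s a. s \<in> states M \<Longrightarrow> a \<in> enabled M s \<Longrightarrow> 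
      (\<Sum>t\<in>states M. ennreal (real_of_rat (prob M s a t)) * \<Phi> (h @ [(s, a)]) t) \<le> \<rho> * \<Phi> h s"
  shows "(\<integral>\<^sup>+ \<omega>. \<Phi> (history \<omega> n) (fst (\<omega> n)) \<partial>path_measure M \<sigma>) \<le> \<rho> ^ n * \<Phi> [] (init M)"
proof (induction n)
  case 0
  show ?case
    using nn_integral_path_0[of \<Phi>] by simp
next
  case (Suc n)
  note nn_integral_path_Suc[of \<Phi> n, OF stop]
  also have "(\<integral>\<^sup>+ \<omega>. (case \<omega> n of (s, None) \<Rightarrow> \<Phi> (history \<omega> n) s
      | (s, Some a) \<Rightarrow> \<Sum>t\<in>states M. ennreal (real_of_rat (prob M s a t)) * \<Phi> (history \<omega> n @ [(s, a)]) t)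
      \<partial>path_measure M \<sigma>) \<le>
      (\<integral>\<^sup>+ \<omega>. \<rho> * \<Phi> (history \<omega> n) (fst (\<omega> n)) \<partial>path_measure M \<sigma>)"
  proof (rule nn_integral_mono_AE, use AE_valid_path in eventually_elim)
    fix \<omega>
    assume v: "valid_path M \<sigma> \<omega>"
    show "(case \<omega> n of (s, None) \<Rightarrow> \<Phi> (history \<omega> n) s
      | (s, Some a) \<Rightarrow> \<Sum>t\<in>states M. ennreal (real_of_rat (prob M s a t)) * \<Phi> (history \<omega> n @ [(s, a)]) t)
      \<le> \<rho> * \<Phi> (history \<omega> n) (fst (\<omega> n))"
    proof (cases "\<omega> n")
      case (Pair s x)
      note s = valid_path_state[OF v Pair]
      show ?thesis
      proof (cases x)
        case None
        then show ?thesis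
          using valid_path_None[OF v] Pair stop'[OF s, of "history \<omega> n"] by simp
      next
        case (Some a)
        then show ?thesis
          using valid_path_Some[OF v, of n s a] Pair step[OF s, of a "history \<omega> n"] by simp
      qed
    qed
  qed
  also have "\<dots> = \<rho> * (\<integral>\<^sup>+ \<omega>. \<Phi> (history \<omega> n) (fst (\<omega> n)) \<partial>path_measure M \<sigma>)"
    using measurable_history_state[of "\<lambda>h x. \<Phi> h (fst x)" n] by (rule nn_integral_cmult)
  also have "\<dots> \<le> \<rho> * (\<rho> ^ n * \<Phi> [] (init M))"
    by (rule mult_left_mono[OF Suc]) simp
  finally show ?case
    by (simp add: mult.assoc)
qed

text \<open>The reverse inequality is required only for actions in the support of the scheduler,
  which is what allows one good scheduler to be certified.\<close>

lemma nn_integral_path_submartingale: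
  fixes \<Phi> :: "('s \<times> 'a) list \<Rightarrow> 's \<Rightarrow> ennreal"
  assumes stop: "\<And>h s a. s \<in> states M \<Longrightarrow> enabled M s = {} \<Longrightarrow> \<Phi> (h @ [(s, a)]) s = \<Phi> h s"
    and step: "\<And>h s a. s \<in> states M \<Longrightarrow> a \<in> enabled M s \<Longrightarrow> a \<in> set_pmf (\<sigma> h s) \<Longrightarrow>
      \<Phi> h s \<le> (\<Sum>t\<in>states M. ennreal (real_of_rat (prob M s a t)) * \<Phi> (h @ [(s, a)]) t)"
  shows "\<Phi> [] (init M) \<le> (\<integral>\<^sup>+ \<omega>. \<Phi> (history \<omega> n) (fst (\<omega> n)) \<partial>path_measure M \<sigma>)"
proof (induction n)
  case 0
  show ?case
    using nn_integral_path_0[of \<Phi>] by simp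
next
  case (Suc n)
  also have "(\<integral>\<^sup>+ \<omega>. \<Phi> (history \<omega> n) (fst (\<omega> n)) \<partial>path_measure M \<sigma>) \<le>
    (\<integral>\<^sup>+ \<omega>. (case \<omega> n of (s, None) \<Rightarrow> \<Phi> (history \<omega> n) s
      | (s, Some a) \<Rightarrow> \<Sum>t\<in>states M. ennreal (real_of_rat (prob M s a t)) * \<Phi> (history \<omega> n @ [(s, a)]) t)
      \<partial>path_measure M \<sigma>)"
  proof (rule nn_integral_mono_AE, use AE_valid_path in eventually_elim)
    fix \<omega>
    assume v: "valid_path M \<sigma> \<omega>"
    show "\<Phi> (history \<omega> n) (fst (\<omega> n)) \<le> (case \<omega> n of (s, None) \<Rightarrow> \<Phi> (history \<omega> n) s
      | (s, Some a) \<Rightarrow> \<Sum>t\<in>states M. ennreal (real_of_rat (prob M s a t)) * \<Phi> (history \<omega> n @ [(s, a)]) t)"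
    proof (cases "\<omega> n")
      case (Pair s x)
      note s = valid_path_state[OF v Pair]
      show ?thesis
      proof (cases x)
        case None
        then show ?thesis
          using valid_path_None[OF v] Pair by simp
      next
        case (Some a)
        then show ?thesis
          using valid_path_Some[OF v, of n s a] Pair step[OF s, of a "history \<omega> n"] by simp
      qed
    qed
  qed
  also have "\<dots> = (\<integral>\<^sup>+ \<omega>. \<Phi> (history \<omega> (Suc n)) (fst (\<omega> (Suc n))) \<partial>path_measure M \<sigma>)"
    by (rule nn_integral_path_Suc[of \<Phi> n, OF stop, symmetric])
  finally show ?case .
qed

end

section \<open>Comparing the payoff with functionals of stopped paths\<close>

definition stopped_payoff :: "('s, 'a) mdp \<Rightarrow> nat \<Rightarrow> ('s, 'a) path \<Rightarrow> ennreal" where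
  "stopped_payoff M n \<omega> =
    (if snd (\<omega> n) \<noteq> None then 0
     else if fst (\<omega> n) = goal M then of_nat (history_weight (wgt_goal M) (history \<omega> n))
     else of_nat (history_weight (wgt_fail M) (history \<omega> n)))"

lemma history_weight_history:
  "history_weight w (history \<omega> n) = (\<Sum>i<n. w (fst (\<omega> i)) (the (snd (\<omega> i))))"
  by (induction n) auto

lemma valid_path_stays:
  assumes "valid_path M \<sigma> \<omega>" "snd (\<omega> n) = None" "n \<le> m"
  shows "\<omega> m = \<omega> n"
  using assms(3)
proof (induction rule: dec_induct)
  case (step m)
  then have "\<omega> m = (fst (\<omega> n), None)"
    using assms(2) by (simp add: prod_eq_iff)
  with step.IH valid_path_None[OF assms(1), of m "fst (\<omega> n)"] show ?case
    by (metis (no_types))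
qed auto

lemma valid_path_terminal:
  assumes "valid_path M \<sigma> \<omega>" "enabled M (fst (\<omega> n)) = {}"
  shows "snd (\<omega> n) = None"
  using valid_path_Some[OF assms(1), of n "fst (\<omega> n)" "the (snd (\<omega> n))"] assms(2)
  by (cases "snd (\<omega> n)") (auto simp: prod_eq_iff)

lemma sets_path_coordinate:
  fixes M :: "('s :: countable, 'a :: countable) mdp"
  shows "{\<omega> \<in> space (path_measure M \<sigma>). P (\<omega> n)} \<in> sets (path_measure M \<sigma>)"
proof -
  have "(\<lambda>\<omega>. P (\<omega> n)) \<in> measurable (path_measure M \<sigma>) (count_space UNIV)"
    by (rule measurable_path_measure[of "Suc n"]) auto
  then show ?thesis
    by (simp add: pred_def)
qed

context
  fixes M :: "('s :: countable, 'a :: countable) mdp" and \<sigma> :: "('s, 'a) scheduler"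
  assumes M: "is_mdp M" and \<sigma>: "\<sigma> \<in> schedulers M"
    and terminal: "\<And>s. s \<in> states M \<Longrightarrow> enabled M s = {} \<Longrightarrow> s = goal M \<or> s = fail M"
    and weights: "\<And>s a. s \<in> states M \<Longrightarrow> enabled M s = {} \<Longrightarrow> wgt_goal M s a = 0 \<and> wgt_fail M s a = 0"
begin

text \<open>A path never leaves a terminal state, so of two terminal positions the earlier one
  determines the later one.\<close>

lemma reaches_stopped:
  assumes v: "valid_path M \<sigma> \<omega>" and n: "snd (\<omega> n) = None" and t: "enabled M t = {}"
  shows "reaches \<omega> {t} \<longleftrightarrow> fst (\<omega> n) = t"
proof
  assume "reaches \<omega> {t}"
  then obtain i where i: "fst (\<omega> i) = t"
    by (auto simp: reaches_def)
  then have i': "snd (\<omega> i) = None"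
    using valid_path_terminal[OF v] t by blast
  show "fst (\<omega> n) = t"
    using valid_path_stays[OF v n, of i] valid_path_stays[OF v i', of n] i by (cases "n \<le> i") auto
qed (auto simp: reaches_def)

lemma path_weight_stopped:
  assumes v: "valid_path M \<sigma> \<omega>" and n: "snd (\<omega> n) = None"
    and w: "\<And>s a. s \<in> states M \<Longrightarrow> enabled M s = {} \<Longrightarrow> w s a = 0"
  shows "path_weight w \<omega> = of_nat (history_weight w (history \<omega> n))"
proof -
  \<comment> \<open>A path weight ignores \<open>None\<close>, a history records it as the action
    \<open>the None\<close>; the two agree because weights vanish at terminal states.\<close>
  have eq: "(case \<omega> i of (s, None) \<Rightarrow> 0 | (s, Some a) \<Rightarrow> of_nat (w s a)) =
      (of_nat (w (fst (\<omega> i)) (the (snd (\<omega> i)))) :: ennreal)" for i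
  proof (cases "\<omega> i")
    case (Pair s x)
    then show ?thesis
      using valid_path_None[OF v, of i s] valid_path_state[OF v Pair] w by (cases x) auto
  qed
  have "path_weight w \<omega> = (\<Sum>i<n. of_nat (w (fst (\<omega> i)) (the (snd (\<omega> i)))))"
    unfolding path_weight_def
  proof (subst suminf_finite[of "{..<n}"])
    fix i
    assume "i \<notin> {..<n}"
    then have "\<omega> i = (fst (\<omega> n), None)"
      using valid_path_stays[OF v n, of i] n by (simp add: prod_eq_iff)
    then show "(case \<omega> i of (s, None) \<Rightarrow> 0 | (s, Some a) \<Rightarrow> of_nat (w s a)) = (0 :: ennreal)"
      by simp
  qed (simp_all add: eq)
  then show ?thesis
    by (simp add: history_weight_history)
qed

lemma payoff_stopped:
  assumes v: "valid_path M \<sigma> \<omega>" and n: "snd (\<omega> n) = None"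
  shows "payoff M \<omega> = stopped_payoff M n \<omega>"
proof -
  have gf: "enabled M (goal M) = {}" "enabled M (fail M) = {}"
    using M by (simp_all add: is_mdp_def)
  have "\<omega> n = (fst (\<omega> n), None)"
    using n by (simp add: prod_eq_iff)
  then have "fst (\<omega> n) = goal M \<or> fst (\<omega> n) = fail M"
    using valid_path_None[OF v] valid_path_state[OF v] terminal by metis
  then show ?thesis
    using n reaches_stopped[OF v n gf(1)] reaches_stopped[OF v n gf(2)]
      path_weight_stopped[OF v n, of "wgt_goal M"] path_weight_stopped[OF v n, of "wgt_fail M"] weights
    by (auto simp: payoff_def stopped_payoff_def)
qed

lemma payoff_unstopped:
  assumes v: "valid_path M \<sigma> \<omega>" and n: "\<And>n. snd (\<omega> n) \<noteq> None"
  shows "payoff M \<omega> = 0"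
proof -
  have "enabled M (goal M) = {}" "enabled M (fail M) = {}"
    using M by (simp_all add: is_mdp_def)
  then have "\<not> reaches \<omega> {goal M}" "\<not> reaches \<omega> {fail M}"
    using valid_path_terminal[OF v] n by (auto simp: reaches_def) metis+
  then show ?thesis
    by (simp add: payoff_def)
qed

text \<open>Fatou's lemma passes the supermartingale bound to the limit: on a stopped path the
  payoff is eventually dominated by \<open>\<Phi>\<close>, and on a path that never stops it is 0.
  Nonnegativity of \<open>\<Phi>\<close> thus takes the place of uniform integrability.\<close>

lemma nn_integral_payoff_le:
  fixes \<Phi> :: "('s \<times> 'a) list \<Rightarrow> 's \<Rightarrow> ennreal"
  assumes stop: "\<And>h s a. s \<in> states M \<Longrightarrow> enabled M s = {} \<Longrightarrow> \<Phi> (h @ [(s, a)]) s = \<Phi> h s"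
    and goal: "\<And>h. of_nat (history_weight (wgt_goal M) h) \<le> \<Phi> h (goal M)"
    and fail: "\<And>h. of_nat (history_weight (wgt_fail M) h) \<le> \<Phi> h (fail M)"
    and step: "\<And>h s a. s \<in> states M \<Longrightarrow> a \<in> enabled M s \<Longrightarrow>
      (\<Sum>t\<in>states M. ennreal (real_of_rat (prob M s a t)) * \<Phi> (h @ [(s, a)]) t) \<le> \<Phi> h s"
  shows "(\<integral>\<^sup>+ \<omega>. payoff M \<omega> \<partial>path_measure M \<sigma>) \<le> \<Phi> [] (init M)"
proof -
  let ?Z = "\<lambda>n \<omega>. \<Phi> (history \<omega> n) (fst (\<omega> n))"
  have Z: "(\<integral>\<^sup>+ \<omega>. ?Z n \<omega> \<partial>path_measure M \<sigma>) \<le> \<Phi> [] (init M)" for n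
    using nn_integral_path_contraction[OF M \<sigma> stop, of 1 n] step by simp
  have "(\<integral>\<^sup>+ \<omega>. payoff M \<omega> \<partial>path_measure M \<sigma>) \<le> (\<integral>\<^sup>+ \<omega>. liminf (\<lambda>n. ?Z n \<omega>) \<partial>path_measure M \<sigma>)"
  proof (rule nn_integral_mono_AE, use AE_valid_path[OF M \<sigma>] in eventually_elim)
    fix \<omega>
    assume v: "valid_path M \<sigma> \<omega>"
    show "payoff M \<omega> \<le> liminf (\<lambda>n. ?Z n \<omega>)"
    proof (cases "\<exists>n. snd (\<omega> n) = None")
      case True
      then obtain n where n: "snd (\<omega> n) = None"
        by blast
      have "payoff M \<omega> \<le> ?Z m \<omega>" if "n \<le> m" for m
      proof -
        have m: "snd (\<omega> m) = None"
          using valid_path_stays[OF v n that] n by simp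
        then have "fst (\<omega> m) = goal M \<or> fst (\<omega> m) = fail M"
          using valid_path_None[OF v, of m "fst (\<omega> m)"] valid_path_state[OF v, of m "fst (\<omega> m)"] terminal
          by (metis prod.collapse)
        then show ?thesis
          using payoff_stopped[OF v m] m goal[of "history \<omega> m"] fail[of "history \<omega> m"]
          by (auto simp: stopped_payoff_def)
      qed
      then show ?thesis
        by (intro Liminf_bounded) (auto simp: eventually_sequentially)
    qed (use payoff_unstopped[OF v] in auto)
  qed
  also have "\<dots> \<le> liminf (\<lambda>n. \<integral>\<^sup>+ \<omega>. ?Z n \<omega> \<partial>path_measure M \<sigma>)"
    using measurable_history_state[OF M \<sigma>, of "\<lambda>h x. \<Phi> h (fst x)"] by (intro nn_integral_liminf)
  also have "\<dots> \<le> liminf (\<lambda>n. \<Phi> [] (init M))"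
    using Z by (intro Liminf_mono) auto
  also have "\<dots> = \<Phi> [] (init M)"
    by (simp add: Liminf_const)
  finally show ?thesis .
qed

section \<open>Geometric decay of a Lyapunov function\<close>

context
  fixes U :: "('s \<times> 'a) list \<Rightarrow> 's \<Rightarrow> real" and r :: real
  assumes r: "0 \<le> r" "r < 1"
    and U_stop: "\<And>h s. s \<in> states M \<Longrightarrow> enabled M s = {} \<Longrightarrow> U h s = 0"
    and U_ge_1: "\<And>h s. s \<in> states M \<Longrightarrow> enabled M s \<noteq> {} \<Longrightarrow> 1 \<le> U h s"
    and U_step: "\<And>h s a. s \<in> states M \<Longrightarrow> a \<in> enabled M s \<Longrightarrow>
      (\<Sum>t\<in>states M. real_of_rat (prob M s a t) * U (h @ [(s, a)]) t) \<le> r * U h s"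
begin

lemma U_nonneg: "s \<in> states M \<Longrightarrow> 0 \<le> U h s"
  using U_stop U_ge_1 by (metis zero_le_one order.refl order.trans)

lemma nn_integral_U:
  "(\<integral>\<^sup>+ \<omega>. ennreal (U (history \<omega> n) (fst (\<omega> n))) \<partial>path_measure M \<sigma>) \<le> ennreal (r ^ n * U [] (init M))"
proof -
  have init: "init M \<in> states M" and fin: "finite (states M)" and p: "\<And>s a t. 0 \<le> prob M s a t"
    using M by (simp_all add: is_mdp_def)
  have "(\<integral>\<^sup>+ \<omega>. ennreal (U (history \<omega> n) (fst (\<omega> n))) \<partial>path_measure M \<sigma>) \<le> ennreal r ^ n * ennreal (U [] (init M))"
  proof (rule nn_integral_path_contraction[OF M \<sigma>])
    fix h s a
    assume s: "s \<in> states M" and a: "a \<in> enabled M s"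
    have "(\<Sum>t\<in>states M. ennreal (real_of_rat (prob M s a t)) * ennreal (U (h @ [(s, a)]) t)) =
        ennreal (\<Sum>t\<in>states M. real_of_rat (prob M s a t) * U (h @ [(s, a)]) t)"
      using p by (subst sum_ennreal[symmetric]) (auto simp: ennreal_mult U_nonneg)
    also have "\<dots> \<le> ennreal (r * U h s)"
      by (intro ennreal_leI U_step s a)
    also have "\<dots> = ennreal r * ennreal (U h s)"
      using r s by (simp add: ennreal_mult U_nonneg)
    finally show "(\<Sum>t\<in>states M. ennreal (real_of_rat (prob M s a t)) * ennreal (U (h @ [(s, a)]) t))
      \<le> ennreal r * ennreal (U h s)" .
  qed (simp_all add: U_stop)
  also have "\<dots> = ennreal (r ^ n * U [] (init M))"
    using r by (simp add: ennreal_mult U_nonneg[OF init] ennreal_power)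
  finally show ?thesis .
qed

lemma U_tendsto: "(\<lambda>n. ennreal (r ^ n * U [] (init M))) \<longlonglongrightarrow> 0"
proof -
  have "(\<lambda>n. r ^ n * U [] (init M)) \<longlonglongrightarrow> 0 * U [] (init M)"
    using r by (intro tendsto_mult LIMSEQ_realpow_zero tendsto_const) auto
  then show ?thesis
    using tendsto_ennrealI[of "\<lambda>n. r ^ n * U [] (init M)" 0 sequentially] by simp
qed

text \<open>\<open>U\<close> is at least 1 as long as the path runs, so the probability of still
  running at time \<open>n\<close> is at most the expectation of \<open>U\<close>, which decays like
  \<open>r ^ n\<close>.\<close>

lemma AE_stopped: "AE \<omega> in path_measure M \<sigma>. \<exists>n. snd (\<omega> n) = None"
proof -
  have "{\<omega> \<in> space (path_measure M \<sigma>). \<forall>n. snd (\<omega> n) \<noteq> None} \<in> sets (path_measure M \<sigma>)"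
    by (intro sets.sets_Collect_countable_All sets_path_coordinate)
  then have meas: "{\<omega>. \<forall>n. snd (\<omega> n) \<noteq> None} \<in> sets (path_measure M \<sigma>)"
    by simp
  let ?N = "{\<omega>. \<forall>n. snd (\<omega> n) \<noteq> None}"
  have "emeasure (path_measure M \<sigma>) ?N \<le> ennreal (r ^ n * U [] (init M))" for n
  proof -
    have "emeasure (path_measure M \<sigma>) ?N = (\<integral>\<^sup>+ \<omega>. indicator ?N \<omega> \<partial>path_measure M \<sigma>)"
      using meas by simp
    also have "\<dots> \<le> (\<integral>\<^sup>+ \<omega>. ennreal (U (history \<omega> n) (fst (\<omega> n))) \<partial>path_measure M \<sigma>)"
    proof (rule nn_integral_mono_AE, use AE_valid_path[OF M \<sigma>] in eventually_elim)
      fix \<omega>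
      assume v: "valid_path M \<sigma> \<omega>"
      show "indicator ?N \<omega> \<le> ennreal (U (history \<omega> n) (fst (\<omega> n)))"
      proof (cases "snd (\<omega> n) = None")
        case False
        then obtain s a where sa: "\<omega> n = (s, Some a)"
          by (metis option.collapse prod.collapse)
        then have "enabled M s \<noteq> {}"
          using valid_path_Some[OF v] by blast
        then have "1 \<le> U (history \<omega> n) (fst (\<omega> n))"
          using U_ge_1 valid_path_state[OF v sa] sa by simp
        then show ?thesis
          by (auto simp: indicator_def simp flip: ennreal_1 intro!: ennreal_leI)
      next
        case True
        then have "\<omega> \<notin> ?N"
          by (metis (mono_tags, lifting) mem_Collect_eq)
        then show ?thesis
          by simp
      qed
    qed
    finally show ?thesis
      using nn_integral_U order_trans by blast
  qed
  then have "emeasure (path_measure M \<sigma>) ?N \<le> 0"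
    using U_tendsto by (intro LIMSEQ_le_const) auto
  then have "?N \<in> null_sets (path_measure M \<sigma>)"
    using meas by (auto simp: null_sets_def)
  then show ?thesis
    by (rule AE_I') auto
qed

lemma measure_reaches: "measure (path_measure M \<sigma>) {\<omega> \<in> space (path_measure M \<sigma>). reaches \<omega> {goal M, fail M}} = 1"
proof -
  interpret prob_space "path_measure M \<sigma>"
    by (rule prob_space_path_measure)
  have "{\<omega> \<in> space (path_measure M \<sigma>). \<exists>n. fst (\<omega> n) \<in> {goal M, fail M}} \<in> sets (path_measure M \<sigma>)"
    by (intro sets.sets_Collect_countable_Ex sets_path_coordinate)
  moreover have "AE \<omega> in path_measure M \<sigma>. \<exists>n. fst (\<omega> n) \<in> {goal M, fail M}"
    using AE_stopped AE_valid_path[OF M \<sigma>]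
  proof eventually_elim
    case (elim \<omega>)
    then obtain n where n: "\<omega> n = (fst (\<omega> n), None)"
      by (metis prod.collapse)
    then have "fst (\<omega> n) \<in> {goal M, fail M}"
      using valid_path_None[OF elim(2) n] valid_path_state[OF elim(2) n] terminal by blast
    then show ?case ..
  qed
  ultimately show ?thesis
    by (subst prob_Collect_eq_1) (simp_all add: reaches_def)
qed

text \<open>A submartingale alone bounds nothing in the limit, since mass could escape along running
  paths. By \<open>bound\<close> that mass is at most the expectation of \<open>U\<close>, which
  tends to 0.\<close>

lemma nn_integral_payoff_ge:
  fixes \<Phi> :: "('s \<times> 'a) list \<Rightarrow> 's \<Rightarrow> ennreal"
  assumes stop: "\<And>h s a. s \<in> states M \<Longrightarrow> enabled M s = {} \<Longrightarrow> \<Phi> (h @ [(s, a)]) s = \<Phi> h s"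
    and goal: "\<And>h. \<Phi> h (goal M) \<le> of_nat (history_weight (wgt_goal M) h)"
    and fail: "\<And>h. \<Phi> h (fail M) \<le> of_nat (history_weight (wgt_fail M) h)"
    and bound: "\<And>h s. s \<in> states M \<Longrightarrow> enabled M s \<noteq> {} \<Longrightarrow> \<Phi> h s \<le> ennreal (U h s)"
    and step: "\<And>h s a. s \<in> states M \<Longrightarrow> a \<in> enabled M s \<Longrightarrow> a \<in> set_pmf (\<sigma> h s) \<Longrightarrow>
      \<Phi> h s \<le> (\<Sum>t\<in>states M. ennreal (real_of_rat (prob M s a t)) * \<Phi> (h @ [(s, a)]) t)"
  shows "\<Phi> [] (init M) \<le> (\<integral>\<^sup>+ \<omega>. payoff M \<omega> \<partial>path_measure M \<sigma>)"
proof -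
  have "\<Phi> [] (init M) \<le> (\<integral>\<^sup>+ \<omega>. payoff M \<omega> \<partial>path_measure M \<sigma>) + ennreal (r ^ n * U [] (init M))" for n
  proof -
    have "\<Phi> [] (init M) \<le> (\<integral>\<^sup>+ \<omega>. \<Phi> (history \<omega> n) (fst (\<omega> n)) \<partial>path_measure M \<sigma>)"
      by (rule nn_integral_path_submartingale[OF M \<sigma> stop step])
    also have "\<dots> \<le> (\<integral>\<^sup>+ \<omega>. stopped_payoff M n \<omega> + ennreal (U (history \<omega> n) (fst (\<omega> n))) \<partial>path_measure M \<sigma>)"
    proof (rule nn_integral_mono_AE, use AE_valid_path[OF M \<sigma>] in eventually_elim)
      fix \<omega>
      assume v: "valid_path M \<sigma> \<omega>"
      note state = valid_path_state[OF v, of n "fst (\<omega> n)" "snd (\<omega> n)", OF prod.collapse[symmetric]]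
      show "\<Phi> (history \<omega> n) (fst (\<omega> n)) \<le> stopped_payoff M n \<omega> + ennreal (U (history \<omega> n) (fst (\<omega> n)))"
      proof (cases "enabled M (fst (\<omega> n)) = {}")
        case True
        then show ?thesis
          using valid_path_terminal[OF v True] terminal[OF state True]
            goal[of "history \<omega> n"] fail[of "history \<omega> n"] U_stop[OF state True]
          by (auto simp: stopped_payoff_def)
      next
        case False
        then show ?thesis
          using bound[OF state False] by (simp add: add_increasing)
      qed
    qed
    also have "\<dots> = (\<integral>\<^sup>+ \<omega>. stopped_payoff M n \<omega> \<partial>path_measure M \<sigma>) +
        (\<integral>\<^sup>+ \<omega>. ennreal (U (history \<omega> n) (fst (\<omega> n))) \<partial>path_measure M \<sigma>)"
    proof (rule nn_integral_add)
      show "stopped_payoff M n \<in> borel_measurable (path_measure M \<sigma>)"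
        using measurable_history_state[OF M \<sigma>, of "\<lambda>h x. if snd x \<noteq> None then 0
          else if fst x = goal M then of_nat (history_weight (wgt_goal M) h)
          else of_nat (history_weight (wgt_fail M) h) :: ennreal" n]
        unfolding stopped_payoff_def[abs_def] .
      show "(\<lambda>\<omega>. ennreal (U (history \<omega> n) (fst (\<omega> n)))) \<in> borel_measurable (path_measure M \<sigma>)"
        using measurable_history_state[OF M \<sigma>, of "\<lambda>h x. ennreal (U h (fst x))"] .
    qed
    also have "\<dots> \<le> (\<integral>\<^sup>+ \<omega>. payoff M \<omega> \<partial>path_measure M \<sigma>) + ennreal (r ^ n * U [] (init M))"
    proof (intro add_mono nn_integral_U nn_integral_mono_AE, use AE_valid_path[OF M \<sigma>] in eventually_elim)
      fix \<omega>
      assume v: "valid_path M \<sigma> \<omega>"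
      show "stopped_payoff M n \<omega> \<le> payoff M \<omega>"
        using payoff_stopped[OF v, of n] by (cases "snd (\<omega> n)") (auto simp: stopped_payoff_def)
    qed
    finally show ?thesis .
  qed
  moreover have "(\<lambda>n. (\<integral>\<^sup>+ \<omega>. payoff M \<omega> \<partial>path_measure M \<sigma>) + ennreal (r ^ n * U [] (init M)))
      \<longlonglongrightarrow> (\<integral>\<^sup>+ \<omega>. payoff M \<omega> \<partial>path_measure M \<sigma>) + 0"
    by (intro tendsto_add tendsto_const U_tendsto)
  ultimately show ?thesis
    by (intro LIMSEQ_le_const[where X="\<lambda>n. (\<integral>\<^sup>+ \<omega>. payoff M \<omega> \<partial>path_measure M \<sigma>) + ennreal (r ^ n * U [] (init M))"])
      auto
qed

end
end

section \<open>The decision process of a linear recurrence\<close>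

text \<open>
  States \<open>0\<close> and \<open>1\<close> are goal and fail, \<open>2\<close> is initial, \<open>3\<close> makes the final choice, \<open>4\<close> shifts \<open>d\<close> by
  \<open>2\<close>, \<open>5\<close> tosses the sign, \<open>6\<close> is the fair copy of the chain, \<open>7\<close> and \<open>8\<close> are the outcomes with
  sign \<open>-\<close> and \<open>+\<close>.  Entry \<open>2 * s + a\<close> lists the two weights of action \<open>a\<close> in state \<open>s\<close> and its
  equally likely successors; it is disabled if there are none.  State \<open>9 + 2 * i\<close> is state \<open>i\<close> of the
  chain with sign \<open>+\<close>, state \<open>10 + 2 * i\<close> the one with sign \<open>-\<close>.
\<close>

definition special_rows :: "(nat \<times> nat \<times> nat list) list" where
  "special_rows =
    [(0, 0, []), (0, 0, []),
     (0, 0, []), (0, 0, []),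
     (1, 0, [2, 9]), (1, 0, [2, 6]),
     (0, 0, [0]), (0, 0, [1]),
     (2, 0, [3]), (0, 0, []),
     (0, 0, [7, 8]), (0, 0, []),
     (0, 1, [6, 5]), (0, 0, []),
     (1, 1, [3]), (0, 0, []),
     (0, 1, [4, 3]), (0, 0, [])]"

definition chain_sign :: "nat \<Rightarrow> int" where
  "chain_sign s = (if odd s then 1 else - 1)"

definition chain_index :: "nat \<Rightarrow> nat" where
  "chain_index s = (s - 9) div 2"

text \<open>Half of the mass of a chain state is available for continuing. It is shared by
  \<open>k\<close> sign pairs, and a pair needs up to \<open>J / Q\<close> to realize a difference
  \<open>x / Q\<close> with \<open>x\<close> below \<open>J\<close> in absolute value; this leads to
  \<open>2 * k * J\<close>.\<close>

definition scale :: "nat \<Rightarrow> int \<Rightarrow> int" where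
  "scale k J = 2 * int k * J"

text \<open>
  The probabilities of a transition that keeps the sign and of the one that flips it are
  \<open>tilt k J x / (2 * Q * Q)\<close> and \<open>tilt k J (- x) / (2 * Q * Q)\<close> with \<open>Q = scale k J\<close>, which differ by
  \<open>x / Q\<close>.  Since \<open>Q\<close> is even and \<open>tilt k J x\<close> is \<open>1\<close> modulo \<open>Q\<close>, these fractions are in lowest
  terms, and the program can write them down without computing a gcd.
\<close>

definition tilt :: "nat \<Rightarrow> int \<Rightarrow> int \<Rightarrow> int" where
  "tilt k J x = scale k J * (J - 1) + 1 + scale k J * x"

text \<open>The targets 5 and 6 take the remaining mass, independently of the sign: 5, 7 and 8
  together get 1 / 2, and so do 6 and the chain states. The mass of 6 is
  \<open>k * (Q - 1) / (Q * Q)\<close>; it is written with denominator \<open>2 * J * Q\<close>,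
  because \<open>k\<close> divides \<open>Q\<close> and has to be cancelled.\<close>

definition chain_prob :: "nat \<Rightarrow> (nat \<Rightarrow> nat \<Rightarrow> int) \<Rightarrow> (nat \<Rightarrow> int) \<Rightarrow> int \<Rightarrow> nat \<Rightarrow> nat \<Rightarrow> rat" where
  "chain_prob k X B J s t = (let Q = scale k J in
    if t < 5 then 0
    else if t = 5 then of_int (Q * (int k * J - J + 1) - 1) / of_int (Q * Q)
    else if t = 6 then of_int (Q - 1) / of_int (2 * J * Q)
    else if t = 7 then of_int (tilt k J (chain_sign s * B (chain_index s))) / of_int (2 * Q * Q)
    else if t = 8 then of_int (tilt k J (- chain_sign s * B (chain_index s))) / of_int (2 * Q * Q)
    else of_int (tilt k J (chain_sign s * chain_sign t * X (chain_index s) (chain_index t))) / of_int (2 * Q * Q))"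

definition reduction_mdp :: "nat \<Rightarrow> (nat \<Rightarrow> nat \<Rightarrow> int) \<Rightarrow> (nat \<Rightarrow> int) \<Rightarrow> int \<Rightarrow> (nat, nat) mdp" where
  "reduction_mdp k X B J =
    \<lparr>states = {..<9 + 2 * k}, actions = {..<2},
     prob = (\<lambda>s a t.
       if \<not> (s < 9 + 2 * k \<and> a < 2 \<and> t < 9 + 2 * k) then 0
       else if s < 9 then
         (let ts = snd (snd (special_rows ! (2 * s + a)))
          in if t \<in> set ts then 1 / of_nat (length ts) else 0)
       else if a = 0 then chain_prob k X B J s t else 0),
     init = 2,
     wgt_goal = (\<lambda>s a. if s < 9 \<and> a < 2 then fst (special_rows ! (2 * s + a)) else 0),
     wgt_fail = (\<lambda>s a. if s < 9 \<and> a < 2 then fst (snd (special_rows ! (2 * s + a)))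
       else if s < 9 + 2 * k \<and> a = 0 then 1 else 0),
     goal = 0, fail = 1\<rparr>"

lemma reduction_mdp_simps [simp]:
  "states (reduction_mdp k X B J) = {..<9 + 2 * k}"
  "actions (reduction_mdp k X B J) = {..<2}"
  "init (reduction_mdp k X B J) = 2"
  "goal (reduction_mdp k X B J) = 0"
  "fail (reduction_mdp k X B J) = 1"
  by (simp_all add: reduction_mdp_def)

lemma sum_states:
  fixes f :: "nat \<Rightarrow> 'a :: comm_monoid_add"
  shows "(\<Sum>t<9 + 2 * k. f t) =
    f 0 + f 1 + f 2 + f 3 + f 4 + f 5 + f 6 + f 7 + f 8 + (\<Sum>l<k. f (9 + 2 * l) + f (10 + 2 * l))"
proof (induction k)
  case 0
  show ?case
    by (simp add: numeral_eq_Suc algebra_simps)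
next
  case (Suc k)
  have "{..<9 + 2 * Suc k} = insert (10 + 2 * k) (insert (9 + 2 * k) {..<9 + 2 * k})"
    by auto
  then show ?case
    using Suc by (simp add: algebra_simps)
qed

text \<open>Everything up to the value function works for an arbitrary integer matrix
  \<open>X\<close> and vector \<open>B\<close> with entries below \<open>J\<close>; the companion
  shape enters only when the bias is identified with the recurrence.\<close>

locale reduction =
  fixes k :: nat and X :: "nat \<Rightarrow> nat \<Rightarrow> int" and B :: "nat \<Rightarrow> int" and J :: int
  assumes k: "1 \<le> k"
    and X: "\<And>i l. i < k \<Longrightarrow> l < k \<Longrightarrow> \<bar>X i l\<bar> < J"
    and B: "\<And>i. i < k \<Longrightarrow> \<bar>B i\<bar> < J"
begin

abbreviation "mdp \<equiv> reduction_mdp k X B J"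
abbreviation "Q \<equiv> scale k J"

lemma J: "1 \<le> J"
  using B[of 0] k by linarith

lemma Q: "2 \<le> Q"
proof -
  have "1 * 1 \<le> int k * J"
    using J k by (intro mult_mono) auto
  then show ?thesis
    by (simp add: scale_def)
qed

definition expect :: "nat \<Rightarrow> nat \<Rightarrow> (nat \<Rightarrow> real) \<Rightarrow> real" where
  "expect s a F = (\<Sum>t<9 + 2 * k. real_of_rat (prob mdp s a t) * F t)"

lemma expect_special:
  assumes "special_rows ! (2 * s + a) = (x, y, ts)" "s < 9" "a < 2"
  shows "expect s a F = (if ts = [] then 0 else (\<Sum>t\<leftarrow>ts. F t) / real (length ts))"
proof -
  let ?n = "9 + 2 * k"
  have n: "9 < ?n"
    using k by simp
  have "(x, y, ts) \<in> set special_rows"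
    using assms nth_mem[of "2 * s + a" special_rows] by (simp add: special_rows_def)
  then have ts: "distinct ts" "set ts \<subseteq> {..<?n}"
    using n by (auto simp: special_rows_def)
  have "expect s a F = (\<Sum>t<?n. if t \<in> set ts then F t / real (length ts) else 0)"
    unfolding expect_def using assms
    by (intro sum.cong) (auto simp: reduction_mdp_def of_rat_divide)
  also have "\<dots> = (\<Sum>t\<in>{..<?n} \<inter> set ts. F t / real (length ts))"
    by (simp add: sum.inter_restrict)
  also have "{..<?n} \<inter> set ts = set ts"
    using ts by blast
  finally show ?thesis
    using ts by (simp add: sum_divide_distrib sum_list_distinct_conv_sum_set)
qed

lemma expect_chain:
  fixes F :: "nat \<Rightarrow> real"
  assumes "9 \<le> s" "s < 9 + 2 * k"
  defines "\<sigma> \<equiv> chain_sign s" and "i \<equiv> chain_index s"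
  shows "expect s 0 F =
    (2 * (Q * (k * J - J + 1) - 1) * F 5 + 2 * k * (Q - 1) * F 6
      + tilt k J (\<sigma> * B i) * F 7 + tilt k J (- \<sigma> * B i) * F 8
      + (\<Sum>l<k. tilt k J (\<sigma> * X i l) * F (9 + 2 * l) + tilt k J (- \<sigma> * X i l) * F (10 + 2 * l)))
    / (2 * Q * Q)"
proof -
  have pos: "real_of_int J > 0" "real_of_int Q > 0" "real k > 0" and Q': "real_of_int Q = 2 * real k * real_of_int J"
    using J Q k by (auto simp: scale_def)
  have p6: "real_of_int (Q - 1) / real_of_int (2 * J * Q) = 2 * real k * real_of_int (Q - 1) / real_of_int (2 * Q * Q)"
    using pos by (simp add: Q' field_simps)
  have p5: "real_of_int x / real_of_int (Q * Q) = 2 * real_of_int x / real_of_int (2 * Q * Q)" for x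
    by simp
  have chain: "real_of_rat (prob mdp s 0 t) = real_of_rat (chain_prob k X B J s t)" if "t < 9 + 2 * k" for t
    using assms that by (simp add: reduction_mdp_def)
  have l: "(\<Sum>l<k. real_of_rat (chain_prob k X B J s (9 + 2 * l)) * F (9 + 2 * l) +
       real_of_rat (chain_prob k X B J s (10 + 2 * l)) * F (10 + 2 * l)) =
     (\<Sum>l<k. tilt k J (\<sigma> * X i l) * F (9 + 2 * l) + tilt k J (- \<sigma> * X i l) * F (10 + 2 * l)) / (2 * Q * Q)"
    unfolding sum_divide_distrib
    by (intro sum.cong) (auto simp: chain_prob_def Let_def of_rat_divide of_rat_mult \<sigma>_def i_def chain_index_def
        chain_sign_def add_divide_distrib)
  have "expect s 0 F = (\<Sum>t<9 + 2 * k. real_of_rat (chain_prob k X B J s t) * F t)"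
    unfolding expect_def by (intro sum.cong) (simp_all add: chain)
  also have "\<dots> = real_of_int (Q * (k * J - J + 1) - 1) / real_of_int (Q * Q) * F 5
      + real_of_int (Q - 1) / real_of_int (2 * J * Q) * F 6
      + tilt k J (\<sigma> * B i) / (2 * Q * Q) * F 7 + tilt k J (- \<sigma> * B i) / (2 * Q * Q) * F 8
      + (\<Sum>l<k. tilt k J (\<sigma> * X i l) * F (9 + 2 * l) + tilt k J (- \<sigma> * X i l) * F (10 + 2 * l)) / (2 * Q * Q)"
    unfolding sum_states l
    by (simp add: chain_prob_def Let_def of_rat_divide of_rat_mult of_rat_diff of_rat_add \<sigma>_def i_def)
  finally show ?thesis
    unfolding p5 p6 by (simp add: add_divide_distrib)
qed

lemma expect_table:
  "expect 0 0 F = 0" "expect 0 1 F = 0" "expect 1 0 F = 0" "expect 1 1 F = 0"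
  "expect 2 0 F = (F 2 + F 9) / 2" "expect 2 1 F = (F 2 + F 6) / 2"
  "expect 3 0 F = F 0" "expect 3 1 F = F 1"
  "expect 4 0 F = F 3" "expect 4 1 F = 0"
  "expect 5 0 F = (F 7 + F 8) / 2" "expect 5 1 F = 0"
  "expect 6 0 F = (F 6 + F 5) / 2" "expect 6 1 F = 0"
  "expect 7 0 F = F 3" "expect 7 1 F = 0"
  "expect 8 0 F = (F 4 + F 3) / 2" "expect 8 1 F = 0"
  by (subst expect_special, (simp add: special_rows_def; fail), simp, simp, simp)+

lemma weight_table:
  "wgt_goal mdp 2 a = (if a < 2 then 1 else 0)" "wgt_goal mdp 3 a = 0" "wgt_goal mdp 4 0 = 2"
  "wgt_goal mdp 5 0 = 0" "wgt_goal mdp 6 0 = 0" "wgt_goal mdp 7 0 = 1" "wgt_goal mdp 8 0 = 0"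
  "wgt_fail mdp 2 a = 0" "wgt_fail mdp 3 a = 0" "wgt_fail mdp 4 0 = 0"
  "wgt_fail mdp 5 0 = 0" "wgt_fail mdp 6 0 = 1" "wgt_fail mdp 7 0 = 1" "wgt_fail mdp 8 0 = 1"
  "9 \<le> s \<Longrightarrow> wgt_goal mdp s 0 = 0" "9 \<le> s \<Longrightarrow> s < 9 + 2 * k \<Longrightarrow> wgt_fail mdp s 0 = 1"
  "wgt_goal mdp 0 a = 0" "wgt_goal mdp (Suc 0) a = 0" "wgt_fail mdp 0 a = 0" "wgt_fail mdp (Suc 0) a = 0"
  by (auto simp: reduction_mdp_def special_rows_def less_2_cases_iff)

lemma expect_chain_1: "9 \<le> s \<Longrightarrow> expect s 1 F = 0"
  by (auto simp: expect_def reduction_mdp_def intro!: sum.neutral)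

lemma chain_index_less: "9 \<le> s \<Longrightarrow> s < 9 + 2 * k \<Longrightarrow> chain_index s < k"
  by (simp add: chain_index_def)

lemma tilt_pos: "\<bar>x\<bar> < J \<Longrightarrow> 0 < tilt k J x"
proof -
  assume "\<bar>x\<bar> < J"
  then have "0 \<le> Q * (J - 1 + x)"
    using Q by (intro mult_nonneg_nonneg) auto
  then show ?thesis
    by (simp add: tilt_def distrib_left)
qed

text \<open>A function on the successors splits into a part that ignores signs, with value
  \<open>H\<close> after stopping and \<open>G\<close> while continuing, and a part that is odd in
  the sign. The first is averaged with weights 1 / 2 each; on the second only the differences of
  probabilities within a pair act, which are \<open>X / Q\<close> and \<open>- B / Q\<close> up to
  the sign of \<open>s\<close>.\<close>

lemma expect_chain_split:
  fixes F e :: "nat \<Rightarrow> real" and G H q :: real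
  assumes s: "9 \<le> s" "s < 9 + 2 * k"
    and F: "F 5 = H" "F 6 = G" "F 7 = H - q" "F 8 = H + q"
      "\<And>l. l < k \<Longrightarrow> F (9 + 2 * l) = G + e l" "\<And>l. l < k \<Longrightarrow> F (10 + 2 * l) = G - e l"
  shows "expect s 0 F = (H + G) / 2 +
    chain_sign s * ((\<Sum>l<k. X (chain_index s) l * e l) - B (chain_index s) * q) / Q"
proof -
  have pos: "real_of_int Q > 0"
    using Q by linarith
  have Q': "real_of_int Q = 2 * real k * real_of_int J"
    by (simp add: scale_def)
  let ?\<sigma> = "real_of_int (chain_sign s)" and ?i = "chain_index s"
  have tilt: "real_of_int (tilt k J x) = Q * (J - 1) + 1 + Q * x" for x
    by (simp add: tilt_def)
  have "(\<Sum>l<k. tilt k J (chain_sign s * X ?i l) * F (9 + 2 * l) + tilt k J (- chain_sign s * X ?i l) * F (10 + 2 * l)) =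
      (\<Sum>l<k. 2 * (Q * (J - 1) + 1) * G + 2 * Q * ?\<sigma> * (X ?i l * e l))"
  proof (intro sum.cong refl)
    fix l
    assume "l \<in> {..<k}"
    then have l: "F (9 + 2 * l) = G + e l" "F (10 + 2 * l) = G - e l"
      using F by simp_all
    show "tilt k J (chain_sign s * X ?i l) * F (9 + 2 * l) + tilt k J (- chain_sign s * X ?i l) * F (10 + 2 * l) =
        2 * (Q * (J - 1) + 1) * G + 2 * Q * ?\<sigma> * (X ?i l * e l)"
      unfolding l tilt by (simp add: algebra_simps)
  qed
  also have "\<dots> = 2 * k * (Q * (J - 1) + 1) * G + 2 * Q * ?\<sigma> * (\<Sum>l<k. X ?i l * e l)"
    by (simp add: sum.distrib sum_distrib_left)
  finally have "expect s 0 F = (2 * (Q * (k * J - J + 1) - 1) * H + 2 * k * (Q - 1) * G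
      + (Q * (J - 1) + 1 + Q * ?\<sigma> * B ?i) * (H - q) + (Q * (J - 1) + 1 - Q * ?\<sigma> * B ?i) * (H + q)
      + (2 * k * (Q * (J - 1) + 1) * G + 2 * Q * ?\<sigma> * (\<Sum>l<k. X ?i l * e l))) / (2 * Q * Q)"
    unfolding expect_chain[OF s] F(1-4) tilt by (simp add: mult.assoc)
  \<comment> \<open>This is where the masses of states 5 and 6 pay off: the coefficients of
    \<open>H\<close> and of \<open>G\<close> both add up to \<open>Q * (2 * k * J)\<close>, the
    square of \<open>Q\<close>.\<close>
  also have "2 * (Q * (k * J - J + 1) - 1) * H + 2 * k * (Q - 1) * G
      + (Q * (J - 1) + 1 + Q * ?\<sigma> * B ?i) * (H - q) + (Q * (J - 1) + 1 - Q * ?\<sigma> * B ?i) * (H + q)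
      + (2 * k * (Q * (J - 1) + 1) * G + 2 * Q * ?\<sigma> * (\<Sum>l<k. X ?i l * e l)) =
    real_of_int Q * (2 * real k * real_of_int J) * (H + G) + 2 * Q * ?\<sigma> * ((\<Sum>l<k. X ?i l * e l) - B ?i * q)"
    by (simp add: algebra_simps)
  also have "\<dots> / (2 * Q * Q) = (H + G) / 2 + ?\<sigma> * ((\<Sum>l<k. X ?i l * e l) - B ?i * q) / Q"
    using pos unfolding Q'[symmetric] by (simp add: field_simps)
  finally show ?thesis .
qed

lemma prob_nonneg: "0 \<le> prob mdp s a t"
proof (cases "9 \<le> s \<and> s < 9 + 2 * k \<and> t < 9 + 2 * k \<and> a = 0")
  case True
  let ?i = "chain_index s"
  have i: "?i < k"
    using True chain_index_less by blast
  have sgn: "\<bar>chain_sign s * x\<bar> = \<bar>x\<bar>" for s x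
    by (simp add: chain_sign_def)
  have Jk: "1 * J \<le> int k * J"
    using J k by (intro mult_right_mono) auto
  then have "1 * 1 \<le> Q * (int k * J - J + 1)"
    using Q by (intro mult_mono) auto
  then have "(0 :: rat) \<le> of_int (Q * (int k * J - J + 1) - 1)"
    by (subst of_int_0_le_iff) simp
  moreover have "0 < tilt k J (chain_sign s * B ?i)" "0 < tilt k J (- chain_sign s * B ?i)"
    using B[OF i] sgn[of s "B ?i"] by (auto intro!: tilt_pos)
  moreover have "0 < tilt k J (chain_sign s * chain_sign t * X ?i (chain_index t))" if "9 \<le> t"
    using X[OF i chain_index_less, of t] that True sgn[of s] sgn[of t]
    by (intro tilt_pos) (simp add: mult.assoc)
  ultimately show ?thesis
    using True Q J by (auto simp: reduction_mdp_def chain_prob_def Let_def intro!: divide_nonneg_nonneg mult_nonneg_nonneg)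
qed (auto simp: reduction_mdp_def Let_def)

lemma of_rat_sum_prob: "real_of_rat (\<Sum>t<9 + 2 * k. prob mdp s a t) = expect s a (\<lambda>_. 1)"
  by (simp add: expect_def of_rat_sum)

lemma expect_chain_one:
  assumes "9 \<le> s" "s < 9 + 2 * k"
  shows "expect s 0 (\<lambda>_. 1) = 1"
  using expect_chain_split[OF assms, of "\<lambda>_. 1" 1 1 0 "\<lambda>_. 0"] by simp

lemma state_cases:
  assumes "s < 9 + 2 * k"
  obtains "s = 0" | "s = 1" | "s = 2" | "s = 3" | "s = 4" | "s = 5" | "s = 6" | "s = 7" | "s = 8" | "9 \<le> s"
  using assms by (cases "9 \<le> s") (force simp: not_le less_Suc_eq eval_nat_numeral)+

text \<open>An action is enabled iff its row sums to 1, that is, iff the expectation of the constant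
  1 is 1; so the tables of expectations decide it.\<close>

lemma enabled_mdp:
  assumes "s < 9 + 2 * k"
  shows "enabled mdp s = (if s = 0 \<or> s = 1 then {} else if s = 2 \<or> s = 3 then {0, 1} else {0})"
proof -
  have "enabled mdp s = {a. a < 2 \<and> expect s a (\<lambda>_. 1) = 1}"
    unfolding enabled_def of_rat_sum_prob[symmetric] of_rat_eq_1_iff by simp
  also have "\<dots> = (if expect s 0 (\<lambda>_. 1) = 1 then {0} else {}) \<union> (if expect s 1 (\<lambda>_. 1) = 1 then {1} else {})"
    by (auto dest!: less_2_cases simp flip: One_nat_def split: if_splits)
  also have "\<dots> = (if s = 0 \<or> s = 1 then {} else if s = 2 \<or> s = 3 then {0, 1} else {0})"
    using assms
    by (cases rule: state_cases[OF assms])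
      (auto simp: expect_table expect_chain_1 expect_chain_one simp del: One_nat_def)
  finally show ?thesis .
qed

lemma is_mdp: "is_mdp mdp"
proof -
  have "expect s a (\<lambda>_. 1) \<in> {0, 1}" if "s < 9 + 2 * k" "a < 2" for s a
    using that(1) less_2_cases[OF that(2)]
    by (cases rule: state_cases[OF that(1)])
      (auto simp: expect_table expect_chain_1 expect_chain_one simp del: One_nat_def simp flip: One_nat_def)
  then have "(\<Sum>t<9 + 2 * k. prob mdp s a t) \<in> {0, 1}" if "s < 9 + 2 * k" "a < 2" for s a
    using that unfolding of_rat_sum_prob[symmetric] by (simp del: of_rat_sum)
  moreover have "\<forall>s a t. \<not> s < 9 + 2 * k \<or> \<not> a < 2 \<or> \<not> t < 9 + 2 * k \<longrightarrow> prob mdp s a t = 0"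
    by (auto simp: reduction_mdp_def)
  moreover have "\<forall>s a. \<not> s < 9 + 2 * k \<or> \<not> a < 2 \<longrightarrow> wgt_goal mdp s a = 0 \<and> wgt_fail mdp s a = 0"
    by (auto simp: reduction_mdp_def)
  ultimately show ?thesis
    using enabled_mdp[of 0] enabled_mdp[of 1] prob_nonneg by (simp add: is_mdp_def)
qed

end

section \<open>The value function\<close>

context reduction
begin

text \<open>
  \<open>bias n i\<close> is half the advantage of sign \<open>+\<close> over sign \<open>-\<close> in state \<open>i\<close> of the chain if \<open>d = n\<close>.
\<close>

primrec bias :: "nat \<Rightarrow> nat \<Rightarrow> real" where
  "bias 0 i = 0"
| "bias (Suc n) i = ((\<Sum>l<k. real_of_int (X i l) * bias n l) - (if n = 0 then real_of_int (B i) / 4 else 0)) / Q"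

text \<open>The sum over a row is at most \<open>k * J\<close> and the term with \<open>B\<close> at
  most \<open>J\<close>, in absolute value; together this is at most \<open>2 * k * J = Q\<close>.
  The bound keeps values nonnegative and their growth linear.\<close>

lemma abs_bias: "i < k \<Longrightarrow> \<bar>bias n i\<bar> \<le> 1"
proof (induction n arbitrary: i)
  case (Suc n)
  have pos: "0 < real_of_int Q"
    using Q by linarith
  have Qeq: "real_of_int Q = 2 * real k * real_of_int J"
    by (simp add: scale_def)
  have k': "1 \<le> real k" and J': "1 \<le> real_of_int J"
    using k J by auto
  have "\<bar>\<Sum>l<k. real_of_int (X i l) * bias n l\<bar> \<le> (\<Sum>l<k. \<bar>real_of_int (X i l) * bias n l\<bar>)"
    by (rule sum_abs)
  also have "\<dots> \<le> (\<Sum>l<k. real_of_int J * 1)"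
  proof (rule sum_mono)
    fix l
    assume "l \<in> {..<k}"
    then have "\<bar>real_of_int (X i l)\<bar> \<le> J" "\<bar>bias n l\<bar> \<le> 1"
      using X[OF Suc.prems, of l] Suc.IH[of l] by auto
    then show "\<bar>real_of_int (X i l) * bias n l\<bar> \<le> real_of_int J * 1"
      unfolding abs_mult using J' by (intro mult_mono) auto
  qed
  also have "\<dots> = real k * J"
    by simp
  finally have "\<bar>\<Sum>l<k. real_of_int (X i l) * bias n l\<bar> \<le> real k * J" .
  moreover have "\<bar>if n = 0 then real_of_int (B i) / 4 else 0\<bar> \<le> 1 * J"
    using B[OF Suc.prems] by auto
  moreover have "1 * real_of_int J \<le> real k * J"
    using k' J' by (intro mult_right_mono) auto
  ultimately have "\<bar>(\<Sum>l<k. real_of_int (X i l) * bias n l) - (if n = 0 then real_of_int (B i) / 4 else 0)\<bar> \<le> Q"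
    unfolding Qeq by linarith
  then show ?case
    using pos by (simp add: abs_divide)
qed auto

text \<open>The solution of \<open>x d = 1 + (x (d - 1) + fair_value (d - 1)) / 2\<close>. For
  \<open>d <= 0\<close> the constant 3 is the fixed point of \<open>x = 1 + (x + 1) / 2\<close>; for
  positive \<open>d\<close> solutions have the form \<open>d + 1 + c / 2 ^ d\<close>, and the value
  25 / 8 at \<open>d = 1\<close> gives \<open>c = 9 / 4\<close>.\<close>

definition neutral_value :: "int \<Rightarrow> real" where
  "neutral_value d = (if d \<le> 0 then 3 else d + 1 + 9 / 4 * (1 / 2) ^ nat d)"

text \<open>The mean of the two outcomes 7 and 8, which differ by 1 / 2 at
  \<open>d = 0\<close>.\<close>

definition fair_value :: "int \<Rightarrow> real" where
  "fair_value d = 1 + max d 0 + (if d = 0 then 1 / 4 else 0)"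

text \<open>
  The future payoff in excess of the current fail weight, as a function of \<open>d\<close>.  The bonus \<open>b\<close> is what
  the initial state gains by entering the chain for one value of \<open>d\<close>.
\<close>

definition value_at :: "(int \<Rightarrow> real) \<Rightarrow> nat \<Rightarrow> int \<Rightarrow> real" where
  "value_at b s d =
    (if s = 0 then d else if s = 1 then 0
     else if s = 2 then max d 0 + 3 + 3 / 4 * (1 / 2) ^ nat \<bar>d\<bar> + b d
     else if s = 3 then max d 0 else if s = 4 then max (d + 2) 0
     else if s = 5 then fair_value d else if s = 6 then neutral_value d
     else if s = 7 then 1 + max d 0 else if s = 8 then 1 + (max (d + 1) 0 + max (d - 1) 0) / 2
     else neutral_value d + chain_sign s * bias (nat d) (chain_index s))"

lemma neutral_value_step: "neutral_value d = 1 + (neutral_value (d - 1) + fair_value (d - 1)) / 2"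
proof -
  consider "d \<le> 0" | "d = 1" | "d \<ge> 2"
    by linarith
  then show ?thesis
  proof cases
    case 3
    then have "nat d = Suc (nat (d - 1))"
      by linarith
    then show ?thesis
      using 3 by (simp add: neutral_value_def fair_value_def field_simps)
  qed (auto simp: neutral_value_def fair_value_def)
qed

text \<open>The closed form is the sum of \<open>neutral_value (d + j) / 2 ^ j\<close> over
  \<open>j >= 1\<close>. For \<open>d >= 0\<close> its exponential terms add up to
  \<open>9 / 4 * (1 / 4 + 1 / 16 + ...) = 3 / 4\<close> times \<open>1 / 2 ^ d\<close>, and at 0 it
  is the threshold 15 / 4. Negative \<open>d\<close> never occur in the initial state, but the
  martingale inequalities are stated for arbitrary histories.\<close>

lemma init_value_step:
  "max d 0 + 3 + 3 / 4 * (1 / 2) ^ nat \<bar>d\<bar> =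
    ((max (d + 1) 0 + 3 + 3 / 4 * (1 / 2) ^ nat \<bar>d + 1\<bar>) + neutral_value (d + 1)) / (2 :: real)"
proof (cases "0 \<le> d")
  case True
  then have "nat \<bar>d + 1\<bar> = Suc (nat \<bar>d\<bar>)" "nat (d + 1) = Suc (nat \<bar>d\<bar>)"
    by linarith+
  then show ?thesis
    using True by (simp add: neutral_value_def field_simps)
next
  case False
  then have "nat \<bar>d\<bar> = Suc (nat \<bar>d + 1\<bar>)"
    by linarith
  then show ?thesis
    using False by (simp add: neutral_value_def field_simps)
qed

lemma second_difference_hinge:
  "(max (real_of_int d + 1) 0 + max (real_of_int d - 1) 0) / 2 = max (real_of_int d) 0 + (if d = 0 then 1 / 2 else 0)"
proof -
  consider "d \<le> - 1" | "d = 0" | "1 \<le> d"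
    by linarith
  then show ?thesis
    by cases auto
qed

lemma value_at_8: "value_at b 8 d = fair_value d + (if d = 0 then 1 / 4 else 0)"
  using second_difference_hinge[of d] by (simp add: value_at_def fair_value_def)

text \<open>The fair copy supplies the even part and the bias the odd part, whose recursion is the
  definition of \<open>bias\<close>. For \<open>d <= 0\<close> the truncation in
  \<open>nat d\<close> makes the bias 0, as it has to be: the next step moves below 0, where both
  outcomes are worth the same.\<close>

lemma chain_value_step:
  assumes s: "9 \<le> s" "s < 9 + 2 * k"
  shows "value_at b s d = 1 + expect s 0 (\<lambda>t. value_at b t (d - 1))"
proof -
  let ?i = "chain_index s"
  define q :: real where "q = (if d - 1 = 0 then 1 / 4 else 0)"
  have "expect s 0 (\<lambda>t. value_at b t (d - 1)) = (fair_value (d - 1) + neutral_value (d - 1)) / 2 +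
    chain_sign s * ((\<Sum>l<k. X ?i l * bias (nat (d - 1)) l) - B ?i * q) / Q" (is "_ = ?m + _ * ?x / _")
  proof (rule expect_chain_split[OF s])
    show "value_at b 8 (d - 1) = fair_value (d - 1) + q"
      unfolding value_at_8 by (simp add: q_def)
  qed (auto simp: value_at_def fair_value_def q_def chain_sign_def chain_index_def)
  moreover have "?x / Q = bias (nat d) ?i"
  proof (cases "d \<le> 0")
    case True
    then show ?thesis
      by (simp add: q_def)
  next
    case False
    then have "nat d = Suc (nat (d - 1))" "nat (d - 1) = 0 \<longleftrightarrow> d - 1 = 0"
      by linarith+
    then show ?thesis
      by (simp add: q_def)
  qed
  ultimately have "expect s 0 (\<lambda>t. value_at b t (d - 1)) = ?m + chain_sign s * bias (nat d) ?i"
    by (simp only: times_divide_eq_right[symmetric])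
  then show ?thesis
    using s neutral_value_step[of d] by (simp add: value_at_def)
qed

definition total_value :: "(int \<Rightarrow> real) \<Rightarrow> nat \<Rightarrow> nat \<Rightarrow> nat \<Rightarrow> real" where
  "total_value b s g f = real f + value_at b s (int g - int f)"

lemma expect_const_add: "expect s a (\<lambda>t. c + F t) = c * expect s a (\<lambda>_. 1) + expect s a F"
  by (simp add: expect_def algebra_simps sum.distrib sum_distrib_left)

lemma expect_one:
  assumes "s < 9 + 2 * k" "a \<in> enabled mdp s"
  shows "expect s a (\<lambda>_. 1) = 1"
  using assms(2) unfolding enabled_def of_rat_sum_prob[symmetric] of_rat_eq_1_iff by simp

lemma expect_total_value:
  assumes "s < 9 + 2 * k" "a \<in> enabled mdp s"
  shows "expect s a (\<lambda>t. total_value b t (g + wgt_goal mdp s a) (f + wgt_fail mdp s a)) =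
    real f + wgt_fail mdp s a +
      expect s a (\<lambda>t. value_at b t (int g - int f + (int (wgt_goal mdp s a) - int (wgt_fail mdp s a))))"
  unfolding total_value_def expect_const_add expect_one[OF assms] by (simp add: algebra_simps)

text \<open>Values are later embedded into \<open>ennreal\<close>, which truncates negative reals,
  so real identities transfer only for nonnegative values. In the goal state the fail weight cancels
  and the goal weight remains.\<close>

lemma total_value_nonneg:
  assumes "s < 9 + 2 * k" "\<And>d. 0 \<le> b d"
  shows "0 \<le> total_value b s g f"
proof -
  have neutral: "1 \<le> neutral_value d" for d
    by (simp add: neutral_value_def)
  have "0 \<le> value_at b s d" if "9 \<le> s" for d
    using abs_bias[OF chain_index_less[OF that assms(1)], of "nat d"] neutral[of d] that
    by (auto simp: value_at_def chain_sign_def abs_le_iff)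
  moreover have "0 \<le> value_at b s d" if "s \<noteq> 0" "s < 9" for d
  proof -
    have "0 \<le> max (real_of_int d) 0" "0 \<le> max (real_of_int d + 1) 0" "0 \<le> max (real_of_int d - 1) 0"
      "0 \<le> max (real_of_int d + 2) 0" "0 \<le> 3 / 4 * (1 / 2 :: real) ^ nat \<bar>d\<bar>"
      by simp_all
    with assms(1) show ?thesis
      using that assms(2)[of d] neutral[of d]
      by (cases rule: state_cases) (simp_all add: value_at_def fair_value_def)
  qed
  ultimately have "0 \<le> value_at b s (int g - int f)" if "s \<noteq> 0"
    using that by (cases "9 \<le> s") (simp_all add: not_le)
  then show ?thesis
    by (cases "s = 0") (simp_all add: total_value_def value_at_def[of b 0])
qed

lemma value_at_le:
  assumes "s < 9 + 2 * k" "s \<noteq> 0" "\<And>d. b d \<le> 1"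
  shows "value_at b s d \<le> max d 0 + 10"
proof -
  have pow: "(1 / 2 :: real) ^ n \<le> 1" for n
    by (simp add: power_le_one)
  have neutral: "neutral_value d \<le> max d 0 + 4"
    using pow[of "nat d"] unfolding neutral_value_def by auto
  show ?thesis
  proof (cases "9 \<le> s")
    case True
    then show ?thesis
      using abs_bias[OF chain_index_less[OF _ assms(1)], of "nat d"] neutral
      by (auto simp: value_at_def chain_sign_def abs_le_iff)
  next
    case False
    then show ?thesis
      using assms(2) assms(3)[of d] neutral pow[of "nat \<bar>d\<bar>"]
      by (auto simp: value_at_def fair_value_def max_def)
  qed
qed

text \<open>The factors that scale the linear potential. A step adds at most 2 to the weights, so
  with the offset 10 the linear part grows at most by the factor 6 / 5. Looping states are made
  large compared with their exits, so that halving outweighs this growth: for state 2 the condition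
  reads \<open>275 * (x + 11) <= 375 * (x + 10)\<close>.\<close>

definition decay :: "nat \<Rightarrow> real" where
  "decay s = (if s = 0 \<or> s = 1 then 0 else if s = 2 then 500 else if s = 3 then 1 else if s = 4 then 2
     else if s = 5 then 5 else if s = 7 \<or> s = 8 then 3 else 50)"

lemma expect_mono: "(\<And>t. F t \<le> G t) \<Longrightarrow> expect s a F \<le> expect s a G"
  unfolding expect_def using prob_nonneg by (intro sum_mono mult_left_mono) auto

lemma expect_decay:
  fixes x :: real
  assumes s: "s < 9 + 2 * k" and a: "a \<in> enabled mdp s" and x: "0 \<le> x"
  shows "expect s a decay * (x + wgt_goal mdp s a + wgt_fail mdp s a + 10) \<le> 3 / 4 * decay s * (x + 10)"
  using s
proof (cases rule: state_cases)
  case 10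
  \<comment> \<open>Raising states 7 and 8 to the value of state 5 leaves a single stopping value,
    so that \<open>expect_chain_split\<close> applies with \<open>q = 0\<close> and yields
    \<open>(5 + 50) / 2\<close>.\<close>
  let ?F = "decay(7 := 5, 8 := 5)"
  have a0: "a = 0"
    using a 10 s by (simp add: enabled_mdp)
  have "expect s 0 decay \<le> expect s 0 ?F"
    by (rule expect_mono) (simp add: decay_def)
  also have "\<dots> = 55 / 2"
    using expect_chain_split[OF 10 s, of ?F 5 50 0 "\<lambda>_. 0"] by (simp add: decay_def)
  finally have "expect s 0 decay * (11 + x) \<le> 55 / 2 * (11 + x)"
    using x by (intro mult_right_mono) auto
  moreover have "decay s = 50"
    using 10 by (simp add: decay_def)
  ultimately show ?thesis
    using 10 s a0 x by (simp add: weight_table)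
qed (use a s x in \<open>auto simp: enabled_mdp expect_table weight_table decay_def simp del: One_nat_def simp flip: One_nat_def\<close>)

end

section \<open>Termination and the two bounds for the maximal expectation\<close>

context reduction
begin

lemma terminal_states: "s \<in> states mdp \<Longrightarrow> enabled mdp s = {} \<Longrightarrow> s = goal mdp \<or> s = fail mdp"
  using enabled_mdp[of s] by (auto split: if_splits)

lemma terminal_weights:
  "s \<in> states mdp \<Longrightarrow> enabled mdp s = {} \<Longrightarrow> wgt_goal mdp s a = 0 \<and> wgt_fail mdp s a = 0"
  using terminal_states[of s] by (auto simp: weight_table)

definition potential :: "(nat \<times> nat) list \<Rightarrow> nat \<Rightarrow> real" where
  "potential h s = decay s * (real (history_weight (wgt_goal mdp) h) + real (history_weight (wgt_fail mdp) h) + 10)"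

lemma decay_terminal: "s \<in> states mdp \<Longrightarrow> enabled mdp s = {} \<Longrightarrow> decay s = 0"
  using terminal_states[of s] by (auto simp: decay_def)

lemma decay_nonterminal: "s \<in> states mdp \<Longrightarrow> enabled mdp s \<noteq> {} \<Longrightarrow> 1 \<le> decay s"
  using enabled_mdp[of s] by (auto simp: decay_def split: if_splits)

lemma potential_terminal: "s \<in> states mdp \<Longrightarrow> enabled mdp s = {} \<Longrightarrow> potential h s = 0"
  by (simp add: potential_def decay_terminal del: reduction_mdp_simps)

text \<open>This makes \<open>potential\<close> dominate the value function: values exceed the
  positive part of \<open>d\<close> by at most 10, and that part plus the fail weight is at most the
  sum of both weights.\<close>

lemma potential_nonterminal:
  assumes "s \<in> states mdp" "enabled mdp s \<noteq> {}"
  shows "real (history_weight (wgt_goal mdp) h) + real (history_weight (wgt_fail mdp) h) + 10 \<le> potential h s"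
  using mult_right_mono[OF decay_nonterminal[OF assms],
      of "real (history_weight (wgt_goal mdp) h) + real (history_weight (wgt_fail mdp) h) + 10"]
  by (simp add: potential_def)

lemma potential_nonterminal_ge_1:
  "s \<in> states mdp \<Longrightarrow> enabled mdp s \<noteq> {} \<Longrightarrow> 1 \<le> potential h s"
  using potential_nonterminal[of s h] by linarith

lemma potential_step:
  assumes "s \<in> states mdp" "a \<in> enabled mdp s"
  shows "(\<Sum>t\<in>states mdp. real_of_rat (prob mdp s a t) * potential (h @ [(s, a)]) t) \<le> 3 / 4 * potential h s"
proof -
  let ?x = "real (history_weight (wgt_goal mdp) h) + real (history_weight (wgt_fail mdp) h)"
  have "(\<Sum>t\<in>states mdp. real_of_rat (prob mdp s a t) * potential (h @ [(s, a)]) t) =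
      expect s a decay * (?x + wgt_goal mdp s a + wgt_fail mdp s a + 10)"
    unfolding expect_def sum_distrib_right by (intro sum.cong) (simp_all add: potential_def algebra_simps)
  also have "\<dots> \<le> 3 / 4 * decay s * (?x + 10)"
    using assms by (intro expect_decay) auto
  finally show ?thesis
    by (simp add: potential_def)
qed

lemma measure_reaches_mdp:
  assumes "\<sigma> \<in> schedulers mdp"
  shows "measure (path_measure mdp \<sigma>) {\<omega> \<in> space (path_measure mdp \<sigma>). reaches \<omega> {goal mdp, fail mdp}} = 1"
proof (rule measure_reaches[OF is_mdp assms terminal_states terminal_weights, where r="3 / 4" and U=potential])
qed ((rule potential_terminal potential_nonterminal_ge_1 potential_step; assumption) | simp)+

lemma schedulers_nonempty: "schedulers M \<noteq> {}"
proof -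
  have "(\<lambda>h s. return_pmf (SOME a. a \<in> enabled M s)) \<in> schedulers M"
    by (auto simp: schedulers_def some_in_eq)
  then show ?thesis
    by blast
qed

lemma min_reach_prob_mdp: "min_reach_prob mdp {goal mdp, fail mdp} = 1"
proof -
  have "min_reach_prob mdp {goal mdp, fail mdp} = (INF \<sigma>\<in>schedulers mdp. 1)"
    unfolding min_reach_prob_def by (rule INF_cong[OF refl]) (rule measure_reaches_mdp)
  also have "\<dots> = 1"
    by (rule cINF_const[OF schedulers_nonempty])
  finally show ?thesis .
qed

lemma threshold_instance: "(mdp, \<theta>) \<in> threshold_instances"
  using is_mdp min_reach_prob_mdp unfolding threshold_instances_def
  by (auto simp del: reduction_mdp_simps(3-5))

text \<open>Outside the two states with a choice the value function is harmonic for every bonus,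
  because the bonus is attached to state 2 and state 2 is a successor of itself only.\<close>

lemma value_step:
  assumes "s < 9 + 2 * k" "a \<in> enabled mdp s" "s \<noteq> 2" "s \<noteq> 3"
  shows "value_at b s d = real (wgt_fail mdp s a) +
    expect s a (\<lambda>t. value_at b t (d + (int (wgt_goal mdp s a) - int (wgt_fail mdp s a))))"
  using assms(1)
proof (cases rule: state_cases)
  case 6
  have "value_at b 5 d = (value_at b 7 d + value_at b 8 d) / 2"
    unfolding value_at_8 by (simp add: value_at_def fair_value_def)
  then show ?thesis
    using 6 assms by (simp add: enabled_mdp expect_table weight_table)
next
  case 7
  then show ?thesis
    using assms neutral_value_step[of d] by (simp add: enabled_mdp expect_table weight_table value_at_def)
next
  case 10
  then show ?thesis
    using assms chain_value_step[of s b d] by (simp add: enabled_mdp weight_table)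
qed (use assms in \<open>auto simp: enabled_mdp expect_table weight_table value_at_def add.commute\<close>)

lemma value_step_3:
  "value_at b 3 d = max (expect 3 0 (\<lambda>t. value_at b t d)) (expect 3 1 (\<lambda>t. value_at b t d))"
  unfolding expect_table by (simp add: value_at_def)

lemma init_value_step':
  "value_at b 2 d - b d = (value_at b 2 (d + 1) - b (d + 1) + neutral_value (d + 1)) / 2"
  using init_value_step[of d] by (simp add: value_at_def)

definition total :: "(int \<Rightarrow> real) \<Rightarrow> (nat \<times> nat) list \<Rightarrow> nat \<Rightarrow> ennreal" where
  "total b h s = ennreal (total_value b s (history_weight (wgt_goal mdp) h) (history_weight (wgt_fail mdp) h))"

lemma total_terminal:
  assumes "s \<in> states mdp" "enabled mdp s = {}"
  shows "total b (h @ [(s, a)]) s = total b h s"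
  using terminal_weights[OF assms, of a] by (simp add: total_def)

lemma total_goal: "total b h (goal mdp) = of_nat (history_weight (wgt_goal mdp) h)"
  by (simp add: total_def total_value_def value_at_def ennreal_of_nat_eq_real_of_nat)

lemma total_fail: "total b h (fail mdp) = of_nat (history_weight (wgt_fail mdp) h)"
  by (simp add: total_def total_value_def value_at_def ennreal_of_nat_eq_real_of_nat)

lemma total_init: "total b [] (init mdp) = ennreal (15 / 4 + b 0)"
  by (simp add: total_def total_value_def value_at_def)

text \<open>Pulling the embedding into \<open>ennreal\<close> out of the sum reduces super- and
  submartingale conditions to real inequalities for \<open>value_at\<close>.\<close>

lemma total_step:
  fixes h
  defines "d \<equiv> int (history_weight (wgt_goal mdp) h) - int (history_weight (wgt_fail mdp) h)"
  assumes s: "s \<in> states mdp" and a: "a \<in> enabled mdp s" and b: "\<And>d. 0 \<le> b d"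
  shows "(\<Sum>t\<in>states mdp. ennreal (real_of_rat (prob mdp s a t)) * total b (h @ [(s, a)]) t) =
    ennreal (real (history_weight (wgt_fail mdp) h) + (real (wgt_fail mdp s a) +
      expect s a (\<lambda>t. value_at b t (d + (int (wgt_goal mdp s a) - int (wgt_fail mdp s a))))))"
proof -
  let ?g = "history_weight (wgt_goal mdp) h" and ?f = "history_weight (wgt_fail mdp) h"
  have "(\<Sum>t\<in>states mdp. ennreal (real_of_rat (prob mdp s a t)) * total b (h @ [(s, a)]) t) =
    (\<Sum>t\<in>states mdp. ennreal (real_of_rat (prob mdp s a t) *
      total_value b t (?g + wgt_goal mdp s a) (?f + wgt_fail mdp s a)))"
    using prob_nonneg by (intro sum.cong) (auto simp: total_def ennreal_mult total_value_nonneg b)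
  also have "\<dots> = ennreal (expect s a (\<lambda>t. total_value b t (?g + wgt_goal mdp s a) (?f + wgt_fail mdp s a)))"
    unfolding expect_def using prob_nonneg by (subst sum_ennreal) (auto simp: total_value_nonneg b)
  finally show ?thesis
    using s a by (simp add: expect_total_value d_def add.assoc)
qed

text \<open>With bonus 0 the value in the initial state is that of always taking the fair copy. If
  no bias is positive, entering the chain never beats the fair copy, so this function is a
  supermartingale under every scheduler.\<close>

lemma max_expectation_le:
  assumes bias: "\<And>n. bias n 0 \<le> 0"
  shows "max_expectation mdp \<le> ereal (15 / 4)"
proof -
  let ?b = "\<lambda>_. 0 :: real"
  have step: "real (wgt_fail mdp s a) +
      expect s a (\<lambda>t. value_at ?b t (d + (int (wgt_goal mdp s a) - int (wgt_fail mdp s a)))) \<le> value_at ?b s d"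
    if s: "s < 9 + 2 * k" and a: "a \<in> enabled mdp s" for s a d
  proof -
    have a': "a = 0 \<or> a = 1"
      using a enabled_mdp[OF s] by (auto split: if_splits)
    consider "s = 2" | "s = 3" | "s \<noteq> 2" "s \<noteq> 3"
      by blast
    then show ?thesis
    proof cases
      case 1
      have "value_at ?b 9 (d + 1) \<le> neutral_value (d + 1)"
        using bias[of "nat (d + 1)"] by (simp add: value_at_def chain_sign_def chain_index_def)
      moreover have "value_at ?b 6 (d + 1) = neutral_value (d + 1)"
        by (simp add: value_at_def)
      ultimately have "expect 2 a (\<lambda>t. value_at ?b t (d + 1)) \<le> value_at ?b 2 d"
        using a' init_value_step'[of ?b d] by (auto simp: expect_table simp del: One_nat_def)
      then show ?thesis
        using 1 a' by (auto simp: weight_table)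
    next
      case 2
      have "expect 3 a (\<lambda>t. value_at ?b t d) \<le> value_at ?b 3 d"
        using a' value_step_3[of ?b d] by auto
      then show ?thesis
        using 2 by (simp add: weight_table)
    next
      case 3
      then show ?thesis
        using value_step[OF s a, of ?b d] by simp
    qed
  qed
  have "(\<integral>\<^sup>+ \<omega>. payoff mdp \<omega> \<partial>path_measure mdp \<sigma>) \<le> ennreal (15 / 4)" if \<sigma>: "\<sigma> \<in> schedulers mdp" for \<sigma>
  proof -
    have "(\<integral>\<^sup>+ \<omega>. payoff mdp \<omega> \<partial>path_measure mdp \<sigma>) \<le> total ?b [] (init mdp)"
    proof (rule nn_integral_payoff_le[OF is_mdp \<sigma> terminal_states terminal_weights])
      fix h s a
      assume s: "s \<in> states mdp" and a: "a \<in> enabled mdp s"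
      show "(\<Sum>t\<in>states mdp. ennreal (real_of_rat (prob mdp s a t)) * total ?b (h @ [(s, a)]) t) \<le> total ?b h s"
        unfolding total_step[OF s a order_refl] unfolding total_def total_value_def
        using s a by (intro ennreal_leI add_left_mono step) auto
    qed (simp_all add: total_terminal total_goal total_fail del: reduction_mdp_simps)
    then show ?thesis
      by (simp only: total_init) simp
  qed
  then have "enn2ereal (\<integral>\<^sup>+ \<omega>. payoff mdp \<omega> \<partial>path_measure mdp \<sigma>) \<le> ereal (15 / 4)" if "\<sigma> \<in> schedulers mdp" for \<sigma>
    using that by (metis enn2ereal_ennreal less_eq_ennreal.rep_eq divide_nonneg_nonneg zero_le_numeral)
  then show ?thesis
    unfolding max_expectation_def by (intro SUP_least)
qed

lemma max_expectation_gt: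
  assumes bias: "0 < bias (Suc n) 0"
  shows "ereal (15 / 4) < max_expectation mdp"
proof -
  \<comment> \<open>At \<open>d = n\<close> the chain is entered with probability 1 / 2 and with
    \<open>d\<close> raised to \<open>n + 1\<close>, which gains half of
    \<open>bias (Suc n) 0\<close>. Each smaller value of \<open>d\<close> halves the gain once more;
    beyond \<open>n\<close> the opportunity has passed.\<close>
  define b where "b d = (if d \<le> int n then (1 / 2) ^ nat (int n + 1 - d) * bias (Suc n) 0 else 0)" for d
  have bias_le: "bias (Suc n) 0 \<le> 1"
    using abs_bias[of 0 "Suc n"] k by (simp add: abs_le_iff del: bias.simps)
  have b: "0 \<le> b d" "b d \<le> 1" for d
    using bias bias_le by (auto simp: b_def power_le_one intro!: mult_le_one simp del: bias.simps)
  define weight_diff where "weight_diff h = int (history_weight (wgt_goal mdp) h) - int (history_weight (wgt_fail mdp) h)" for h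
  \<comment> \<open>Action 0 offers the chain in state 2 and moves to goal in state 3, action 1
    offers the fair copy and moves to fail. The value of \<open>d\<close> is computed from the
    history.\<close>
  define \<sigma> :: "(nat, nat) scheduler" where
    "\<sigma> h s = return_pmf (if s = 2 \<and> weight_diff h \<noteq> int n \<or> s = 3 \<and> weight_diff h < 0 then 1 else 0)" for h s
  have \<sigma>: "\<sigma> \<in> schedulers mdp"
    by (auto simp: schedulers_def \<sigma>_def enabled_mdp)
  have step: "value_at b s (weight_diff h) \<le> real (wgt_fail mdp s a) +
      expect s a (\<lambda>t. value_at b t (weight_diff h + (int (wgt_goal mdp s a) - int (wgt_fail mdp s a))))"
    if s: "s < 9 + 2 * k" and a: "a \<in> enabled mdp s" and a': "a \<in> set_pmf (\<sigma> h s)" for s a h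
  proof -
    let ?d = "weight_diff h"
    consider "s = 2" "?d = int n" | "s = 2" "?d \<noteq> int n" | "s = 3" | "s \<noteq> 2" "s \<noteq> 3"
      by blast
    then show ?thesis
    proof cases
      case 1
      then have "value_at b 9 (?d + 1) = neutral_value (?d + 1) + 2 * b ?d"
        by (simp add: value_at_def chain_sign_def chain_index_def b_def nat_add_distrib del: bias.simps)
      moreover have "b (?d + 1) = 0"
        using 1 by (simp add: b_def)
      ultimately show ?thesis
        using 1 a' init_value_step'[of b ?d] by (simp add: \<sigma>_def weight_table expect_table)
    next
      case 2
      have "b ?d = b (?d + 1) / 2"
      proof (cases "?d < int n")
        case True
        then have "nat (int n + 1 - ?d) = Suc (nat (int n + 1 - (?d + 1)))"
          by linarith
        then show ?thesis
          using True by (simp add: b_def)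
      qed (use 2 in \<open>simp add: b_def\<close>)
      moreover have "value_at b 6 (?d + 1) = neutral_value (?d + 1)"
        by (simp add: value_at_def)
      ultimately show ?thesis
        using 2 a' init_value_step'[of b ?d] by (simp add: \<sigma>_def weight_table expect_table[unfolded One_nat_def])
    next
      case 3
      then show ?thesis
        using a' by (auto simp: \<sigma>_def weight_table expect_table[unfolded One_nat_def] value_at_def)
    next
      case 4
      then show ?thesis
        using value_step[OF s a, of b ?d] by simp
    qed
  qed
  have "total b [] (init mdp) \<le> (\<integral>\<^sup>+ \<omega>. payoff mdp \<omega> \<partial>path_measure mdp \<sigma>)"
  proof (rule nn_integral_payoff_ge[OF is_mdp \<sigma> terminal_states terminal_weights,
        where r="3 / 4" and U=potential])
    fix h s
    assume s: "s \<in> states mdp" and ne: "enabled mdp s \<noteq> {}"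
    have "s \<noteq> 0"
      using ne enabled_mdp[of 0] by auto
    then have "value_at b s (weight_diff h) \<le> max (weight_diff h) 0 + 10"
      using s b by (intro value_at_le) auto
    then show "total b h s \<le> ennreal (potential h s)"
      using potential_nonterminal[OF s ne, of h]
      by (auto simp: total_def total_value_def weight_diff_def intro!: ennreal_leI)
  next
    fix h s a
    assume s: "s \<in> states mdp" and a: "a \<in> enabled mdp s" and a': "a \<in> set_pmf (\<sigma> h s)"
    show "total b h s \<le> (\<Sum>t\<in>states mdp. ennreal (real_of_rat (prob mdp s a t)) * total b (h @ [(s, a)]) t)"
      unfolding total_step[OF s a b(1)] unfolding total_def total_value_def weight_diff_def[symmetric]
      using s a a' by (intro ennreal_leI add_left_mono step) auto
  qed (((rule total_terminal potential_terminal potential_nonterminal_ge_1 potential_step; assumption)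
      | (simp add: total_goal total_fail del: reduction_mdp_simps; fail) | simp)+)
  then have "ennreal (15 / 4 + b 0) \<le> (\<integral>\<^sup>+ \<omega>. payoff mdp \<omega> \<partial>path_measure mdp \<sigma>)"
    by (simp only: total_init)
  then have "ereal (15 / 4 + b 0) \<le> enn2ereal (\<integral>\<^sup>+ \<omega>. payoff mdp \<omega> \<partial>path_measure mdp \<sigma>)"
    using b(1)[of 0] unfolding less_eq_ennreal.rep_eq by (subst (asm) enn2ereal_ennreal) simp_all
  also have "\<dots> \<le> max_expectation mdp"
    unfolding max_expectation_def using \<sigma> by (rule SUP_upper)
  finally have ge: "ereal (15 / 4 + b 0) \<le> max_expectation mdp" .
  have "0 < b 0"
    using bias by (simp add: b_def del: bias.simps)
  then have "ereal (15 / 4) < ereal (15 / 4 + b 0)"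
    by simp
  from less_le_trans[OF this ge] show ?thesis .
qed

text \<open>Since \<open>bias 0\<close> vanishes, a positive bias has a successor as its index, as
  the strict lower bound requires.\<close>

lemma exceeds_threshold_iff: "exceeds_threshold (mdp, 15 / 4) \<longleftrightarrow> (\<exists>n. 0 < bias n 0)"
proof -
  have eq: "real_of_rat (15 / 4) = 15 / 4"
    by (simp add: of_rat_divide)
  show ?thesis
  proof
    assume "exceeds_threshold (mdp, 15 / 4)"
    then have "\<not> max_expectation mdp \<le> ereal (15 / 4)"
      by (simp add: exceeds_threshold_def eq not_le)
    then show "\<exists>n. 0 < bias n 0"
      using max_expectation_le not_le by blast
  next
    assume "\<exists>n. 0 < bias n 0"
    then obtain n where n: "0 < bias n 0" ..
    then obtain m where "n = Suc m"
      by (cases n) auto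
    then show "exceeds_threshold (mdp, 15 / 4)"
      using max_expectation_gt n by (simp add: exceeds_threshold_def eq del: bias.simps)
  qed
qed

end

section \<open>Running time of programs\<close>

definition bounded :: "nat \<Rightarrow> store \<Rightarrow> bool" where
  "bounded S s \<longleftrightarrow> (\<forall>r. \<bar>fst s r\<bar> < 2 ^ S) \<and> (\<forall>i. \<bar>snd s i\<bar> < 2 ^ S)"

text \<open>
  Every instruction is charged \<open>2 * S + 2\<close>, which is justified as long as all numbers are below
  \<open>2 ^ S\<close>; the factor \<open>n\<close> counts instructions.
\<close>

definition runs :: "int list set \<Rightarrow> nat \<Rightarrow> program \<Rightarrow> nat \<Rightarrow> (store \<Rightarrow> bool) \<Rightarrow> store \<Rightarrow> bool" where
  "runs A S c n Q s \<longleftrightarrow> (bounded S s \<longrightarrow>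
    (\<exists>t s'. exec A c s t s' \<and> t \<le> n * (2 * S + 2) \<and> bounded S s' \<and> Q s'))"

lemma int_size_le: "\<bar>x\<bar> < 2 ^ S \<Longrightarrow> int_size x \<le> S + 1"
proof -
  assume "\<bar>x\<bar> < 2 ^ S"
  then have "nat \<bar>x\<bar> < 2 ^ S"
    by (simp add: nat_less_iff)
  then have "floorlog 2 (nat \<bar>x\<bar>) \<le> S"
    by (intro floorlog_leI) simp_all
  then show ?thesis
    by (simp add: int_size_def)
qed

lemma bounded_reg: "bounded S (R, M) \<Longrightarrow> int_size (R r) \<le> S + 1"
  and bounded_mem: "bounded S (R, M) \<Longrightarrow> int_size (M i) \<le> S + 1"
  by (rule int_size_le; simp add: bounded_def)+

lemma runs_consequence:
  assumes "runs A S c n Q s" "n \<le> n'" "\<And>s'. bounded S s' \<Longrightarrow> Q s' \<Longrightarrow> Q' s'"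
  shows "runs A S c n' Q' s"
  using assms(1) unfolding runs_def
  by (meson assms(2,3) mult_le_mono1 le_trans)

lemma runs_weaken: "runs A S c n Q s \<Longrightarrow> n \<le> n' \<Longrightarrow> runs A S c n' Q s"
  by (erule runs_consequence)

lemma runs_Skip: "Q s \<Longrightarrow> runs A S Skip 1 Q s"
  unfolding runs_def by (intro impI exI conjI) (rule exec.Skip, auto)

lemma runs_Const:
  assumes "\<bar>c\<bar> < 2 ^ S" "Q (R(r := c), M)"
  shows "runs A S (Const r c) 1 Q (R, M)"
  unfolding runs_def
proof (intro impI exI conjI)
  show "exec A (Const r c) (R, M) (int_size c) (R(r := c), M)"
    by (rule exec.Const)
qed (use assms int_size_le[of c S] in \<open>auto simp: bounded_def\<close>)

text \<open>The size of the result may be bounded under the assumption that the store is bounded;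
  copies and decrements inherit their bound from the register that they read.\<close>

lemma runs_Arith:
  assumes "bounded S (R, M) \<Longrightarrow> \<bar>arith_op f (R a) (R b)\<bar> < 2 ^ S" "Q (R(r := arith_op f (R a) (R b)), M)"
  shows "runs A S (Arith r f a b) 1 Q (R, M)"
  unfolding runs_def
proof (intro impI exI conjI)
  assume *: "bounded S (R, M)"
  then have "int_size (R a) \<le> S + 1" "int_size (R b) \<le> S + 1"
    by (rule bounded_reg bounded_mem)+
  then show "int_size (R a) + int_size (R b) \<le> 1 * (2 * S + 2)"
    by simp
  show "exec A (Arith r f a b) (R, M) (int_size (R a) + int_size (R b)) (R(r := arith_op f (R a) (R b)), M)"
    by (rule exec.Arith)
qed (use assms in \<open>auto simp: bounded_def\<close>)

lemma runs_Load:
  assumes "Q (R(r := M (R a)), M)"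
  shows "runs A S (Load r a) 1 Q (R, M)"
  unfolding runs_def
proof (intro impI exI conjI)
  assume *: "bounded S (R, M)"
  then have "int_size (R a) \<le> S + 1" "int_size (M (R a)) \<le> S + 1"
    by (rule bounded_reg bounded_mem)+
  then show "int_size (R a) + int_size (M (R a)) \<le> 1 * (2 * S + 2)"
    by simp
  show "exec A (Load r a) (R, M) (int_size (R a) + int_size (M (R a))) (R(r := M (R a)), M)"
    by (rule exec.Load)
qed (use assms in \<open>auto simp: bounded_def\<close>)

lemma runs_Store:
  assumes "Q (R, M(R a := R r))"
  shows "runs A S (Store a r) 1 Q (R, M)"
  unfolding runs_def
proof (intro impI exI conjI)
  assume *: "bounded S (R, M)"
  then have "int_size (R a) \<le> S + 1" "int_size (R r) \<le> S + 1"
    by (rule bounded_reg bounded_mem)+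
  then show "int_size (R a) + int_size (R r) \<le> 1 * (2 * S + 2)"
    by simp
  show "exec A (Store a r) (R, M) (int_size (R a) + int_size (R r)) (R, M(R a := R r))"
    by (rule exec.Store)
qed (use assms in \<open>auto simp: bounded_def\<close>)

lemma runs_Query:
  assumes "w = map (\<lambda>i. M (R a + int i)) [0..<nat (R n)]" "Q (R(r := of_bool (w \<in> A)), M)" "1 \<le> S"
  shows "runs A S (Query r a n) (length w + 1) Q (R, M)"
  unfolding runs_def
proof (intro impI exI conjI)
  assume *: "bounded S (R, M)"
  then have "int_size (R a) \<le> S + 1" "int_size (R n) \<le> S + 1"
    by (rule bounded_reg)+
  moreover have "word_size w \<le> length w * (S + 1)"
  proof -
    have "\<forall>x\<in>set w. int_size x \<le> S + 1"
      using bounded_mem[OF *] assms(1) by simp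
    then have "sum_list (map int_size w) \<le> sum_list (map (\<lambda>_. S + 1) w)"
      by (intro sum_list_mono) auto
    then show ?thesis
      by (simp add: word_size_def sum_list_triv del: add_Suc_right)
  qed
  ultimately have "int_size (R a) + int_size (R n) + word_size w \<le> (S + 1) + (S + 1) + length w * (S + 1)"
    by (intro add_mono)
  then show "int_size (R a) + int_size (R n) + word_size w \<le> (length w + 1) * (2 * S + 2)"
    by (simp add: algebra_simps)
  show "exec A (Query r a n) (R, M) (int_size (R a) + int_size (R n) + word_size w) (R(r := of_bool (w \<in> A)), M)"
    using assms(1) by (rule exec.Query)
  have "(1 :: int) < 2 ^ S"
    using assms(3) by simp
  then show "bounded S (R(r := of_bool (w \<in> A)), M)"
    using * by (auto simp: bounded_def)
qed (rule assms(2))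

lemma runs_Seq:
  assumes "runs A S c1 n1 (\<lambda>s'. runs A S c2 n2 Q s') s"
  shows "runs A S (Seq c1 c2) (n1 + n2) Q s"
  unfolding runs_def
proof
  assume "bounded S s"
  then obtain t1 s1 where 1: "exec A c1 s t1 s1" "t1 \<le> n1 * (2 * S + 2)" "bounded S s1" "runs A S c2 n2 Q s1"
    using assms by (auto simp: runs_def[of _ _ c1])
  then obtain t2 s2 where 2: "exec A c2 s1 t2 s2" "t2 \<le> n2 * (2 * S + 2)" "bounded S s2" "Q s2"
    by (auto simp: runs_def)
  have "exec A (Seq c1 c2) s (t1 + t2) s2"
    using 1(1) 2(1) by (rule exec.Seq)
  moreover have "t1 + t2 \<le> (n1 + n2) * (2 * S + 2)"
    using 1(2) 2(2) unfolding distrib_right by (rule add_mono)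
  ultimately show "\<exists>t s'. exec A (Seq c1 c2) s t s' \<and> t \<le> (n1 + n2) * (2 * S + 2) \<and> bounded S s' \<and> Q s'"
    using 2 by blast
qed

lemma runs_IfPos:
  assumes "0 < R r \<Longrightarrow> runs A S c1 n Q (R, M)" "\<not> 0 < R r \<Longrightarrow> runs A S c2 n Q (R, M)"
  shows "runs A S (IfPos r c1 c2) (n + 1) Q (R, M)"
  unfolding runs_def
proof
  assume b: "bounded S (R, M)"
  have t: "int_size (R r) + t \<le> (n + 1) * (2 * S + 2)" if "t \<le> n * (2 * S + 2)" for t
  proof -
    have "int_size (R r) + t \<le> (S + 1) + n * (2 * S + 2)"
      using bounded_reg[OF b] that by (intro add_mono)
    then show ?thesis
      by (simp add: algebra_simps)
  qed
  show "\<exists>t s'. exec A (IfPos r c1 c2) (R, M) t s' \<and> t \<le> (n + 1) * (2 * S + 2) \<and> bounded S s' \<and> Q s'"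
  proof (cases "0 < R r")
    case True
    with assms(1) b show ?thesis
      unfolding runs_def by (meson t exec.IfTrue)
  next
    case False
    with assms(2) b show ?thesis
      unfolding runs_def by (meson t exec.IfFalse)
  qed
qed

text \<open>The invariant is indexed by the completed rounds and the number \<open>m\<close> of
  rounds is fixed in advance, so termination and time bound come together; the 1 added to
  \<open>n\<close> pays for the test.\<close>

lemma runs_WhilePos:
  assumes "I 0 s"
    and step: "\<And>j R M. j < m \<Longrightarrow> I j (R, M) \<Longrightarrow> 0 < R r \<and> runs A S c n (I (Suc j)) (R, M)"
    and stop: "\<And>R M. I m (R, M) \<Longrightarrow> \<not> 0 < R r"
  shows "runs A S (WhilePos r c) (m * (n + 1) + 1) (I m) s"
proof -
  have "runs A S (WhilePos r c) (d * (n + 1) + 1) (I m) s" if "I j s" "j + d = m" for j d s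
    using that
  proof (induction d arbitrary: j s)
    case 0
    obtain R M where s: "s = (R, M)"
      by (cases s)
    then have stop': "\<not> 0 < R r" "I m (R, M)"
      using stop 0 by auto
    show ?case
      unfolding runs_def s
    proof (intro impI exI conjI)
      assume "bounded S (R, M)"
      then show "int_size (R r) \<le> (0 * (n + 1) + 1) * (2 * S + 2)"
        using bounded_reg[of S R M r] by simp
    qed (use stop' exec.WhileFalse in auto)
  next
    case (Suc d)
    obtain R M where s: "s = (R, M)"
      by (cases s)
    have j: "j < m"
      using Suc.prems by simp
    have step': "0 < R r" "runs A S c n (I (Suc j)) (R, M)"
      using step[OF j] Suc.prems(1) s by auto
    show ?case
      unfolding runs_def
    proof
      assume b: "bounded S s"
      then have size: "int_size (R r) \<le> 2 * S + 2"
        using s bounded_reg[of S R M r] by simp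
      obtain t1 s1 where 1: "exec A c (R, M) t1 s1" "t1 \<le> n * (2 * S + 2)" "bounded S s1" "I (Suc j) s1"
        using step'(2) b s by (auto simp: runs_def)
      obtain t2 s2 where 2: "exec A (WhilePos r c) s1 t2 s2" "t2 \<le> (d * (n + 1) + 1) * (2 * S + 2)" "bounded S s2" "I m s2"
        using Suc.IH[OF 1(4)] Suc.prems(2) 1(3) by (auto simp: runs_def)
      have "exec A (WhilePos r c) s (int_size (R r) + t1 + t2) s2"
        unfolding s using step'(1) 1(1) 2(1) by (rule exec.WhileTrue)
      moreover have "int_size (R r) + t1 + t2 \<le> (2 * S + 2) + n * (2 * S + 2) + (d * (n + 1) + 1) * (2 * S + 2)"
        using size 1(2) 2(2) by (intro add_mono)
      moreover have "\<dots> = (Suc d * (n + 1) + 1) * (2 * S + 2)"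
        by (simp add: algebra_simps)
      ultimately show "\<exists>t s'. exec A (WhilePos r c) s t s' \<and> t \<le> (Suc d * (n + 1) + 1) * (2 * S + 2) \<and> bounded S s' \<and> I m s'"
        using 2 by metis
    qed
  qed
  from this[of 0 s m] assms(1) show ?thesis
    by simp
qed

section \<open>Writing a word to memory\<close>

lemmas runs_intros = runs_Seq runs_Const runs_Arith runs_Load runs_Store

text \<open>Output grows upward from address \<open>st\<close> and register 1 points behind it. The
  cells below \<open>st\<close> hold the input data and stay readable throughout.\<close>

definition emitted :: "int \<Rightarrow> (int \<Rightarrow> int) \<Rightarrow> int list \<Rightarrow> store \<Rightarrow> bool" where
  "emitted st M0 ws s \<longleftrightarrow> fst s 1 = st + int (length ws) \<and>
    (\<forall>i<length ws. snd s (st + int i) = ws ! i) \<and> (\<forall>i<st. snd s i = M0 i)"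

definition keeps :: "nat set \<Rightarrow> (nat \<Rightarrow> int) \<Rightarrow> (nat \<Rightarrow> int) \<Rightarrow> bool" where
  "keeps V R R' \<longleftrightarrow> (\<forall>r. r \<notin> V \<longrightarrow> R' r = R r)"

lemma keeps_refl: "keeps V R R"
  and keeps_trans: "keeps V R R' \<Longrightarrow> keeps V R' R'' \<Longrightarrow> keeps V R R''"
  and keeps_upd: "r \<in> V \<Longrightarrow> keeps V R R' \<Longrightarrow> keeps V R (R'(r := x))"
  by (auto simp: keeps_def)

definition emit :: "nat \<Rightarrow> program" where
  "emit r = Seq (Store 1 r) (Arith 1 Add 1 4)"

definition emit_const :: "int \<Rightarrow> program" where
  "emit_const c = Seq (Const 21 c) (emit 21)"

primrec emit_consts :: "int list \<Rightarrow> program" where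
  "emit_consts [] = Skip"
| "emit_consts (c # cs) = Seq (emit_const c) (emit_consts cs)"

text \<open>\<open>lim\<close> caps the total output length, which keeps the output pointer below
  \<open>2 ^ S\<close>.\<close>

locale emitter =
  fixes A :: "int list set" and S :: nat and st :: int and lim :: nat and M0 :: "int \<Rightarrow> int"
  assumes st: "0 \<le> st" and lim: "st + int lim < 2 ^ S"
begin

definition emits_at :: "nat set \<Rightarrow> (nat \<Rightarrow> int) \<Rightarrow> program \<Rightarrow> nat \<Rightarrow> int list \<Rightarrow> bool" where
  "emits_at V R c n ws \<longleftrightarrow> (\<forall>M ws0. emitted st M0 ws0 (R, M) \<longrightarrow> length ws0 + length ws \<le> lim \<longrightarrow>
    runs A S c n (\<lambda>(R', M'). keeps V R R' \<and> emitted st M0 (ws0 @ ws) (R', M')) (R, M))"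

text \<open>Quantifying over all registers that agree with \<open>R\<close> outside \<open>V\<close>
  makes fragments composable: what a fragment reads lies outside \<open>V\<close>, so its
  specification survives any earlier fragment that writes only to \<open>V\<close>.
  \<open>emits_at\<close> is for fragments that read registers set immediately before.\<close>

definition emits :: "nat set \<Rightarrow> (nat \<Rightarrow> int) \<Rightarrow> program \<Rightarrow> nat \<Rightarrow> int list \<Rightarrow> bool" where
  "emits V R c n ws \<longleftrightarrow> (\<forall>R'. keeps V R R' \<longrightarrow> emits_at V R' c n ws)"

lemma emits_atI:
  assumes "\<And>M ws0. emitted st M0 ws0 (R, M) \<Longrightarrow> length ws0 + length ws \<le> lim \<Longrightarrow>
    runs A S c n (\<lambda>(R', M'). keeps V R R' \<and> emitted st M0 (ws0 @ ws) (R', M')) (R, M)"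
  shows "emits_at V R c n ws"
  using assms by (simp add: emits_at_def)

lemma emits_atD:
  assumes "emits_at V R c n ws" "emitted st M0 ws0 (R, M)" "length ws0 + length ws \<le> lim"
    and "\<And>R' M'. keeps V R R' \<Longrightarrow> emitted st M0 (ws0 @ ws) (R', M') \<Longrightarrow> Q (R', M')"
  shows "runs A S c n Q (R, M)"
proof (rule runs_consequence)
  show "runs A S c n (\<lambda>(R', M'). keeps V R R' \<and> emitted st M0 (ws0 @ ws) (R', M')) (R, M)"
    using assms by (simp add: emits_at_def)
qed (use assms(4) in auto)

lemma emits_imp_at: "emits V R c n ws \<Longrightarrow> emits_at V R c n ws"
  unfolding emits_def using keeps_refl by blast

lemma emits_weaken: "emits V R c n ws \<Longrightarrow> n \<le> n' \<Longrightarrow> ws = ws' \<Longrightarrow> emits V R c n' ws'"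
  unfolding emits_def emits_at_def by (blast intro: runs_weaken)

lemma emits_at_Seq:
  assumes "emits_at V R c1 n1 ws1" "\<And>R'. keeps V R R' \<Longrightarrow> emits_at V R' c2 n2 ws2"
  shows "emits_at V R (Seq c1 c2) (n1 + n2) (ws1 @ ws2)"
proof (rule emits_atI, rule runs_Seq)
  fix M ws0
  assume e: "emitted st M0 ws0 (R, M)" and l: "length ws0 + length (ws1 @ ws2) \<le> lim"
  show "runs A S c1 n1 (\<lambda>s'. runs A S c2 n2 (\<lambda>(R', M'). keeps V R R' \<and> emitted st M0 (ws0 @ ws1 @ ws2) (R', M')) s') (R, M)"
  proof (rule emits_atD[OF assms(1) e])
    fix R' M'
    assume k: "keeps V R R'" and e': "emitted st M0 (ws0 @ ws1) (R', M')"
    show "runs A S c2 n2 (\<lambda>(R', M'). keeps V R R' \<and> emitted st M0 (ws0 @ ws1 @ ws2) (R', M')) (R', M')"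
      by (rule emits_atD[OF assms(2)[OF k] e']) (use l keeps_trans[OF k] in auto)
  qed (use l in simp)
qed

lemma emits_Seq: "emits V R c1 n1 ws1 \<Longrightarrow> emits V R c2 n2 ws2 \<Longrightarrow> emits V R (Seq c1 c2) (n1 + n2) (ws1 @ ws2)"
  unfolding emits_def by (blast intro: emits_at_Seq keeps_trans)

lemma emits_at_emit:
  assumes "R r = v" "R 4 = 1" "r \<noteq> 1" "1 \<in> V"
  shows "emits_at V R (emit r) 2 [v]"
proof (rule emits_atI)
  fix M ws0
  assume e: "emitted st M0 ws0 (R, M)" and l: "length ws0 + length [v] \<le> lim"
  have R1: "R 1 = st + int (length ws0)"
    using e by (simp add: emitted_def)
  have "emitted st M0 (ws0 @ [v]) (R(1 := R 1 + R 4), M(R 1 := R r))"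
    using e assms st by (auto simp: emitted_def nth_append less_Suc_eq)
  moreover have "\<bar>R 1 + R 4\<bar> < 2 ^ S"
    using R1 assms l st lim by simp
  ultimately have "runs A S (emit r) (1 + 1) (\<lambda>(R', M'). keeps V R R' \<and> emitted st M0 (ws0 @ [v]) (R', M')) (R, M)"
    unfolding emit_def by (intro runs_intros) (use assms(4) in \<open>auto simp: keeps_def\<close>)
  then show "runs A S (emit r) 2 (\<lambda>(R', M'). keeps V R R' \<and> emitted st M0 (ws0 @ [v]) (R', M')) (R, M)"
    by (simp only: one_add_one)
qed

lemma emits_emit:
  assumes "R r = v" "R 4 = 1" "r \<notin> V" "4 \<notin> V" "1 \<in> V"
  shows "emits V R (emit r) 2 [v]"
  unfolding emits_def
  using assms by (auto intro!: emits_at_emit simp: keeps_def)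

lemma emitted_upd: "r \<noteq> 1 \<Longrightarrow> emitted st M0 ws (R(r := x), M) = emitted st M0 ws (R, M)"
  by (simp add: emitted_def)

lemma emits_at_assign:
  assumes "\<And>M Q. Q (R(r := x), M) \<Longrightarrow> runs A S c n Q (R, M)" "r \<in> V" "r \<noteq> 1"
    and "emits_at V (R(r := x)) c' n' ws"
  shows "emits_at V R (Seq c c') (n + n') ws"
proof (rule emits_atI, rule runs_Seq, rule assms(1), rule emits_atD[OF assms(4)])
  fix M ws0
  assume "emitted st M0 ws0 (R, M)"
  then show "emitted st M0 ws0 (R(r := x), M)"
    using assms(3) by (simp add: emitted_upd)
next
  fix ws0 R' M'
  assume k: "keeps V (R(r := x)) R'" and "emitted st M0 (ws0 @ ws) (R', M')"
  moreover have "keeps V R R'"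
    using keeps_trans[OF keeps_upd[OF assms(2) keeps_refl] k] .
  ultimately show "case (R', M') of (R', M') \<Rightarrow> keeps V R R' \<and> emitted st M0 (ws0 @ ws) (R', M')"
    by simp
qed

lemma emits_emit_const:
  assumes "R 4 = 1" "\<bar>c\<bar> < 2 ^ S" "4 \<notin> V" "1 \<in> V" "21 \<in> V"
  shows "emits V R (emit_const c) 3 [c]"
  unfolding emits_def emit_const_def
proof (intro allI impI)
  fix R'
  assume "keeps V R R'"
  then have "R' 4 = 1"
    using assms by (simp add: keeps_def)
  then have "emits_at V (R'(21 := c)) (emit 21) 2 [c]"
    using assms by (intro emits_at_emit) auto
  then have "emits_at V R' (Seq (Const 21 c) (emit 21)) (1 + 2) [c]"
    using assms by (intro emits_at_assign runs_Const) simp_all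
  then show "emits_at V R' (Seq (Const 21 c) (emit 21)) 3 [c]"
    by (simp add: eval_nat_numeral)
qed

lemma emits_Skip: "emits V R Skip 1 []"
  unfolding emits_def by (auto intro!: emits_atI runs_Skip simp: keeps_refl simp del: One_nat_def)

lemma emits_emit_consts:
  assumes "R 4 = 1" "\<And>c. c \<in> set cs \<Longrightarrow> \<bar>c\<bar> < 2 ^ S" and V: "4 \<notin> V" "1 \<in> V" "21 \<in> V"
  shows "emits V R (emit_consts cs) (3 * length cs + 1) cs"
  using assms(2)
proof (induction cs)
  case (Cons c cs)
  have "emits V R (emit_consts (c # cs)) (3 + (3 * length cs + 1)) ([c] @ cs)"
    unfolding emit_consts.simps using Cons by (intro emits_Seq emits_emit_const Cons.IH assms(1) V) auto
  then show ?case
    by (simp add: algebra_simps)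
qed (simp add: emits_Skip[unfolded One_nat_def])

text \<open>Register \<open>r\<close> counts down from \<open>m\<close> and is preserved by the
  body; further loop variables are described by \<open>I\<close>, which is indifferent to
  \<open>r\<close> by \<open>I_upd\<close>. A round costs the body, the decrement and the
  test.\<close>

lemma emits_at_For:
  assumes "R r = int m" "R 4 = 1" "r \<in> V" "r \<noteq> 1" "4 \<notin> V"
    and I: "I 0 R"
    and I_upd: "\<And>j R x. I j R \<Longrightarrow> I j (R(r := x))"
    and step: "\<And>j R' M ws0. j < m \<Longrightarrow> keeps V R R' \<Longrightarrow> R' r = int (m - j) \<Longrightarrow> I j R' \<Longrightarrow>
      emitted st M0 ws0 (R', M) \<Longrightarrow> length ws0 + length (f j) \<le> lim \<Longrightarrow>
      runs A S c n (\<lambda>(R'', M'). keeps V R' R'' \<and> R'' r = R' r \<and> I (Suc j) R'' \<and>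
        emitted st M0 (ws0 @ f j) (R'', M')) (R', M)"
  shows "emits_at V R (WhilePos r (Seq c (Arith r Sub r 4))) (m * (n + 2) + 1) (concat (map f [0..<m]))"
proof (rule emits_atI)
  fix M ws0
  assume e: "emitted st M0 ws0 (R, M)" and l: "length ws0 + length (concat (map f [0..<m])) \<le> lim"
  define inv where "inv j s \<longleftrightarrow> keeps V R (fst s) \<and> fst s r = int (m - j) \<and> I j (fst s) \<and>
    emitted st M0 (ws0 @ concat (map f [0..<j])) s" for j s
  have "runs A S (WhilePos r (Seq c (Arith r Sub r 4))) (m * (n + 1 + 1) + 1) (inv m) (R, M)"
  proof (rule runs_WhilePos)
    show "inv 0 (R, M)"
      using e I assms(1) by (simp add: inv_def keeps_refl)
  next
    fix j R' M'
    assume j: "j < m" and inv: "inv j (R', M')"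
    have len: "length ws0 + length (concat (map f [0..<j])) + length (f j) \<le> lim"
    proof -
      have "[0..<m] = [0..<Suc j] @ [Suc j..<m]"
        using j by (metis Suc_leI le_add_diff_inverse upt_add_eq_append zero_le)
      then show ?thesis
        using l by simp
    qed
    have k: "keeps V R R'"
      using inv by (simp add: inv_def)
    have "runs A S (Seq c (Arith r Sub r 4)) (n + 1) (inv (Suc j)) (R', M')"
    proof (rule runs_Seq)
      have "runs A S c n (\<lambda>(R'', M''). keeps V R' R'' \<and> R'' r = R' r \<and> I (Suc j) R'' \<and>
          emitted st M0 ((ws0 @ concat (map f [0..<j])) @ f j) (R'', M'')) (R', M')"
        using step[OF j k, of "ws0 @ concat (map f [0..<j])" M'] inv len by (simp add: inv_def)
      then show "runs A S c n (\<lambda>s'. runs A S (Arith r Sub r 4) 1 (inv (Suc j)) s') (R', M')"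
      proof (rule runs_consequence; clarify?)
        fix R'' M''
        assume k': "keeps V R' R''" and r: "R'' r = R' r" and I': "I (Suc j) R''"
          and e': "emitted st M0 ((ws0 @ concat (map f [0..<j])) @ f j) (R'', M'')"
        have R4: "R'' 4 = 1"
          using keeps_trans[OF k k'] assms(2,5) by (simp add: keeps_def)
        have eq: "R'' r - 1 = int (m - Suc j)"
          using r inv j by (simp add: inv_def of_nat_diff)
        show "runs A S (Arith r Sub r 4) 1 (inv (Suc j)) (R'', M'')"
        proof (rule runs_Arith)
          assume "bounded S (R'', M'')"
          then have "\<bar>R'' r\<bar> < 2 ^ S"
            by (simp add: bounded_def)
          moreover have "0 \<le> R'' r - 1"
            unfolding eq by simp
          ultimately show "\<bar>arith_op Sub (R'' r) (R'' 4)\<bar> < 2 ^ S"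
            using R4 by simp
        next
          show "inv (Suc j) (R''(r := arith_op Sub (R'' r) (R'' 4)), M'')"
            using e' I_upd[OF I'] keeps_upd[OF assms(3) keeps_trans[OF k k']] assms(4) by (simp add: inv_def R4 eq emitted_upd)
        qed
      qed
    qed
    moreover have "0 < R' r"
      using inv j by (simp add: inv_def)
    ultimately show "0 < R' r \<and> runs A S (Seq c (Arith r Sub r 4)) (n + 1) (inv (Suc j)) (R', M')"
      by simp
  qed (simp add: inv_def)
  then show "runs A S (WhilePos r (Seq c (Arith r Sub r 4))) (m * (n + 2) + 1)
      (\<lambda>(R', M'). keeps V R R' \<and> emitted st M0 (ws0 @ concat (map f [0..<m])) (R', M')) (R, M)"
    by (rule runs_consequence) (auto simp: inv_def)
qed

end

section \<open>Words for the rows of the chain and programs that write them\<close>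

definition pair_word :: "nat \<Rightarrow> int \<Rightarrow> int \<Rightarrow> int list" where
  "pair_word k J x = [tilt k J x, 2 * scale k J * scale k J, tilt k J (- x), 2 * scale k J * scale k J]"

text \<open>The companion matrix times \<open>L\<close>: all rows but the last one are shifts, with
  \<open>L\<close> in place of 1, and the last row holds the scaled coefficients, oldest term
  first.\<close>

definition coefficient :: "nat \<Rightarrow> int \<Rightarrow> (nat \<Rightarrow> int) \<Rightarrow> nat \<Rightarrow> nat \<Rightarrow> int" where
  "coefficient k L a i l = (if Suc i = k then a l else if l = Suc i then L else 0)"

definition disabled_word :: "nat \<Rightarrow> int list" where
  "disabled_word k = [0, 0] @ concat (replicate (9 + 2 * k) [0, 1])"

text \<open>The weights 0 and 1 at the start of the row happen to be spelled like the fraction 0;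
  with the zero probabilities of the states 0 to 4 this gives six copies of
  \<open>[0, 1]\<close>.\<close>

definition chain_word :: "nat \<Rightarrow> (nat \<Rightarrow> nat \<Rightarrow> int) \<Rightarrow> (nat \<Rightarrow> int) \<Rightarrow> int \<Rightarrow> int \<Rightarrow> nat \<Rightarrow> int list" where
  "chain_word k X B J \<sigma> i =
    concat (replicate 6 [0, 1]) @
    [scale k J * (int k * J - J + 1) - 1, scale k J * scale k J, scale k J - 1, 2 * J * scale k J] @
    pair_word k J (\<sigma> * B i) @ concat (map (\<lambda>l. pair_word k J (\<sigma> * X i l)) [0..<k])"

abbreviation "volatile_row \<equiv> {1, 20, 21, 22, 23, 24, 25, 26, 27, 28}"

text \<open>
  Registers: 1 is the output pointer, 2 the start of the output, 8 and 9 hold \<open>L\<close> and \<open>J\<close>, 29, 30 and 31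
  hold \<open>k - i\<close>, the address of the output value of chain state \<open>i\<close>, and the sign of the row.  Register 7
  is never written and stays \<open>0\<close>.
\<close>

definition constants :: "nat \<Rightarrow> int \<Rightarrow> int \<Rightarrow> (nat \<Rightarrow> int) \<Rightarrow> bool" where
  "constants k L J R \<longleftrightarrow> (let Q = scale k J in
    R 3 = int k \<and> R 4 = 1 \<and> R 5 = 9 + 2 * int k \<and> R 6 = 2 \<and> R 7 = 0 \<and> R 8 = L \<and> R 10 = Q \<and>
    R 11 = Q * Q \<and> R 12 = 2 * Q * Q \<and> R 13 = Q * (J - 1) + 1 \<and> R 14 = Q * (int k * J - J + 1) - 1 \<and>
    R 15 = Q - 1 \<and> R 16 = 2 * J * Q \<and> R 17 = 2 * int k - 1)"

lemma constants_keeps: "constants k L J R \<Longrightarrow> keeps volatile_row R R' \<Longrightarrow> constants k L J R'"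
  by (simp add: constants_def keeps_def Let_def)

lemma keeps_mono: "keeps V R R' \<Longrightarrow> V \<subseteq> V' \<Longrightarrow> keeps V' R R'"
  by (auto simp: keeps_def)

definition emit_zeros :: "nat \<Rightarrow> program" where
  "emit_zeros r = Seq (Arith 20 Add r 7) (WhilePos 20 (Seq (Seq (emit 7) (emit 4)) (Arith 20 Sub 20 4)))"

definition emit_pair :: program where
  "emit_pair = Seq (Arith 22 Mul 10 24) (Seq (Arith 23 Add 13 22) (Seq (emit 23) (Seq (emit 12)
    (Seq (Arith 23 Sub 13 22) (Seq (emit 23) (emit 12))))))"

text \<open>Register 27 holds \<open>k - 1 - i\<close> and register 25 holds \<open>k - l\<close>.
  The last row is recognized by 0 in register 27, and \<open>l = Suc i\<close> means that both
  registers are equal, which is tested by the signs of the two differences.\<close>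

definition select_coefficient :: program where
  "select_coefficient =
    IfPos 27
      (Seq (Arith 28 Sub 25 27)
        (IfPos 28 (Const 24 0)
          (Seq (Arith 28 Sub 27 25) (IfPos 28 (Const 24 0) (Arith 24 Add 8 7)))))
      (Load 24 26)"

definition emit_output_pair :: program where
  "emit_output_pair = Seq (Load 24 30) (Seq (Arith 24 Mul 31 24) emit_pair)"

definition emit_coefficient_pair :: program where
  "emit_coefficient_pair =
    Seq select_coefficient (Seq (Arith 24 Mul 31 24) (Seq emit_pair (Arith 26 Sub 26 6)))"

definition emit_coefficient_pairs :: program where
  "emit_coefficient_pairs =
    Seq (Arith 25 Add 3 7) (Seq (Arith 26 Add 17 7) (Seq (Arith 27 Sub 29 4)
      (WhilePos 25 (Seq emit_coefficient_pair (Arith 25 Sub 25 4)))))"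

definition emit_row :: program where
  "emit_row =
    Seq (emit_consts (concat (replicate 6 [0, 1])))
    (Seq (emit 14) (Seq (emit 11) (Seq (emit 15) (Seq (emit 16)
    (Seq emit_output_pair (Seq emit_coefficient_pairs
    (Seq (emit_consts [0, 0]) (emit_zeros 5))))))))"

context emitter
begin

text \<open>Adding a register that contains 0 serves as the move instruction; the copied value is
  bounded because the store is.\<close>

lemma runs_move: "R z = 0 \<Longrightarrow> Q (R(r := R a), M) \<Longrightarrow> runs A S (Arith r Add a z) 1 Q (R, M)"
  by (rule runs_Arith) (simp_all add: bounded_def)

lemma emits_emit_zeros:
  assumes R: "R r = int m" "R 4 = 1" "R 7 = 0" and V: "r \<notin> V" "4 \<notin> V" "7 \<notin> V" "1 \<in> V" "20 \<in> V"
  shows "emits V R (emit_zeros r) (6 * m + 2) (concat (replicate m [0, 1]))"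
  unfolding emits_def
proof (intro allI impI)
  fix R'
  assume "keeps V R R'"
  then have R': "R' r = int m" "R' 4 = 1" "R' 7 = 0"
    using R V by (simp_all add: keeps_def)
  let ?R = "R'(20 := R' r)"
  have "emits_at V ?R (WhilePos 20 (Seq (Seq (emit 7) (emit 4)) (Arith 20 Sub 20 4))) (m * ((2 + 2) + 2) + 1)
      (concat (map (\<lambda>_. [0, 1]) [0..<m]))"
  proof (rule emits_at_For[where I="\<lambda>_ _. True"])
    fix j R'' M ws0
    assume k: "keeps V ?R R''" and e: "emitted st M0 ws0 (R'', M)" and l: "length ws0 + length [0 :: int, 1] \<le> lim"
    have R'': "R'' 7 = 0" "R'' 4 = 1"
      using k R' V by (auto simp: keeps_def)
    let ?V = "{1 :: nat}"
    have "emits_at ?V R'' (Seq (emit 7) (emit 4)) (2 + 2) ([0] @ [1])"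
      by (rule emits_imp_at, rule emits_Seq; rule emits_emit) (simp_all add: R'')
    then show "runs A S (Seq (emit 7) (emit 4)) (2 + 2) (\<lambda>(R''', M'). keeps V R'' R''' \<and> R''' 20 = R'' 20 \<and> True \<and>
        emitted st M0 (ws0 @ [0, 1]) (R''', M')) (R'', M)"
    proof (rule emits_atD[OF _ e])
      fix R3 M3
      assume k3: "keeps {1} R'' R3" and "emitted st M0 (ws0 @ [0] @ [1]) (R3, M3)"
      moreover have "keeps V R'' R3" "R3 20 = R'' 20"
        using keeps_mono[OF k3, of V] k3 V by (simp_all add: keeps_def)
      ultimately show "case (R3, M3) of (R''', M') \<Rightarrow> keeps V R'' R''' \<and> R''' 20 = R'' 20 \<and> True \<and>
          emitted st M0 (ws0 @ [0, 1]) (R''', M')"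
        by simp
    qed (use l in simp)
  qed (use R' V in auto)
  note while = this
  have "emits_at V R' (emit_zeros r) (1 + (m * ((2 + 2) + 2) + 1)) (concat (map (\<lambda>_. [0, 1]) [0..<m]))"
    unfolding emit_zeros_def
  proof (rule emits_at_assign[OF _ _ _ while])
    show "runs A S (Arith 20 Add r 7) 1 Q (R', M)" if "Q (R'(20 := R' r), M)" for M Q
      using R'(3) that by (rule runs_move)
  qed (use V in simp_all)
  then show "emits_at V R' (emit_zeros r) (6 * m + 2) (concat (replicate m [0, 1]))"
    by (simp add: map_replicate_const mult.commute)
qed

end

text \<open>The odd input cells, where the numerators were, hold integers by now, coefficients
  before initial values. \<open>a\<close> reads the coefficients backwards, since a companion row
  starts with the oldest term. The output begins right behind the input, whose length is
  \<open>4 * k + 1\<close>.\<close>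

locale row_emitter = emitter +
  fixes k :: nat and L J :: int and a b :: "nat \<Rightarrow> int"
  assumes k: "1 \<le> k"
    and cell_a: "\<And>l. l < k \<Longrightarrow> M0 (2 * int k - 1 - 2 * int l) = a l"
    and cell_b: "\<And>i. i < k \<Longrightarrow> M0 (2 * int k + 1 + 2 * int i) = b i"
    and st_eq: "st = 4 * int k + 1"
    and a: "\<And>l. l < k \<Longrightarrow> \<bar>a l\<bar> < J" and b: "\<And>i. i < k \<Longrightarrow> \<bar>b i\<bar> < J" and L: "\<bar>L\<bar> < J"
    and big: "2 * scale k J * scale k J < 2 ^ S"
begin

abbreviation "Q \<equiv> scale k J"

lemma J1: "1 \<le> J"
  using L by linarith

lemma two_J_le_Q: "2 * J \<le> Q"
  using k J1 by (simp add: scale_def)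

lemma prod_bound: "0 \<le> x \<Longrightarrow> x \<le> Q \<Longrightarrow> 0 \<le> y \<Longrightarrow> y \<le> 2 * Q \<Longrightarrow> \<bar>x * y\<bar> < 2 ^ S"
proof -
  assume "0 \<le> x" "x \<le> Q" "0 \<le> y" "y \<le> 2 * Q"
  then have "x * y \<le> Q * (2 * Q)" "0 \<le> x * y"
    by (auto intro!: mult_mono)
  then show ?thesis
    using big by (simp add: mult.assoc mult.left_commute)
qed

lemma tilt_bound: "\<bar>x\<bar> < J \<Longrightarrow> 0 < tilt k J x \<and> tilt k J x \<le> Q * Q \<and> tilt k J x < 2 ^ S"
proof -
  assume x: "\<bar>x\<bar> < J"
  have Q: "2 \<le> Q"
    using two_J_le_Q J1 by linarith
  have eq: "tilt k J x = Q * (J - 1 + x) + 1"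
    by (simp add: tilt_def distrib_left)
  have "0 \<le> Q * (J - 1 + x)"
    using x Q by (intro mult_nonneg_nonneg) auto
  moreover have "Q * (J - 1 + x) \<le> Q * (Q - 1)"
    using x Q two_J_le_Q by (intro mult_left_mono) auto
  moreover have "Q * (Q - 1) + 1 \<le> Q * Q"
    using Q by (simp add: right_diff_distrib)
  moreover have "0 \<le> Q * Q"
    using Q by (intro mult_nonneg_nonneg) auto
  ultimately show ?thesis
    using big eq by (simp add: mult.assoc) 
qed

text \<open>The two numerators lie symmetrically around the content of register 13; register 22
  keeps \<open>Q * x\<close>, so one multiplication serves both.\<close>

lemma runs_emit_pair:
  assumes c: "constants k L J R" and x: "\<bar>R 24\<bar> < J"
    and e: "emitted st M0 ws0 (R, M)" and l: "length ws0 + 4 \<le> lim"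
    and Q: "\<And>R' M'. keeps {1, 22, 23} R R' \<Longrightarrow> emitted st M0 (ws0 @ pair_word k J (R 24)) (R', M') \<Longrightarrow> P (R', M')"
  shows "runs A S emit_pair 11 P (R, M)"
proof -
  let ?x = "R 24" and ?V = "{1 :: nat, 22, 23}"
  have R: "R 10 = Q" "R 13 = Q * (J - 1) + 1" "R 12 = 2 * Q * Q" "R 4 = 1"
    using c by (simp_all add: constants_def Let_def)
  have t: "tilt k J ?x = Q * (J - 1) + 1 + Q * ?x" "tilt k J (- ?x) = Q * (J - 1) + 1 - Q * ?x"
    by (simp_all add: tilt_def)
  have bnd: "\<bar>Q * (J - 1) + 1 + Q * ?x\<bar> < 2 ^ S" "\<bar>Q * (J - 1) + 1 - Q * ?x\<bar> < 2 ^ S"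
    using tilt_bound[OF x] tilt_bound[of "- ?x"] x unfolding t by simp_all
  have bnd': "\<bar>Q * ?x\<bar> < 2 ^ S"
  proof -
    have "\<bar>Q * ?x\<bar> \<le> \<bar>Q\<bar> * J"
      unfolding abs_mult using x by (intro mult_left_mono) auto
    also have "\<bar>Q\<bar> * J < 2 ^ S"
      using prod_bound[of "\<bar>Q\<bar>" J] two_J_le_Q J1 by simp
    finally show ?thesis .
  qed
  let ?R1 = "R(22 := Q * ?x, 23 := tilt k J ?x)"
  have e1: "emits_at {1} ?R1 (Seq (emit 23) (emit 12)) (2 + 2) ([tilt k J ?x] @ [2 * Q * Q])"
    by (rule emits_imp_at, rule emits_Seq; rule emits_emit) (simp_all add: R)
  have e2: "emits_at {1} (R'(23 := tilt k J (- ?x))) (Seq (emit 23) (emit 12)) (2 + 2) ([tilt k J (- ?x)] @ [2 * Q * Q])"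
    if "keeps {1} ?R1 R'" for R'
    using that by (intro emits_imp_at emits_Seq emits_emit) (auto simp: keeps_def R)
  have "runs A S (Seq (emit 23) (Seq (emit 12) (Seq (Arith 23 Sub 13 22) (Seq (emit 23) (emit 12))))) (2 + (2 + (1 + 4))) P (?R1, M)"
  proof -
    have em: "emits_at {1} ?R1 (emit 23) 2 [tilt k J ?x]"
      by (rule emits_imp_at, rule emits_emit) (simp_all add: R)
    show ?thesis
    proof (rule runs_Seq, rule emits_atD[OF em])
      show "emitted st M0 ws0 (?R1, M)"
        using e by (simp add: emitted_upd)
    next
      fix R' M'
      assume k1: "keeps {1} ?R1 R'" and e': "emitted st M0 (ws0 @ [tilt k J ?x]) (R', M')"
      have em: "emits_at {1} R' (emit 12) 2 [2 * Q * Q]"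
        using k1 by (intro emits_imp_at emits_emit) (simp_all add: R keeps_def)
      show "runs A S (Seq (emit 12) (Seq (Arith 23 Sub 13 22) (Seq (emit 23) (emit 12)))) (2 + (1 + 4)) P (R', M')"
      proof (rule runs_Seq, rule emits_atD[OF em e'])
        fix R2 M2
        assume k2: "keeps {1} R' R2" and e2': "emitted st M0 ((ws0 @ [tilt k J ?x]) @ [2 * Q * Q]) (R2, M2)"
        have k12: "keeps {1} ?R1 R2"
          using k1 k2 by (rule keeps_trans)
        then have R2: "R2 13 = Q * (J - 1) + 1" "R2 22 = Q * ?x"
          by (simp_all add: keeps_def R)
        show "runs A S (Seq (Arith 23 Sub 13 22) (Seq (emit 23) (emit 12))) (1 + 4) P (R2, M2)"
        proof (rule runs_Seq, rule runs_Arith)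
          show "\<bar>arith_op Sub (R2 13) (R2 22)\<bar> < 2 ^ S"
            using bnd by (simp add: R2)
          have "runs A S (Seq (emit 23) (emit 12)) (2 + 2) P (R2(23 := tilt k J (- ?x)), M2)"
          proof (rule emits_atD[OF e2[OF k12]])
            show "emitted st M0 ((ws0 @ [tilt k J ?x]) @ [2 * Q * Q]) (R2(23 := tilt k J (- ?x)), M2)"
              using e2' by (simp add: emitted_upd)
          next
            fix R3 M3
            assume "keeps {1} (R2(23 := tilt k J (- ?x))) R3"
              "emitted st M0 (((ws0 @ [tilt k J ?x]) @ [2 * Q * Q]) @ [tilt k J (- ?x)] @ [2 * Q * Q]) (R3, M3)"
            then show "P (R3, M3)"
              using k12 by (intro Q) (auto simp: keeps_def pair_word_def)
          qed (use l in simp)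
          then show "runs A S (Seq (emit 23) (emit 12)) 4 P (R2(23 := arith_op Sub (R2 13) (R2 22)), M2)"
            by (simp add: R2 t)
        qed
      qed (use l in simp)
    qed (use l in simp)
  qed
  note main = this
  have "runs A S emit_pair (1 + (1 + (2 + (2 + (1 + 4))))) P (R, M)"
    unfolding emit_pair_def
  proof (rule runs_Seq, rule runs_Arith)
    show "runs A S (Seq (Arith 23 Add 13 22) (Seq (emit 23) (Seq (emit 12) (Seq (Arith 23 Sub 13 22) (Seq (emit 23) (emit 12))))))
        (1 + (2 + (2 + (1 + 4)))) P (R(22 := arith_op Mul (R 10) (R 24)), M)"
    proof (rule runs_Seq, rule runs_Arith)
    qed (use main bnd in \<open>simp_all add: R t\<close>)
  qed (use bnd' in \<open>simp add: R\<close>)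
  then show ?thesis
    by simp
qed

lemma runs_select_coefficient:
  assumes c: "constants k L J R" and M: "\<And>x. x < st \<Longrightarrow> M x = M0 x"
    and R: "R 25 = int (k - l)" "R 26 = 2 * int k - 1 - 2 * int l" "R 27 = int k - int i - 1"
    and i: "i < k" and l: "l < k"
    and Q: "\<And>x. P (R(28 := x, 24 := coefficient k L a i l), M)"
  shows "runs A S select_coefficient 6 P (R, M)"
proof -
  have cR: "R 7 = 0" "R 8 = L"
    using c by (simp_all add: constants_def Let_def)
  have one: "\<bar>0 :: int\<bar> < 2 ^ S"
    by simp
  have kS: "\<bar>R 27 - R 25\<bar> < 2 ^ S"  "\<bar>R 25 - R 27\<bar> < 2 ^ S"
  proof -
    have "int k \<le> st"
      unfolding st_eq by simp
    then have "int k < 2 ^ S"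
      using lim by linarith
    moreover have "0 \<le> R 25" "R 25 \<le> int k" "0 \<le> R 27" "R 27 \<le> int k"
      using R i l by auto
    ultimately show "\<bar>R 27 - R 25\<bar> < 2 ^ S"  "\<bar>R 25 - R 27\<bar> < 2 ^ S"
      by linarith+
  qed
  have "runs A S select_coefficient (5 + 1) P (R, M)"
    unfolding select_coefficient_def
  proof (rule runs_IfPos)
    assume "0 < R 27"
    then have i': "Suc i < k"
      using R i by linarith
    show "runs A S (Seq (Arith 28 Sub 25 27)
        (IfPos 28 (Const 24 0) (Seq (Arith 28 Sub 27 25) (IfPos 28 (Const 24 0) (Arith 24 Add 8 7))))) 5 P (R, M)"
    proof (rule runs_weaken, rule runs_Seq, rule runs_Arith, simp add: kS, rule runs_IfPos)
      let ?R = "R(28 := arith_op Sub (R 25) (R 27))"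
      assume "0 < ?R 28"
      then have "coefficient k L a i l = 0"
        using R i' l by (simp add: coefficient_def)
      then show "runs A S (Const 24 0) 3 P (?R, M)"
        using Q[of "arith_op Sub (R 25) (R 27)"] by (intro runs_weaken[OF runs_Const[OF one]]) simp_all
    next
      let ?R = "R(28 := arith_op Sub (R 25) (R 27))"
      assume le: "\<not> 0 < ?R 28"
      have "runs A S (Seq (Arith 28 Sub 27 25) (IfPos 28 (Const 24 0) (Arith 24 Add 8 7))) (1 + (1 + 1)) P (?R, M)"
      proof (rule runs_Seq, rule runs_Arith, simp add: kS, rule runs_IfPos)
        let ?R' = "?R(28 := arith_op Sub (?R 27) (?R 25))"
        assume "0 < ?R' 28"
        then have "coefficient k L a i l = 0"
          using R i' l by (simp add: coefficient_def)
        then show "runs A S (Const 24 0) 1 P (?R', M)"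
          using Q[of "?R' 28"] by (intro runs_Const[OF one]) simp
      next
        let ?R' = "?R(28 := arith_op Sub (?R 27) (?R 25))"
        assume "\<not> 0 < ?R' 28"
        then have "coefficient k L a i l = L"
          using R i' l le by (auto simp: coefficient_def)
        then show "runs A S (Arith 24 Add 8 7) 1 P (?R', M)"
          using Q[of "?R' 28"] by (intro runs_move) (simp_all add: cR)
      qed
      then show "runs A S (Seq (Arith 28 Sub 27 25) (IfPos 28 (Const 24 0) (Arith 24 Add 8 7))) 3 P (?R, M)"
        by (simp add: eval_nat_numeral)
    qed simp
  next
    assume "\<not> 0 < R 27"
    then have "Suc i = k"
      using R i by linarith
    then have "coefficient k L a i l = M (R 26)"
      using M[of "R 26"] cell_a[OF l] R st_eq l by (simp add: coefficient_def)
    then show "runs A S (Load 24 26) 5 P (R, M)"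
      using Q[of "R 28"] by (intro runs_weaken[OF runs_Load]) simp_all
  qed
  then show ?thesis
    by simp
qed

lemma emitted_mem: "emitted st M0 ws (R, M) \<Longrightarrow> x < st \<Longrightarrow> M x = M0 x"
  by (simp add: emitted_def)

lemma J_bound: "\<bar>x\<bar> < J \<Longrightarrow> \<bar>x\<bar> < 2 ^ S"
  using prod_bound[of 1 J] two_J_le_Q J1 by simp

lemma abs_sign_mult: "\<sigma> \<in> {1, - 1} \<Longrightarrow> \<bar>\<sigma> * x\<bar> = \<bar>x :: int\<bar>"
  by auto

lemma abs_coefficient: "l < k \<Longrightarrow> \<bar>coefficient k L a i l\<bar> < J"
  using a L J1 by (simp add: coefficient_def)

lemma constants_upd:
  "r \<in> volatile_row \<union> {29, 30, 31} \<Longrightarrow> constants k L J (R(r := x)) = constants k L J R"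
  by (auto simp: constants_def Let_def)

lemma emits_at_output_pair:
  assumes c: "constants k L J R" and R: "R 30 = 2 * int k + 1 + 2 * int i" "R 31 \<in> {1, - 1}" and i: "i < k"
  shows "emits_at volatile_row R emit_output_pair 13
    (pair_word k J (R 31 * b i))"
proof -
  have "emits_at volatile_row R emit_output_pair (1 + (1 + 11)) (pair_word k J (R 31 * b i))"
    unfolding emit_output_pair_def
  proof (rule emits_atI, rule runs_Seq, rule runs_Load, rule runs_Seq, rule runs_Arith)
    fix M ws0
    assume e: "emitted st M0 ws0 (R, M)" and l: "length ws0 + length (pair_word k J (R 31 * b i)) \<le> lim"
    let ?R1 = "R(24 := M (R 30))"
    have Mb: "M (R 30) = b i"
      using emitted_mem[OF e, of "R 30"] R i cell_b[OF i] st_eq by simp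
    have x: "\<bar>R 31 * b i\<bar> < J"
      using abs_sign_mult[OF R(2)] b[OF i] by simp
    then show "\<bar>arith_op Mul (?R1 31) (?R1 24)\<bar> < 2 ^ S"
      using J_bound Mb by simp
    let ?R2 = "?R1(24 := arith_op Mul (?R1 31) (?R1 24))"
    have R2: "?R2 24 = R 31 * b i"
      using Mb by simp
    show "runs A S emit_pair 11 (\<lambda>(R', M'). keeps volatile_row R R' \<and>
        emitted st M0 (ws0 @ pair_word k J (R 31 * b i)) (R', M')) (?R2, M)"
    proof (rule runs_emit_pair)
      show "constants k L J ?R2"
        using c by (simp add: constants_upd)
      show "emitted st M0 ws0 (?R2, M)"
        using e by (simp add: emitted_upd)
      fix R' M'
      assume k': "keeps {1, 22, 23} ?R2 R'" and e': "emitted st M0 (ws0 @ pair_word k J (?R2 24)) (R', M')"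
      then have "keeps volatile_row R R'"
        by (simp add: keeps_def)
      with e'[unfolded R2] show "case (R', M') of (R', M') \<Rightarrow> keeps volatile_row R R' \<and>
          emitted st M0 (ws0 @ pair_word k J (R 31 * b i)) (R', M')"
        by simp
    qed (use l x in \<open>simp_all add: pair_word_def Mb\<close>)
  qed
  then show ?thesis
    by simp
qed

lemma emits_at_coefficient_pairs:
  assumes c: "constants k L J R" and R: "R 29 = int (k - i)" "R 31 \<in> {1, - 1}" and i: "i < k"
  shows "emits_at volatile_row R emit_coefficient_pairs (1 + (1 + (1 + (k * ((6 + (1 + (11 + 1))) + 2) + 1))))
    (concat (map (\<lambda>l. pair_word k J (R 31 * coefficient k L a i l)) [0..<k]))"
proof -
  have cR: "R 3 = int k" "R 4 = 1" "R 7 = 0" "R 17 = 2 * int k - 1"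
    using c by (simp_all add: constants_def Let_def)
  have k_st: "2 * int k + 1 \<le> st"
    unfolding st_eq by simp
  let ?R1 = "R(25 := R 3)"
  let ?R2 = "?R1(26 := ?R1 17)"
  let ?R = "?R2(27 := R 29 - 1)"
  let ?I = "\<lambda>l R'. R' 26 = 2 * int k - 1 - 2 * int l \<and> R' 27 = int k - int i - 1"
  have loop: "emits_at volatile_row ?R
    (WhilePos 25 (Seq emit_coefficient_pair (Arith 25 Sub 25 4))) (k * ((6 + (1 + (11 + 1))) + 2) + 1)
    (concat (map (\<lambda>l. pair_word k J (R 31 * coefficient k L a i l)) [0..<k]))"
  proof (rule emits_at_For[where I="?I"])
    fix l R' M ws0
    assume l: "l < k" and k': "keeps volatile_row ?R R'" and R25: "R' 25 = int (k - l)" and I: "?I l R'"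
      and e: "emitted st M0 ws0 (R', M)"
      and len: "length ws0 + length (pair_word k J (R 31 * coefficient k L a i l)) \<le> lim"
    have R': "R' 31 = R 31"
      using k' by (simp add: keeps_def)
    have c': "constants k L J R'"
      using constants_keeps[OF _ k'] c by (simp add: constants_upd)
    then have R6: "R' 6 = 2"
      by (simp add: constants_def Let_def)
    let ?x = "R 31 * coefficient k L a i l"
    have x: "\<bar>?x\<bar> < J"
      using abs_sign_mult[OF R(2)] abs_coefficient[OF l] by simp
    let ?P = "\<lambda>(R'', M'). keeps volatile_row R' R'' \<and> R'' 25 = R' 25 \<and> ?I (Suc l) R'' \<and>
        emitted st M0 (ws0 @ pair_word k J ?x) (R'', M')"
    show "runs A S emit_coefficient_pair (6 + (1 + (11 + 1))) ?P (R', M)"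
      unfolding emit_coefficient_pair_def
    proof (rule runs_Seq, rule runs_select_coefficient[OF c' emitted_mem[OF e], of l i])
      fix y
      let ?Ra = "R'(28 := y, 24 := coefficient k L a i l)"
      let ?Rb = "?Ra(24 := arith_op Mul (?Ra 31) (?Ra 24))"
      have b24: "?Rb 24 = ?x"
        by (simp add: R')
      show "runs A S (Seq (Arith 24 Mul 31 24) (Seq emit_pair (Arith 26 Sub 26 6))) (1 + (11 + 1)) ?P (?Ra, M)"
      proof (rule runs_Seq, rule runs_Arith)
        show "\<bar>arith_op Mul (?Ra 31) (?Ra 24)\<bar> < 2 ^ S"
          using J_bound[OF x] by (simp add: R')
        show "runs A S (Seq emit_pair (Arith 26 Sub 26 6)) (11 + 1) ?P (?Rb, M)"
        proof (rule runs_Seq, rule runs_emit_pair)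
          show "constants k L J ?Rb"
            using c' by (simp add: constants_upd)
          show "emitted st M0 ws0 (?Rb, M)"
            using e by (simp add: emitted_upd)
          fix R3 M3
          assume k3: "keeps {1, 22, 23} ?Rb R3" and e3: "emitted st M0 (ws0 @ pair_word k J (?Rb 24)) (R3, M3)"
          have R3: "R3 26 = R' 26" "R3 6 = 2" "R3 25 = R' 25" "R3 27 = R' 27"
            using k3 R6 by (simp_all add: keeps_def)
          show "runs A S (Arith 26 Sub 26 6) 1 ?P (R3, M3)"
          proof (rule runs_Arith)
            show "\<bar>arith_op Sub (R3 26) (R3 6)\<bar> < 2 ^ S"
              using R3 I l k_st lim by auto
            have "keeps volatile_row R' (R3(26 := arith_op Sub (R3 26) (R3 6)))"
              using k3 by (auto simp: keeps_def)
            then show "?P (R3(26 := arith_op Sub (R3 26) (R3 6)), M3)"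
              using e3 R3 I unfolding b24 by (simp add: emitted_upd)
          qed
        qed (use len x R' in \<open>simp_all add: pair_word_def\<close>)
      qed
    qed (use R25 I i l in simp_all)
  qed (use cR R i in \<open>auto simp: of_nat_diff\<close>)
  have "\<bar>int k - int i - 1\<bar> < 2 ^ S"
    using i k_st lim by auto
  then have "emits_at volatile_row ?R2 (Seq (Arith 27 Sub 29 4)
      (WhilePos 25 (Seq emit_coefficient_pair (Arith 25 Sub 25 4)))) (1 + (k * ((6 + (1 + (11 + 1))) + 2) + 1))
    (concat (map (\<lambda>l. pair_word k J (R 31 * coefficient k L a i l)) [0..<k]))"
    by (intro emits_at_assign[OF _ _ _ loop] runs_Arith) (use cR R i in \<open>simp_all add: of_nat_diff\<close>)
  note e2 = this
  have "emits_at volatile_row ?R1 (Seq (Arith 26 Add 17 7) (Seq (Arith 27 Sub 29 4)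
      (WhilePos 25 (Seq emit_coefficient_pair (Arith 25 Sub 25 4))))) (1 + (1 + (k * ((6 + (1 + (11 + 1))) + 2) + 1)))
    (concat (map (\<lambda>l. pair_word k J (R 31 * coefficient k L a i l)) [0..<k]))"
    by (rule emits_at_assign[OF _ _ _ e2], rule runs_move) (use cR in simp_all)
  note e1 = this
  show ?thesis
    unfolding emit_coefficient_pairs_def
    by (rule emits_at_assign[OF _ _ _ e1], rule runs_move) (use cR in simp_all)
qed

text \<open>The encoding lists two actions for every state; the disabled second action of a chain
  state is written together with the first.\<close>

lemma emits_emit_row:
  assumes c: "constants k L J R" and R: "R 29 = int (k - i)" "R 30 = 2 * int k + 1 + 2 * int i"
      "R 31 = \<sigma>" "\<sigma> \<in> {1, - 1}" and i: "i < k"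
  shows "emits volatile_row R emit_row (127 + 33 * k)
    (chain_word k (coefficient k L a) b J \<sigma> i @ disabled_word k)"
proof -
  let ?V = volatile_row
  let ?Q = "scale k J"
  have cR: "R 4 = 1" "R 7 = 0" "R 14 = ?Q * (int k * J - J + 1) - 1" "R 11 = ?Q * ?Q" "R 15 = ?Q - 1"
      "R 16 = 2 * J * ?Q" "R 5 = int (9 + 2 * k)"
    using c by (simp_all add: constants_def Let_def)
  have S: "(1 :: int) < 2 ^ S"
    using J_bound[of 1] two_J_le_Q big J1 prod_bound[of 1 2] by simp
  have pair: "emits ?V R emit_output_pair 13
    (pair_word k J (\<sigma> * b i))"
    unfolding emits_def
  proof (intro allI impI)
    fix R'
    assume k': "keeps ?V R R'"
    then have R': "R' 30 = R 30" "R' 31 = \<sigma>"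
      using R by (simp_all add: keeps_def)
    show "emits_at ?V R' emit_output_pair 13
      (pair_word k J (\<sigma> * b i))"
      using emits_at_output_pair[OF constants_keeps[OF c k'] _ _ i] R' R by simp
  qed
  have pairs: "emits ?V R emit_coefficient_pairs (1 + (1 + (1 + (k * ((6 + (1 + (11 + 1))) + 2) + 1))))
    (concat (map (\<lambda>l. pair_word k J (\<sigma> * coefficient k L a i l)) [0..<k]))"
    unfolding emits_def
  proof (intro allI impI)
    fix R'
    assume k': "keeps ?V R R'"
    then have R': "R' 29 = R 29" "R' 31 = \<sigma>"
      using R by (simp_all add: keeps_def)
    show "emits_at ?V R' emit_coefficient_pairs (1 + (1 + (1 + (k * ((6 + (1 + (11 + 1))) + 2) + 1))))
    (concat (map (\<lambda>l. pair_word k J (\<sigma> * coefficient k L a i l)) [0..<k]))"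
      using emits_at_coefficient_pairs[OF constants_keeps[OF c k'] _ _ i] R' R by simp
  qed
  have "set (concat (replicate 6 [0, 1])) = {0, 1 :: int}"
    by simp
  then have head: "emits ?V R (emit_consts (concat (replicate 6 [0, 1]))) (3 * length (concat (replicate 6 [0, 1 :: int])) + 1)
      (concat (replicate 6 [0, 1]))"
    using cR S by (intro emits_emit_consts) auto
  have zeros: "emits ?V R (emit_consts [0, 0]) (3 * length [0, 0 :: int] + 1) [0, 0]"
    using cR S by (intro emits_emit_consts) auto
  have emit: "emits ?V R (emit 14) 2 [?Q * (int k * J - J + 1) - 1]" "emits ?V R (emit 11) 2 [?Q * ?Q]"
      "emits ?V R (emit 15) 2 [?Q - 1]" "emits ?V R (emit 16) 2 [2 * J * ?Q]"
    using cR by (intro emits_emit; simp)+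
  have tail: "emits ?V R (emit_zeros 5) (6 * (9 + 2 * k) + 2) (concat (replicate (9 + 2 * k) [0, 1]))"
    using cR by (intro emits_emit_zeros) simp_all
  note row = emits_Seq[OF head emits_Seq[OF emit(1) emits_Seq[OF emit(2)
    emits_Seq[OF emit(3) emits_Seq[OF emit(4) emits_Seq[OF pair emits_Seq[OF pairs
    emits_Seq[OF zeros tail]]]]]]]]
  show ?thesis
    unfolding emit_row_def
    by (rule emits_weaken[OF row]) (simp_all add: chain_word_def disabled_word_def length_concat sum_list_replicate)
qed

end

section \<open>Words for the special states and the complete output\<close>

definition special_prefix :: "nat \<times> nat \<times> nat list \<Rightarrow> int list" where
  "special_prefix = (\<lambda>(g, f, ts). int g # int f #
    concat (map (\<lambda>t. if t \<in> set ts then [1, int (length ts)] else [0, 1]) [0..<10]))"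

text \<open>Special states lead only to states up to 9, so the first 22 numbers of a row are the
  same for all \<open>k\<close> and become constants of the program; only the number of trailing
  zeros depends on the input.\<close>

definition special_word :: "nat \<Rightarrow> nat \<times> nat \<times> nat list \<Rightarrow> int list" where
  "special_word k r = special_prefix r @ concat (replicate (2 * k - 1) [0, 1])"

definition chain_rows_word :: "nat \<Rightarrow> (nat \<Rightarrow> nat \<Rightarrow> int) \<Rightarrow> (nat \<Rightarrow> int) \<Rightarrow> int \<Rightarrow> nat \<Rightarrow> int list" where
  "chain_rows_word k X B J i =
    (chain_word k X B J 1 i @ disabled_word k) @ (chain_word k X B J (- 1) i @ disabled_word k)"

text \<open>The header consists of the threshold 15 / 4, the number of states, the number of
  actions, and the initial, goal and fail state.\<close>

definition reduction_word :: "nat \<Rightarrow> (nat \<Rightarrow> nat \<Rightarrow> int) \<Rightarrow> (nat \<Rightarrow> int) \<Rightarrow> int \<Rightarrow> int list" where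
  "reduction_word k X B J = [15, 4] @ [int (9 + 2 * k)] @ [2, 2, 0, 1] @
    concat (map (special_word k) special_rows) @ concat (map (chain_rows_word k X B J) [0..<k])"

abbreviation "volatile_all \<equiv> {1, 20, 21, 22, 23, 24, 25, 26, 27, 28, 29, 30, 31}"

lemma length_special_prefix: "length (special_prefix r) = 22"
proof -
  have "length (concat (map (\<lambda>t. if t \<in> set ts then [1, int (length ts)] else [0, 1]) xs)) = 2 * length xs" for ts xs
    by (induction xs) auto
  from this[of _ "[0..<10]"] show ?thesis
    by (simp add: special_prefix_def split: prod.split)
qed

primrec emit_special :: "(nat \<times> nat \<times> nat list) list \<Rightarrow> program" where
  "emit_special [] = Skip"
| "emit_special (r # rs) = Seq (Seq (emit_consts (special_prefix r)) (emit_zeros 17)) (emit_special rs)"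

definition emit_chain :: program where
  "emit_chain = Seq (Arith 29 Add 3 7) (Seq (Arith 30 Add 17 6)
    (WhilePos 29 (Seq
      (Seq (Const 31 1) (Seq emit_row (Seq (Const 31 (- 1)) (Seq emit_row (Arith 30 Add 30 6)))))
      (Arith 29 Sub 29 4))))"

definition emit_all :: program where
  "emit_all = Seq (emit_consts [15, 4]) (Seq (emit 5) (Seq (emit_consts [2, 2, 0, 1])
    (Seq (emit_special special_rows) emit_chain)))"

context emitter
begin

lemma emits_emit_special:
  assumes R: "R 4 = 1" "R 7 = 0" "R 17 = int m" and V: "1 \<in> V" "20 \<in> V" "21 \<in> V" "4 \<notin> V" "7 \<notin> V" "17 \<notin> V"
    and rs: "\<And>r c. r \<in> set rs \<Longrightarrow> c \<in> set (special_prefix r) \<Longrightarrow> \<bar>c\<bar> < 2 ^ S"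
  shows "emits V R (emit_special rs) (length rs * (69 + 6 * m) + 1)
    (concat (map (\<lambda>r. special_prefix r @ concat (replicate m [0, 1])) rs))"
  using rs
proof (induction rs)
  case Nil
  show ?case
    using emits_Skip by simp
next
  case (Cons r rs)
  have 1: "emits V R (emit_consts (special_prefix r)) (3 * length (special_prefix r) + 1) (special_prefix r)"
    by (rule emits_emit_consts) (use R V Cons.prems[of r] in simp_all)
  have 2: "emits V R (emit_zeros 17) (6 * m + 2) (concat (replicate m [0, 1]))"
    using R V by (intro emits_emit_zeros) auto
  have 3: "emits V R (emit_special rs) (length rs * (69 + 6 * m) + 1)
    (concat (map (\<lambda>r. special_prefix r @ concat (replicate m [0, 1])) rs))"
    by (rule Cons.IH, rule Cons.prems) simp_all
  show ?case
    unfolding emit_special.simps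
    by (rule emits_weaken[OF emits_Seq[OF emits_Seq[OF 1 2] 3]]) (simp_all add: length_special_prefix)
qed

end

context row_emitter
begin

abbreviation "X \<equiv> coefficient k L a"

lemma emits_at_emit_chain:
  assumes c: "constants k L J R"
  shows "emits_at volatile_all R emit_chain
    (1 + (1 + (k * ((1 + ((127 + 33 * k) + (1 + ((127 + 33 * k) + 1)))) + 2) + 1)))
    (concat (map (chain_rows_word k X b J) [0..<k]))"
proof -
  have cR: "R 3 = int k" "R 4 = 1" "R 6 = 2" "R 7 = 0" "R 17 = 2 * int k - 1"
    using c by (simp_all add: constants_def Let_def)
  have k_st: "4 * int k + 1 \<le> st"
    unfolding st_eq by simp
  have S: "(1 :: int) < 2 ^ S"
    using J_bound[of 1] two_J_le_Q big J1 prod_bound[of 1 2] by simp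
  let ?n = "127 + 33 * k"
  let ?R1 = "R(29 := R 3)"
  let ?R = "?R1(30 := 1 + 2 * int k)"
  let ?I = "\<lambda>i R'. R' 30 = 2 * int k + 1 + 2 * int i"
  let ?body = "Seq (Const 31 1) (Seq emit_row (Seq (Const 31 (- 1)) (Seq emit_row (Arith 30 Add 30 6))))"
  have loop: "emits_at volatile_all ?R (WhilePos 29 (Seq ?body (Arith 29 Sub 29 4)))
    (k * ((1 + (?n + (1 + (?n + 1)))) + 2) + 1) (concat (map (chain_rows_word k X b J) [0..<k]))"
  proof (rule emits_at_For[where I="?I"])
    fix i R' M ws0
    assume i: "i < k" and k': "keeps volatile_all ?R R'" and R29: "R' 29 = int (k - i)" and I: "?I i R'"
      and e: "emitted st M0 ws0 (R', M)"
      and len: "length ws0 + length (chain_rows_word k X b J i) \<le> lim"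
    have c': "constants k L J R'"
      using k' c by (simp add: constants_def keeps_def Let_def)
    let ?W = "\<lambda>\<sigma>. chain_word k X b J \<sigma> i @ disabled_word k"
    let ?P = "\<lambda>(R'', M'). keeps volatile_all R' R'' \<and> R'' 29 = R' 29 \<and> ?I (Suc i) R'' \<and>
        emitted st M0 (ws0 @ chain_rows_word k X b J i) (R'', M')"
    show "runs A S ?body (1 + (?n + (1 + (?n + 1)))) ?P (R', M)"
    proof (rule runs_Seq, rule runs_Const, use S in simp, rule runs_Seq)
      let ?Ra = "R'(31 := 1)"
      have em: "emits_at volatile_row ?Ra emit_row ?n (?W 1)"
        using c' R29 I i by (intro emits_imp_at emits_emit_row) (simp_all add: constants_upd)
      show "runs A S emit_row ?n (runs A S (Seq (Const 31 (- 1)) (Seq emit_row (Arith 30 Add 30 6))) (1 + (?n + 1)) ?P) (?Ra, M)"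
      proof (rule emits_atD[OF em])
        show "emitted st M0 ws0 (?Ra, M)"
          using e by (simp add: emitted_upd)
        fix R2 M2
        assume k2: "keeps volatile_row ?Ra R2" and e2: "emitted st M0 (ws0 @ ?W 1) (R2, M2)"
        have R2: "R2 29 = int (k - i)" "?I i R2"
          using k2 R29 I by (simp_all add: keeps_def)
        have c2: "constants k L J R2"
          using constants_keeps[OF _ k2] c' by (simp add: constants_upd)
        let ?Rb = "R2(31 := - 1)"
        have em: "emits_at volatile_row ?Rb emit_row ?n (?W (- 1))"
          using c2 R2 i by (intro emits_imp_at emits_emit_row) (simp_all add: constants_upd)
        show "runs A S (Seq (Const 31 (- 1)) (Seq emit_row (Arith 30 Add 30 6))) (1 + (?n + 1)) ?P (R2, M2)"
        proof (rule runs_Seq, rule runs_Const, use S in simp, rule runs_Seq, rule emits_atD[OF em])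
          show "emitted st M0 (ws0 @ ?W 1) (?Rb, M2)"
            using e2 by (simp add: emitted_upd)
          fix R3 M3
          assume k3: "keeps volatile_row ?Rb R3" and e3: "emitted st M0 ((ws0 @ ?W 1) @ ?W (- 1)) (R3, M3)"
          have R3: "R3 29 = R' 29" "R3 30 = R' 30" "R3 6 = 2"
            using k3 k2 k' cR by (simp_all add: keeps_def)
          show "runs A S (Arith 30 Add 30 6) 1 ?P (R3, M3)"
          proof (rule runs_Arith)
            show "\<bar>arith_op Add (R3 30) (R3 6)\<bar> < 2 ^ S"
              using R3 I i k_st lim by auto
            have "keeps volatile_all R' (R3(30 := arith_op Add (R3 30) (R3 6)))"
              using k3 k2 by (auto simp: keeps_def)
            then show "?P (R3(30 := arith_op Add (R3 30) (R3 6)), M3)"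
              using e3 R3 I by (simp add: emitted_upd chain_rows_word_def)
          qed
        qed (use len in \<open>simp_all add: chain_rows_word_def\<close>)
      qed (use len in \<open>simp_all add: chain_rows_word_def\<close>)
    qed
  qed (use cR in auto)
  have "\<bar>1 + 2 * int k\<bar> < 2 ^ S"
    using k_st lim by auto
  then have 2: "emits_at volatile_all ?R1 (Seq (Arith 30 Add 17 6) (WhilePos 29 (Seq ?body (Arith 29 Sub 29 4))))
    (1 + (k * ((1 + (?n + (1 + (?n + 1)))) + 2) + 1)) (concat (map (chain_rows_word k X b J) [0..<k]))"
    by (intro emits_at_assign[OF _ _ _ loop] runs_Arith) (use cR in simp_all)
  show ?thesis
    unfolding emit_chain_def
    by (rule emits_at_assign[OF _ _ _ 2], rule runs_move) (use cR in simp_all)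
qed

lemma emits_at_emit_all:
  assumes c: "constants k L J R" and S: "16 < (2 :: int) ^ S"
  shows "emits_at volatile_all R emit_all (1600 + 1000 * k + 100 * k * k) (reduction_word k X b J)"
proof -
  let ?V = volatile_all
  have k': "2 * int k - 1 = int (2 * k - 1)"
    using k by linarith
  have cR: "R 4 = 1" "R 7 = 0" "R 5 = int (9 + 2 * k)" "R 17 = int (2 * k - 1)"
    using c unfolding k'[symmetric] by (simp_all add: constants_def Let_def)
  have 1: "emits ?V R (emit_consts [15, 4]) (3 * length [15, 4 :: int] + 1) [15, 4]"
    using cR S by (intro emits_emit_consts) auto
  have 2: "emits ?V R (emit 5) 2 [int (9 + 2 * k)]"
    using cR by (intro emits_emit) simp_all
  have 3: "emits ?V R (emit_consts [2, 2, 0, 1]) (3 * length [2, 2, 0, 1 :: int] + 1) [2, 2, 0, 1]"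
    using cR S by (intro emits_emit_consts) auto
  have prefix: "c \<in> {0, 1, 2}" if "r \<in> set special_rows" "c \<in> set (special_prefix r)" for r c
    using that by (auto simp: special_rows_def special_prefix_def split: if_splits)
  have 4: "emits ?V R (emit_special special_rows) (length special_rows * (69 + 6 * (2 * k - 1)) + 1)
      (concat (map (special_word k) special_rows))"
    unfolding special_word_def[abs_def]
  proof (rule emits_emit_special)
    fix r c
    assume "r \<in> set special_rows" "c \<in> set (special_prefix r)"
    from prefix[OF this] S show "\<bar>c\<bar> < 2 ^ S"
      by auto
  qed (use cR in simp_all)
  have 5: "emits ?V R emit_chain
    (1 + (1 + (k * ((1 + ((127 + 33 * k) + (1 + ((127 + 33 * k) + 1)))) + 2) + 1)))
    (concat (map (chain_rows_word k X b J) [0..<k]))"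
    unfolding emits_def
  proof (intro allI impI emits_at_emit_chain)
    fix R'
    assume "keeps ?V R R'"
    with c show "constants k L J R'"
      by (simp add: constants_def keeps_def Let_def)
  qed
  have "length special_rows = 18"
    by (simp add: special_rows_def)
  with emits_imp_at[OF emits_weaken[OF emits_Seq[OF 1 emits_Seq[OF 2 emits_Seq[OF 3 emits_Seq[OF 4 5]]]]]]
  show ?thesis
    unfolding emit_all_def reduction_word_def by (simp add: algebra_simps)
qed

end

section \<open>Correctness of the encoding\<close>

text \<open>\<open>rat_word\<close> reads off the normal form, so numerator and denominator appear
  literally only for a reduced fraction with positive denominator. The coprimality facts below serve
  this.\<close>

lemma rat_word_divide:
  assumes "0 < b" "coprime a b"
  shows "rat_word (of_int a / of_int b) = [a, b]"
proof -
  have "quotient_of (of_int a / of_int b) = (a, b)"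
    using assms by (simp add: quotient_of_Fract normalize_stable flip: Fract_of_int_quotient)
  then show ?thesis
    by (simp add: rat_word_def)
qed

lemma rat_word_0: "rat_word 0 = [0, 1]"
  and rat_word_1: "rat_word 1 = [1, 1]"
  and rat_word_half: "rat_word (1 / 2) = [1, 2]"
  using rat_word_divide[of 1 0] rat_word_divide[of 1 1] rat_word_divide[of 2 1] by simp_all

lemma coprime_mult_add_1: "coprime (q * m + 1) (q :: int)" and coprime_mult_diff_1: "coprime (q * m - 1) (q :: int)"
proof -
  show "coprime (q * m + 1) q"
    by (rule coprimeI) (metis dvd_add_right_iff dvd_mult2)
  show "coprime (q * m - 1) q"
    by (rule coprimeI) (metis dvd_diff_right_iff dvd_mult2)
qed

text \<open>Chain states are numbered in sign pairs, so rows and columns of the encoding are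
  regrouped two at a time.\<close>

lemma concat_map_upt_pairs:
  "concat (map f [m..<m + 2 * n]) = concat (map (\<lambda>l. f (m + 2 * l) @ f (Suc m + 2 * l)) [0..<n])"
proof (induction n)
  case (Suc n)
  have "[m..<m + 2 * Suc n] = [m..<m + 2 * n] @ [m + 2 * n, Suc m + 2 * n]"
    by simp
  then show ?case
    by (simp add: Suc)
qed simp

lemma map_const: "(\<And>x. x \<in> set xs \<Longrightarrow> f x = c) \<Longrightarrow> map f xs = replicate (length xs) c"
  by (induction xs) auto

context reduction
begin

lemma coprime_tilt: "coprime (tilt k J x) (2 * Q * Q)"
proof -
  have "tilt k J x = Q * (J - 1 + x) + 1"
    by (simp add: tilt_def distrib_left)
  then have 1: "coprime (tilt k J x) Q"
    using coprime_mult_add_1 by metis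
  then have "coprime (tilt k J x) 2"
    by (simp add: scale_def)
  with 1 show ?thesis
    by simp
qed

lemma row_word_special:
  assumes "s < 9" "a < 2"
  shows "row_word mdp s a = special_word k (special_rows ! (2 * s + a))"
proof -
  obtain g f ts where row: "special_rows ! (2 * s + a) = (g, f, ts)"
    by (metis prod_cases3)
  have "(g, f, ts) \<in> set special_rows"
    using assms nth_mem[of "2 * s + a" special_rows] row by (simp add: special_rows_def)
  then have ts: "set ts \<subseteq> {..<10}" "ts \<noteq> [] \<Longrightarrow> length ts = 1 \<or> length ts = 2"
    by (auto simp: special_rows_def)
  let ?w = "\<lambda>t. rat_word (prob mdp s a t)"
  have w: "?w t = (if t \<in> set ts then [1, int (length ts)] else [0, 1])" if "t < 9 + 2 * k" for t
  proof -
    have "prob mdp s a t = (if t \<in> set ts then 1 / of_nat (length ts) else 0)"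
      using assms that row by (simp add: reduction_mdp_def)
    then show ?thesis
      using ts(2) by (cases "ts = []") (auto simp: rat_word_0 rat_word_1 rat_word_half)
  qed
  have "[0..<9 + 2 * k] = [0..<10] @ [10..<9 + 2 * k]"
    using k upt_add_eq_append[of 0 10 "2 * k - 1"] by simp
  then have "concat (map ?w [0..<9 + 2 * k]) = concat (map ?w [0..<10]) @ concat (map ?w [10..<9 + 2 * k])"
    by simp
  also have "map ?w [0..<10] = map (\<lambda>t. if t \<in> set ts then [1, int (length ts)] else [0, 1]) [0..<10]"
    using k w by (intro map_cong) auto
  also have "map ?w [10..<9 + 2 * k] = replicate (length [10..<9 + 2 * k]) [0, 1]"
    by (rule map_const) (use w ts(1) in auto)
  finally show ?thesis
    using assms row by (simp add: row_word_def special_word_def special_prefix_def reduction_mdp_def)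
qed

lemma row_word_disabled: "9 \<le> s \<Longrightarrow> row_word mdp s 1 = disabled_word k"
proof -
  assume s: "9 \<le> s"
  have "map (\<lambda>t. rat_word (prob mdp s 1 t)) [0..<9 + 2 * k] = replicate (length [0..<9 + 2 * k]) [0, 1]"
    by (rule map_const) (use s in \<open>auto simp: reduction_mdp_def rat_word_0\<close>)
  moreover have "wgt_goal mdp s 1 = 0" "wgt_fail mdp s 1 = 0"
    using s by (auto simp: reduction_mdp_def)
  ultimately show ?thesis
    by (simp add: row_word_def disabled_word_def)
qed

lemma row_word_chain:
  assumes s: "9 \<le> s" "s < 9 + 2 * k"
  shows "row_word mdp s 0 = chain_word k X B J (chain_sign s) (chain_index s)"
proof -
  let ?w = "\<lambda>t. rat_word (prob mdp s 0 t)" and ?\<sigma> = "chain_sign s" and ?i = "chain_index s"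
  have p: "prob mdp s 0 t = chain_prob k X B J s t" if "t < 9 + 2 * k" for t
    using s that by (simp add: reduction_mdp_def)
  have Q': "0 < Q * Q" "0 < 2 * Q * Q" "0 < 2 * J * Q"
    using Q J by auto
  have tilt: "rat_word (of_int (tilt k J x) / of_int (2 * Q * Q)) = [tilt k J x, 2 * Q * Q]" for x
    using Q' by (intro rat_word_divide coprime_tilt) simp
  have "coprime (Q * (int k * J - J + 1) - 1) (Q * Q)"
    using coprime_mult_diff_1 by simp
  then have w5: "?w 5 = [Q * (int k * J - J + 1) - 1, Q * Q]"
    using k Q' by (simp only: p) (simp add: chain_prob_def Let_def rat_word_divide del: of_int_mult of_int_diff)
  have "coprime (Q - 1) Q"
    using coprime_mult_diff_1[of Q 1] by simp
  \<comment> \<open>\<open>Q\<close> is a multiple of \<open>2 * J\<close>, so \<open>Q - 1\<close>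
    is -1 modulo \<open>2 * J\<close>.\<close>
  moreover have "coprime (Q - 1) (2 * J)"
    using coprime_mult_diff_1[of "2 * J" "int k"] by (simp add: scale_def mult_ac)
  ultimately have "coprime (Q - 1) (2 * J * Q)"
    by (simp only: coprime_mult_right_iff)
  then have w6: "?w 6 = [Q - 1, 2 * J * Q]"
    using k Q' by (simp only: p) (simp add: chain_prob_def Let_def rat_word_divide del: of_int_mult of_int_diff)
  have w7: "?w 7 @ ?w 8 = pair_word k J (?\<sigma> * B ?i)"
    using k by (simp only: p) (simp add: chain_prob_def Let_def tilt pair_word_def del: of_int_mult)
  have wl: "?w (9 + 2 * l) @ ?w (Suc 9 + 2 * l) = pair_word k J (?\<sigma> * X ?i l)" if "l < k" for l
  proof -
    have "?w (9 + 2 * l) = [tilt k J (?\<sigma> * X ?i l), 2 * Q * Q]"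
      using that by (subst p) (simp_all add: chain_prob_def Let_def tilt chain_sign_def[of "9 + 2 * l"] chain_index_def[of "9 + 2 * l"] del: of_int_mult)
    moreover have "?w (Suc 9 + 2 * l) = [tilt k J (- (?\<sigma> * X ?i l)), 2 * Q * Q]"
      using that by (subst p) (simp_all add: chain_prob_def Let_def tilt chain_sign_def[of "10 + 2 * l"] chain_index_def[of "10 + 2 * l"] del: of_int_mult)
    ultimately show ?thesis
      by (simp add: pair_word_def)
  qed
  have "[0..<9 + 2 * k] = [0..<5] @ [5, 6, 7, 8] @ [9..<9 + 2 * k]"
    using upt_add_eq_append[of 0 9 "2 * k"] by (simp add: upt_rec)
  then have "concat (map ?w [0..<9 + 2 * k]) = concat (map ?w [0..<5]) @ ?w 5 @ ?w 6 @ (?w 7 @ ?w 8) @ concat (map ?w [9..<9 + 2 * k])"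
    by simp
  also have "map ?w [0..<5] = replicate (length [0..<5]) [0, 1]"
    by (rule map_const) (use k in \<open>auto simp: p chain_prob_def Let_def rat_word_0\<close>)
  also have "concat (map ?w [9..<9 + 2 * k]) = concat (map (\<lambda>l. pair_word k J (?\<sigma> * X ?i l)) [0..<k])"
    unfolding concat_map_upt_pairs by (intro arg_cong[where f=concat] map_cong) (use wl in auto)
  finally have "concat (map ?w [0..<9 + 2 * k]) = concat (replicate 5 [0, 1]) @
      [Q * (int k * J - J + 1) - 1, Q * Q] @ [Q - 1, 2 * J * Q] @ pair_word k J (?\<sigma> * B ?i) @
      concat (map (\<lambda>l. pair_word k J (?\<sigma> * X ?i l)) [0..<k])"
    unfolding w5 w6 w7 by simp
  moreover have "concat (replicate 6 [0, 1]) = [0, 1 :: int] @ concat (replicate 5 [0, 1])"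
    by (simp add: eval_nat_numeral)
  ultimately show ?thesis
    using s by (simp add: row_word_def chain_word_def reduction_mdp_def)
qed

lemma threshold_word_mdp: "threshold_word (mdp, 15 / 4) = reduction_word k X B J"
proof -
  let ?r = "\<lambda>s. concat (map (row_word mdp s) [0..<2])"
  have r: "?r s = row_word mdp s 0 @ row_word mdp s 1" for s
    by (simp add: upt_rec)
  have "map ?r [0..<9] = map (\<lambda>s. special_word k (special_rows ! (2 * s)) @ special_word k (special_rows ! (2 * s + 1))) [0..<9]"
    by (intro map_cong) (simp_all add: r row_word_special)
  also have "concat \<dots> = concat (map (special_word k) special_rows)"
    by (simp add: special_rows_def upt_rec)
  finally have special: "concat (map ?r [0..<9]) = concat (map (special_word k) special_rows)" .
  have chain: "?r (9 + 2 * i) @ ?r (Suc 9 + 2 * i) = chain_rows_word k X B J i" if "i < k" for i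
    using that by (simp add: r row_word_chain row_word_disabled[unfolded One_nat_def] chain_rows_word_def
        chain_sign_def chain_index_def)
  have "[0..<9 + 2 * k] = [0..<9] @ [9..<9 + 2 * k]"
    using upt_add_eq_append[of 0 9 "2 * k"] by simp
  then have "concat (map ?r [0..<9 + 2 * k]) = concat (map ?r [0..<9]) @ concat (map ?r [9..<9 + 2 * k])"
    by simp
  also have "concat (map ?r [9..<9 + 2 * k]) = concat (map (chain_rows_word k X B J) [0..<k])"
    unfolding concat_map_upt_pairs by (intro arg_cong[where f=concat] map_cong) (use chain in auto)
  finally have "concat (map ?r [0..<9 + 2 * k]) =
      concat (map (special_word k) special_rows) @ concat (map (chain_rows_word k X B J) [0..<k])"
    by (simp only: special)
  moreover have "rat_word (15 / 4) = [15, 4]"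
    using rat_word_divide[of 4 15] coprime_mult_diff_1[of 4 4] by simp
  ultimately show ?thesis
    by (simp add: threshold_word_def reduction_word_def del: upt_Suc upt_rec)
qed

text \<open>Applied to the vector of the terms from \<open>u n\<close> to
  \<open>u (n + k - 1)\<close>, the matrix \<open>X\<close> shifts by one term and multiplies by
  \<open>L\<close>. The initial values enter once, as \<open>- B / (4 * Q)\<close>, so each further
  step contributes one more factor \<open>L / Q\<close>.\<close>

lemma bias_Suc_eq:
  fixes u :: "nat \<Rightarrow> rat"
  assumes u: "linear_recurrence \<alpha> \<beta> u" and len: "length \<alpha> = k" "length \<beta> = k"
    and X: "X = coefficient k L a"
    and a: "\<And>l. l < k \<Longrightarrow> of_int (a l) = of_int L * \<alpha> ! (k - 1 - l)"
    and B: "\<And>i. i < k \<Longrightarrow> of_int (B i) = of_int L * \<beta> ! i"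
    and i: "i < k"
  shows "bias (Suc n) i = - (1 / 4) * (real_of_int L / Q) ^ Suc n * real_of_rat (u (n + i))"
  using i
proof (induction n arbitrary: i)
  case 0
  have "real_of_rat (of_int (B i)) = real_of_rat (of_int L * u i)"
    using u B[OF 0] 0 len by (simp add: linear_recurrence_def)
  then have "real_of_int (B i) = real_of_int L * real_of_rat (u i)"
    by (simp add: of_rat_mult)
  then show ?case
    by simp
next
  case (Suc n)
  let ?c = "- (1 / 4) * (real_of_int L / Q) ^ Suc n"
  have "(\<Sum>l<k. real_of_int (X i l) * bias (Suc n) l) = (\<Sum>l<k. real_of_int (X i l) * (?c * real_of_rat (u (n + l))))"
    using Suc.IH by (intro sum.cong) (simp_all del: bias.simps)
  also have "\<dots> = ?c * real_of_rat (\<Sum>l<k. of_int (X i l) * u (n + l))"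
    unfolding of_rat_sum sum_distrib_left by (intro sum.cong) (simp_all add: of_rat_mult mult_ac)
  also have "(\<Sum>l<k. of_int (X i l) * u (n + l)) = of_int L * u (Suc n + i)"
  proof (cases "Suc i = k")
    case True
    have "(\<Sum>l<k. of_int (X i l) * u (n + l)) = of_int L * (\<Sum>l<k. \<alpha> ! (k - 1 - l) * u (n + l))"
      using True a by (simp add: X coefficient_def sum_distrib_left mult.assoc)
    \<comment> \<open>The substitution \<open>j = k - l\<close> turns the order of the matrix row
      into the order of the recurrence.\<close>
    also have "(\<Sum>l<k. \<alpha> ! (k - 1 - l) * u (n + l)) = (\<Sum>j = 1..k. \<alpha> ! (j - 1) * u (n + k - j))"
      by (rule sum.reindex_bij_witness[of _ "\<lambda>j. k - j" "\<lambda>l. k - l"]) auto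
    also have "\<dots> = u (n + k)"
      using u len by (simp add: linear_recurrence_def)
    also have "n + k = Suc n + i"
      using True by simp
    finally show ?thesis .
  next
    case False
    then have "(\<Sum>l<k. of_int (X i l) * u (n + l)) = (\<Sum>l<k. if l = Suc i then of_int L * u (n + l) else 0)"
      by (intro sum.cong) (auto simp: X coefficient_def)
    then show ?thesis
      using False Suc.prems by simp
  qed
  finally have "bias (Suc (Suc n)) i = ?c * (real_of_int L * real_of_rat (u (Suc n + i))) / Q"
    by (simp del: bias.simps add: bias.simps(2)[of "Suc n"] of_rat_mult)
  then show ?case
    by (simp del: bias.simps add: mult_ac)
qed

end

text \<open>\<open>positive\<close> asks for the existence of a solution, so one has to be
  exhibited. The guard on \<open>i\<close> makes the recursion visibly decreasing; all summands
  satisfy it as soon as \<open>n\<close> is at least the length of \<open>\<alpha>\<close>.\<close>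

function recurrence_solution :: "rat list \<Rightarrow> rat list \<Rightarrow> nat \<Rightarrow> rat" where
  "recurrence_solution \<alpha> \<beta> n =
    (if n < length \<beta> then \<beta> ! n
     else \<Sum>i = 1..length \<alpha>. \<alpha> ! (i - 1) * (if 0 < i \<and> i \<le> n then recurrence_solution \<alpha> \<beta> (n - i) else 0))"
  by auto
termination
  by (relation "Wellfounded.measure (\<lambda>(\<alpha>, \<beta>, n). n)") auto

declare recurrence_solution.simps [simp del]

lemma linear_recurrence_solution:
  assumes "length \<alpha> = length \<beta>"
  shows "linear_recurrence \<alpha> \<beta> (recurrence_solution \<alpha> \<beta>)"
  unfolding linear_recurrence_def
proof (intro conjI allI impI)
  show "recurrence_solution \<alpha> \<beta> j = \<beta> ! j" if "j < length \<beta>" for j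
    using that by (simp add: recurrence_solution.simps)
  show "recurrence_solution \<alpha> \<beta> (n + length \<alpha>) =
      (\<Sum>i = 1..length \<alpha>. \<alpha> ! (i - 1) * recurrence_solution \<alpha> \<beta> (n + length \<alpha> - i))" for n
    using assms by (subst recurrence_solution.simps) (auto intro!: sum.cong)
qed

lemma linear_recurrence_unique:
  assumes "linear_recurrence \<alpha> \<beta> u" "linear_recurrence \<alpha> \<beta> v" "length \<alpha> = length \<beta>"
  shows "u = v"
proof
  fix n
  show "u n = v n"
  proof (induction n rule: less_induct)
    case (less n)
    show ?case
    proof (cases "n < length \<beta>")
      case False
      then obtain m where n: "n = m + length \<alpha>"
        using assms(3) by (metis add.commute le_add_diff_inverse not_le)
      have "(\<Sum>i = 1..length \<alpha>. \<alpha> ! (i - 1) * u (m + length \<alpha> - i)) =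
          (\<Sum>i = 1..length \<alpha>. \<alpha> ! (i - 1) * v (m + length \<alpha> - i))"
        using less n by (intro sum.cong) auto
      then show ?thesis
        using assms(1,2) n by (simp add: linear_recurrence_def)
    qed (use assms(1,2) in \<open>simp add: linear_recurrence_def\<close>)
  qed
qed

text \<open>By uniqueness the existential quantifier in \<open>positive\<close> speaks about one
  sequence, and its term \<open>n\<close> is negative iff \<open>bias (Suc n) 0\<close> is positive,
  since \<open>L / Q > 0\<close>.\<close>

lemma (in reduction) positive_iff:
  assumes len: "length \<alpha> = k" "length \<beta> = k"
    and X: "X = coefficient k L a" and L: "0 < L"
    and a: "\<And>l. l < k \<Longrightarrow> of_int (a l) = of_int L * \<alpha> ! (k - 1 - l)"
    and B: "\<And>i. i < k \<Longrightarrow> of_int (B i) = of_int L * \<beta> ! i"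
  shows "positive (\<alpha>, \<beta>) \<longleftrightarrow> \<not> exceeds_threshold (mdp, 15 / 4)"
proof -
  let ?u = "recurrence_solution \<alpha> \<beta>"
  have u: "linear_recurrence \<alpha> \<beta> ?u"
    using len by (intro linear_recurrence_solution) simp
  have "positive (\<alpha>, \<beta>) \<longleftrightarrow> (\<forall>n. 0 \<le> ?u n)"
  proof
    assume "positive (\<alpha>, \<beta>)"
    then obtain v where v: "linear_recurrence \<alpha> \<beta> v" "\<forall>n. 0 \<le> v n"
      by (auto simp: positive_def)
    then have "v = ?u"
      using linear_recurrence_unique[OF v(1) u] len by simp
    with v(2) show "\<forall>n. 0 \<le> ?u n"
      by blast
  next
    assume "\<forall>n. 0 \<le> ?u n"
    with u show "positive (\<alpha>, \<beta>)"
      unfolding positive_def by blast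
  qed
  moreover have "0 < bias (Suc n) 0 \<longleftrightarrow> ?u n < 0" for n
  proof -
    define p where "p = (real_of_int L / Q) ^ Suc n"
    have "0 < p"
      unfolding p_def using L Q by (intro zero_less_power divide_pos_pos) auto
    moreover have "bias (Suc n) 0 = - (1 / 4) * (real_of_int L / Q) ^ Suc n * real_of_rat (?u (n + 0))"
      using u len X a B by (rule bias_Suc_eq) (use k in simp_all)
    then have "bias (Suc n) 0 = - (1 / 4) * p * real_of_rat (?u n)"
      by (simp only: p_def add_0_right)
    ultimately show ?thesis
      by (simp add: mult_less_0_iff del: bias.simps)
  qed
  moreover have "(\<exists>n. 0 < bias n 0) \<longleftrightarrow> (\<exists>n. 0 < bias (Suc n) 0)"
    by (metis bias.simps(1) less_irrefl not0_implies_Suc)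
  ultimately show ?thesis
    unfolding exceeds_threshold_iff by (simp add: not_less del: bias.simps)
qed

section \<open>Clearing denominators\<close>

lemma runs_Arith_eq:
  assumes "arith_op f (R a) (R b) = v" "\<bar>v\<bar> < 2 ^ S" "Q (R(r := v), M)"
  shows "runs A S (Arith r f a b) 1 Q (R, M)"
  using assms by (intro runs_Arith) simp_all

text \<open>Squares stand in for absolute values: a sum of squares bounds every entry and is
  computed without comparisons.\<close>

lemma abs_le_square: "\<bar>x\<bar> \<le> x * (x :: int)"
proof (cases "x = 0")
  case False
  then have "1 * \<bar>x\<bar> \<le> \<bar>x\<bar> * \<bar>x\<bar>"
    by (intro mult_right_mono) auto
  then show ?thesis
    by (simp add: abs_mult_self_eq)
qed simp

definition initialize :: program where
  "initialize = Seq (Const 4 1) (Seq (Const 6 2) (Seq (Arith 2 Add 0 7) (Seq (Arith 1 Add 0 7) (Load 3 7))))"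

definition multiply_denominators :: program where
  "multiply_denominators = Seq (Arith 20 Add 3 3) (Seq (Arith 21 Add 6 7) (Seq (Arith 8 Add 4 7)
    (WhilePos 20 (Seq (Load 22 21) (Seq (Arith 8 Mul 8 22) (Seq (Arith 21 Add 21 6) (Arith 20 Sub 20 4)))))))"

text \<open>Each numerator is overwritten in place by its integer multiple; the division is exact
  because every denominator divides \<open>L\<close>. Register 9 accumulates
  \<open>J\<close>.\<close>

definition clear_denominators :: program where
  "clear_denominators = Seq (Arith 9 Mul 8 8) (Seq (Arith 9 Add 9 4) (Seq (Arith 20 Add 3 3) (Seq (Arith 21 Add 4 7)
    (WhilePos 20
      (Seq (Load 22 21) (Seq (Arith 22 Mul 22 8) (Seq (Arith 23 Add 21 4) (Seq (Load 24 23)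
      (Seq (Arith 22 Div 22 24) (Seq (Store 21 22) (Seq (Arith 22 Mul 22 22) (Seq (Arith 9 Add 9 22)
      (Seq (Arith 21 Add 21 6) (Arith 20 Sub 20 4))))))))))))))"

definition compute_constants :: program where
  "compute_constants =
    Seq (Arith 14 Mul 3 9) (Seq (Arith 10 Mul 14 6) (Seq (Arith 11 Mul 10 10) (Seq (Arith 12 Mul 11 6)
    (Seq (Arith 13 Sub 9 4) (Seq (Arith 13 Mul 10 13) (Seq (Arith 13 Add 13 4)
    (Seq (Arith 14 Sub 14 9) (Seq (Arith 14 Add 14 4) (Seq (Arith 14 Mul 10 14) (Seq (Arith 14 Sub 14 4)
    (Seq (Arith 15 Sub 10 4) (Seq (Arith 16 Mul 9 10) (Seq (Arith 16 Mul 16 6)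
    (Seq (Arith 17 Add 3 3) (Seq (Const 5 9) (Seq (Arith 5 Add 5 17) (Arith 17 Sub 17 4)))))))))))))))))"

definition prepare :: program where
  "prepare = Seq initialize (Seq multiply_denominators (Seq clear_denominators compute_constants))"

text \<open>Taking the product of the denominators for \<open>L\<close> spares the computation of a
  least common multiple, and it still has polynomial bit length. The summand \<open>L * L\<close> of
  \<open>J\<close> covers the shift entries of the companion matrix, and the summand 1 makes the
  bound strict.\<close>

locale input_data =
  fixes A :: "int list set" and S k :: nat and num den :: "nat \<Rightarrow> int" and L J :: int and val :: "nat \<Rightarrow> int"
  assumes k: "1 \<le> k"
    and den: "\<And>j. j < 2 * k \<Longrightarrow> 0 < den j"
    and L_def: "L = (\<Prod>j<2 * k. den j)"
    and val_def: "\<And>j. val j = num j * L div den j"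
    and J_def: "J = 1 + L * L + (\<Sum>j<2 * k. val j * val j)"
    and num: "\<And>j. j < 2 * k \<Longrightarrow> \<bar>num j * L\<bar> < 2 ^ S"
    and address: "4 * int k + 10 < 2 ^ S"
    and big: "2 * scale k J * scale k J < 2 ^ S"
begin

abbreviation "Q \<equiv> scale k J"

lemma L_pos: "1 \<le> L"
proof -
  have "0 < L"
    unfolding L_def using den by (intro prod_pos) auto
  then show ?thesis
    by simp
qed

lemma L_square: "L \<le> L * L"
  using abs_le_square[of L] L_pos by simp

lemma sum_square_le: "j \<le> 2 * k \<Longrightarrow> 1 + L * L + (\<Sum>i<j. val i * val i) \<le> J"
  unfolding J_def by (intro add_left_mono sum_mono2) auto

lemma J_facts: "1 \<le> J" "L < J"
proof -
  have "1 + L * L \<le> J"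
    using sum_square_le[of 0] by simp
  then show "1 \<le> J" "L < J"
    using L_square L_pos by linarith+
qed

lemma val_square_less: "j < 2 * k \<Longrightarrow> val j * val j < J"
proof -
  assume j: "j < 2 * k"
  have "val j * val j \<le> (\<Sum>i<2 * k. val i * val i)"
    using j by (intro member_le_sum) auto
  then show ?thesis
    using L_square L_pos unfolding J_def by linarith
qed

lemma abs_val_less: "j < 2 * k \<Longrightarrow> \<bar>val j\<bar> < J"
  using val_square_less abs_le_square[of "val j"] by fastforce

lemma Q_facts: "Q = 2 * (int k * J)" "2 * J \<le> Q" "2 \<le> Q"
proof -
  show Q: "Q = 2 * (int k * J)"
    by (simp add: scale_def)
  have "1 * J \<le> int k * J"
    using k J_facts by (intro mult_right_mono) auto
  then show "2 * J \<le> Q" "2 \<le> Q"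
    using Q J_facts by linarith+
qed

lemma mult_le_QQ: "0 \<le> x \<Longrightarrow> x \<le> Q \<Longrightarrow> 0 \<le> y \<Longrightarrow> y \<le> Q \<Longrightarrow> 0 \<le> x * y \<and> x * y \<le> Q * Q"
  by (auto intro: mult_mono)

lemma QQ: "2 * Q \<le> Q * Q" "2 * (Q * Q) < 2 ^ S" "0 \<le> Q * Q"
  using Q_facts big mult_right_mono[of 2 Q Q] by (simp_all add: mult.assoc)

lemma J_small: "\<bar>x\<bar> \<le> J \<Longrightarrow> \<bar>x\<bar> < 2 ^ S"
  using Q_facts QQ by linarith

definition basic :: "int \<Rightarrow> (nat \<Rightarrow> int) \<Rightarrow> bool" where
  "basic st R \<longleftrightarrow> R 1 = st \<and> R 2 = st \<and> R 3 = int k \<and> R 4 = 1 \<and> R 6 = 2 \<and> R 7 = 0"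

lemma runs_initialize:
  assumes "R 0 = st" "R 7 = 0" "M 0 = int k" "\<bar>st\<bar> < 2 ^ S"
    and "\<And>R'. basic st R' \<Longrightarrow> P (R', M)"
  shows "runs A S initialize (1 + (1 + (1 + (1 + 1)))) P (R, M)"
proof -
  have "2 < (2 :: int) ^ S"
    using address by simp
  then show ?thesis
    unfolding initialize_def using assms
    by (intro runs_intros) (simp_all add: basic_def)
qed

lemma runs_multiply_denominators:
  assumes R: "basic st R" and M: "\<And>j. j < 2 * k \<Longrightarrow> M (2 + 2 * int j) = den j"
    and P: "\<And>R'. basic st R' \<Longrightarrow> R' 8 = L \<Longrightarrow> P (R', M)"
  shows "runs A S multiply_denominators (1 + (1 + (1 + (2 * k * ((1 + (1 + (1 + 1))) + 1) + 1)))) P (R, M)"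
proof -
  define I where "I j = (\<lambda>(R', M'). M' = M \<and> basic st R' \<and> R' 20 = 2 * int k - int j \<and> R' 21 = 2 + 2 * int j \<and>
    R' 8 = (\<Prod>i<j. den i))" for j
  have loop: "runs A S (WhilePos 20 (Seq (Load 22 21) (Seq (Arith 8 Mul 8 22) (Seq (Arith 21 Add 21 6) (Arith 20 Sub 20 4)))))
      (2 * k * ((1 + (1 + (1 + 1))) + 1) + 1) (I (2 * k)) (R', M)" if "I 0 (R', M)" for R'
  proof (rule runs_WhilePos[where I=I, OF that])
    fix j R' M'
    assume j: "j < 2 * k" and I: "I j (R', M')"
    \<comment> \<open>The remaining denominators are at least 1, so partial products never exceed
      the final one.\<close>
    have "(\<Prod>i<j. den i) * den j \<le> L"
    proof -
      have "(\<Prod>i<Suc j. den i) * 1 \<le> (\<Prod>i<Suc j. den i) * (\<Prod>i\<in>{Suc j..<2 * k}. den i)"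
      proof (rule mult_left_mono)
        have "1 \<le> den i" if "i < 2 * k" for i
          using den[OF that] by simp
        then show "1 \<le> (\<Prod>i\<in>{Suc j..<2 * k}. den i)"
          by (intro prod_ge_1) auto
        show "0 \<le> (\<Prod>i<Suc j. den i)"
          using den j by (intro prod_nonneg) (auto simp: less_imp_le)
      qed
      also have "(\<Prod>i<Suc j. den i) * (\<Prod>i\<in>{Suc j..<2 * k}. den i) = L"
        unfolding L_def using j prod.atLeastLessThan_concat[of 0 "Suc j" "2 * k" den]
        by (simp add: atLeast0LessThan)
      finally show ?thesis
        by simp
    qed
    moreover have "0 \<le> (\<Prod>i<j. den i) * den j"
      using den j by (intro mult_nonneg_nonneg prod_nonneg) (auto simp: less_imp_le)
    ultimately have "\<bar>(\<Prod>i<j. den i) * den j\<bar> < 2 ^ S"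
      using J_facts by (intro J_small) simp
    then show "0 < R' 20 \<and> runs A S (Seq (Load 22 21) (Seq (Arith 8 Mul 8 22) (Seq (Arith 21 Add 21 6) (Arith 20 Sub 20 4))))
        (1 + (1 + (1 + 1))) (I (Suc j)) (R', M')"
      using I j M[OF j] address by (intro conjI runs_intros) (auto simp: I_def basic_def)
  qed (simp add: I_def)
  have fin: "P (R', M')" if "I (2 * k) (R', M')" for R' M'
    using that P by (auto simp: I_def L_def)
  show ?thesis
    unfolding multiply_denominators_def
  proof (rule runs_Seq, rule runs_Arith_eq[where v="2 * int k"], use R in \<open>simp add: basic_def\<close>, use address in simp,
      rule runs_Seq, rule runs_Arith_eq[where v=2], use R in \<open>simp add: basic_def\<close>, use address in simp,
      rule runs_Seq, rule runs_Arith_eq[where v=1], use R in \<open>simp add: basic_def\<close>, use address in simp)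
    show "runs A S (WhilePos 20 (Seq (Load 22 21) (Seq (Arith 8 Mul 8 22) (Seq (Arith 21 Add 21 6) (Arith 20 Sub 20 4)))))
      (2 * k * ((1 + (1 + (1 + 1))) + 1) + 1) P (R(20 := 2 * int k, 21 := 2, 8 := 1), M)"
      by (rule runs_consequence[OF loop order_refl]) (use R fin in \<open>auto simp: I_def basic_def\<close>)
  qed
qed

lemma runs_clear_denominators:
  assumes R: "basic st R" "R 8 = L"
    and M: "\<And>j. j < 2 * k \<Longrightarrow> M (1 + 2 * int j) = num j" "\<And>j. j < 2 * k \<Longrightarrow> M (2 + 2 * int j) = den j"
    and P: "\<And>R' M'. basic st R' \<Longrightarrow> R' 8 = L \<Longrightarrow> R' 9 = J \<Longrightarrow> (\<And>j. j < 2 * k \<Longrightarrow> M' (1 + 2 * int j) = val j) \<Longrightarrow> P (R', M')"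
  shows "runs A S clear_denominators
    (1 + (1 + (1 + (1 + (2 * k * ((1 + (1 + (1 + (1 + (1 + (1 + (1 + (1 + (1 + 1))))))))) + 1) + 1))))) P (R, M)"
proof -
  define I where "I j = (\<lambda>(R', M'). basic st R' \<and> R' 8 = L \<and> R' 20 = 2 * int k - int j \<and> R' 21 = 1 + 2 * int j \<and>
    R' 9 = 1 + L * L + (\<Sum>i<j. val i * val i) \<and>
    (\<forall>i<2 * k. M' (1 + 2 * int i) = (if i < j then val i else num i) \<and> M' (2 + 2 * int i) = den i))" for j
  let ?body = "Seq (Load 22 21) (Seq (Arith 22 Mul 22 8) (Seq (Arith 23 Add 21 4) (Seq (Load 24 23)
      (Seq (Arith 22 Div 22 24) (Seq (Store 21 22) (Seq (Arith 22 Mul 22 22) (Seq (Arith 9 Add 9 22)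
      (Seq (Arith 21 Add 21 6) (Arith 20 Sub 20 4)))))))))"
  let ?n = "1 + (1 + (1 + (1 + (1 + (1 + (1 + (1 + (1 + 1))))))))"
  have loop: "runs A S (WhilePos 20 ?body) (2 * k * (?n + 1) + 1) (I (2 * k)) (R', M)" if "I 0 (R', M)" for R'
  proof (rule runs_WhilePos[where I=I, OF that])
    fix j R' M'
    assume j: "j < 2 * k" and I: "I j (R', M')"
    have R': "basic st R'" "R' 8 = L" "R' 20 = 2 * int k - int j" "R' 21 = 1 + 2 * int j"
      "R' 9 = 1 + L * L + (\<Sum>i<j. val i * val i)"
      and M': "M' (1 + 2 * int j) = num j" "M' (2 + 2 * int j) = den j"
      using I j by (auto simp: I_def)
    have b1: "\<bar>val j\<bar> < 2 ^ S"
      using abs_val_less[OF j] by (intro J_small) simp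
    have b2: "\<bar>val j * val j\<bar> < 2 ^ S"
      using val_square_less[OF j] by (intro J_small) (simp add: abs_mult)
    have "0 \<le> (\<Sum>i<j. val i * val i)" "0 \<le> L * L" "0 \<le> val j * val j"
      by (auto intro!: sum_nonneg)
    moreover have "1 + L * L + (\<Sum>i<j. val i * val i) + val j * val j \<le> J"
      using sum_square_le[of "Suc j"] j by (simp add: add.assoc)
    ultimately have b3: "\<bar>1 + L * L + (\<Sum>i<j. val i * val i) + val j * val j\<bar> < 2 ^ S"
      by (intro J_small) linarith
    let ?R3 = "R'(22 := num j, 22 := num j * L, 23 := 2 + 2 * int j, 24 := den j, 22 := val j)"
    let ?M = "M'(1 + 2 * int j := val j)"
    let ?R6 = "?R3(22 := val j * val j, 9 := 1 + L * L + (\<Sum>i<Suc j. val i * val i), 21 := 1 + 2 * int (Suc j),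
      20 := 2 * int k - int (Suc j))"
    have I': "I (Suc j) (?R6, ?M)"
      using I R' unfolding I_def basic_def by (auto simp: less_Suc_eq)
    have "runs A S ?body ?n (I (Suc j)) (R', M')"
      apply (rule runs_Seq, rule runs_Load)
      apply (rule runs_Seq, rule runs_Arith_eq[where v="num j * L"], simp add: R' M', rule num[OF j])
      apply (rule runs_Seq, rule runs_Arith_eq[where v="2 + 2 * int j"], use R' in \<open>simp add: basic_def\<close>, use address j in simp)
      apply (rule runs_Seq, rule runs_Load)
      apply (rule runs_Seq, rule runs_Arith_eq[where v="val j"], simp add: val_def M', rule b1)
      apply (rule runs_Seq, rule runs_Store)
      apply (rule runs_Seq, rule runs_Arith_eq[where v="val j * val j"], simp, rule b2)
      apply (rule runs_Seq, rule runs_Arith_eq[where v="1 + L * L + (\<Sum>i<Suc j. val i * val i)"], simp add: R', use b3 in \<open>simp add: add.assoc\<close>)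
      apply (rule runs_Seq, rule runs_Arith_eq[where v="1 + 2 * int (Suc j)"], use R' in \<open>simp add: basic_def\<close>, use address j in simp)
      apply (rule runs_Arith_eq[where v="2 * int k - int (Suc j)"], use R' in \<open>simp add: basic_def\<close>, use address j in simp)
      using I' by (simp add: R' M')
    then show "0 < R' 20 \<and> runs A S ?body ?n (I (Suc j)) (R', M')"
      using R' j by simp
  qed (simp add: I_def)
  have fin: "P (R', M')" if "I (2 * k) (R', M')" for R' M'
    using that unfolding I_def by (auto intro!: P simp: J_def)
  have b: "\<bar>L * L\<bar> < 2 ^ S" "\<bar>1 + L * L\<bar> < 2 ^ S"
  proof -
    have "1 + L * L \<le> J" "0 \<le> L * L"
      using sum_square_le[of 0] by simp_all
    then show "\<bar>L * L\<bar> < 2 ^ S" "\<bar>1 + L * L\<bar> < 2 ^ S"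
      by (intro J_small; linarith)+
  qed
  show ?thesis
    unfolding clear_denominators_def
    apply (rule runs_Seq, rule runs_Arith_eq[where v="L * L"], simp add: R, rule b)
    apply (rule runs_Seq, rule runs_Arith_eq[where v="1 + L * L"], use R in \<open>simp add: basic_def\<close>, rule b)
    apply (rule runs_Seq, rule runs_Arith_eq[where v="2 * int k"], use R in \<open>simp add: basic_def\<close>, use address in simp)
    apply (rule runs_Seq, rule runs_Arith_eq[where v="1"], use R in \<open>simp add: basic_def\<close>, use address in simp)
    apply (rule runs_consequence[OF loop order_refl])
    using R M fin by (auto simp: I_def basic_def)
qed

lemma runs_compute_constants:
  assumes R: "basic st R" "R 8 = L" "R 9 = J"
    and P: "\<And>R'. basic st R' \<Longrightarrow> constants k L J R' \<Longrightarrow> P (R', M)"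
  shows "runs A S compute_constants (1 + (1 + (1 + (1 + (1 + (1 + (1 + (1 + (1 + (1 + (1 + (1 + (1 + (1 + (1 + (1 + (1 + 1)))))))))))))))))
    P (R, M)"
proof -
  have kJ: "J \<le> int k * J" "int k * J \<le> Q"
    using Q_facts J_facts by linarith+
  have 1: "0 \<le> Q * (J - 1) \<and> Q * (J - 1) \<le> Q * Q"
    by (rule mult_le_QQ) (use J_facts Q_facts in linarith)+
  have 2: "0 \<le> Q * (int k * J - J + 1) \<and> Q * (int k * J - J + 1) \<le> Q * Q"
    by (rule mult_le_QQ) (use J_facts Q_facts kJ in linarith)+
  have 3: "0 \<le> J * Q \<and> J * Q \<le> Q * Q"
    by (rule mult_le_QQ) (use J_facts Q_facts in linarith)+
  have b: "\<bar>int k * J\<bar> < 2 ^ S" "\<bar>Q\<bar> < 2 ^ S" "\<bar>Q * Q\<bar> < 2 ^ S" "\<bar>2 * Q * Q\<bar> < 2 ^ S" "\<bar>J - 1\<bar> < 2 ^ S"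
    "\<bar>Q * (J - 1)\<bar> < 2 ^ S" "\<bar>Q * (J - 1) + 1\<bar> < 2 ^ S" "\<bar>int k * J - J\<bar> < 2 ^ S" "\<bar>int k * J - J + 1\<bar> < 2 ^ S"
    "\<bar>Q * (int k * J - J + 1)\<bar> < 2 ^ S" "\<bar>Q * (int k * J - J + 1) - 1\<bar> < 2 ^ S" "\<bar>Q - 1\<bar> < 2 ^ S"
    "\<bar>J * Q\<bar> < 2 ^ S" "\<bar>2 * J * Q\<bar> < 2 ^ S"
    using 1 2 3 kJ Q_facts QQ J_facts unfolding mult.assoc[of 2] by linarith+
  show ?thesis
    unfolding compute_constants_def
    apply (rule runs_Seq, rule runs_Arith_eq[where v="int k * J"], use R in \<open>simp add: basic_def\<close>, rule b)
    apply (rule runs_Seq, rule runs_Arith_eq[where v=Q], use R in \<open>simp add: basic_def scale_def\<close>, rule b)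
    apply (rule runs_Seq, rule runs_Arith_eq[where v="Q * Q"], simp, rule b)
    apply (rule runs_Seq, rule runs_Arith_eq[where v="2 * Q * Q"], use R in \<open>simp add: basic_def\<close>, rule b)
    apply (rule runs_Seq, rule runs_Arith_eq[where v="J - 1"], use R in \<open>simp add: basic_def\<close>, rule b)
    apply (rule runs_Seq, rule runs_Arith_eq[where v="Q * (J - 1)"], simp, rule b)
    apply (rule runs_Seq, rule runs_Arith_eq[where v="Q * (J - 1) + 1"], use R in \<open>simp add: basic_def\<close>, rule b)
    apply (rule runs_Seq, rule runs_Arith_eq[where v="int k * J - J"], use R in \<open>simp add: basic_def\<close>, rule b)
    apply (rule runs_Seq, rule runs_Arith_eq[where v="int k * J - J + 1"], use R in \<open>simp add: basic_def\<close>, rule b)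
    apply (rule runs_Seq, rule runs_Arith_eq[where v="Q * (int k * J - J + 1)"], simp, rule b)
    apply (rule runs_Seq, rule runs_Arith_eq[where v="Q * (int k * J - J + 1) - 1"], use R in \<open>simp add: basic_def\<close>, rule b)
    apply (rule runs_Seq, rule runs_Arith_eq[where v="Q - 1"], use R in \<open>simp add: basic_def\<close>, rule b)
    apply (rule runs_Seq, rule runs_Arith_eq[where v="J * Q"], use R in \<open>simp add: basic_def\<close>, rule b)
    apply (rule runs_Seq, rule runs_Arith_eq[where v="2 * J * Q"], use R in \<open>simp add: basic_def\<close>, rule b)
    apply (rule runs_Seq, rule runs_Arith_eq[where v="2 * int k"], use R in \<open>simp add: basic_def\<close>, use address in simp)
    apply (rule runs_Seq, rule runs_Const, use address in simp)
    apply (rule runs_Seq, rule runs_Arith_eq[where v="9 + 2 * int k"], simp, use address in simp)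
    apply (rule runs_Arith_eq[where v="2 * int k - 1"], use R in \<open>simp add: basic_def\<close>, use address k in simp)
    apply (rule P)
    using R by (simp_all add: basic_def constants_def Let_def)
qed

lemma runs_prepare:
  assumes R: "R 0 = st" "R 7 = 0" "\<bar>st\<bar> < 2 ^ S" and M: "M 0 = int k"
      "\<And>j. j < 2 * k \<Longrightarrow> M (1 + 2 * int j) = num j" "\<And>j. j < 2 * k \<Longrightarrow> M (2 + 2 * int j) = den j"
    and P: "\<And>R' M'. R' 1 = st \<Longrightarrow> R' 2 = st \<Longrightarrow> constants k L J R' \<Longrightarrow>
      (\<And>j. j < 2 * k \<Longrightarrow> M' (1 + 2 * int j) = val j) \<Longrightarrow> P (R', M')"
  shows "runs A S prepare (32 + 32 * k) P (R, M)"
proof -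
  let ?Q = "\<lambda>(R', M'). basic st R' \<and> constants k L J R' \<and> (\<forall>j<2 * k. M' (1 + 2 * int j) = val j)"
  \<comment> \<open>The step count is left open, filled in by the rules for the four parts, and
    compared with the bound at the end.\<close>
  have "\<exists>n\<le>32 + 32 * k. runs A S prepare n ?Q (R, M)"
    unfolding prepare_def
    apply (rule exI, rule conjI[rotated])
     apply (rule runs_Seq, rule runs_initialize, rule R(1), rule R(2), rule M(1), rule R(3))
     apply (rule runs_Seq, rule runs_multiply_denominators, assumption, rule M(3), assumption)
     apply (rule runs_Seq, rule runs_clear_denominators, assumption, assumption, rule M(2), assumption, rule M(3), assumption)
     apply (rule runs_compute_constants, assumption, assumption, assumption)
     apply simp
    apply simp
    done
  then obtain n where n: "n \<le> 32 + 32 * k" and run: "runs A S prepare n ?Q (R, M)"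
    by blast
  show ?thesis
  proof (rule runs_consequence[OF run n])
    fix s'
    assume Q: "?Q s'"
    obtain R' M' where s': "s' = (R', M')"
      by (cases s')
    show "P s'"
      unfolding s' by (rule P) (use Q s' in \<open>simp_all add: basic_def\<close>)
  qed
qed

end

section \<open>The reduction\<close>

text \<open>The answer is subtracted from 1, because the threshold is exceeded exactly for the
  no-instances of Positivity.\<close>

definition reduction_program :: program where
  "reduction_program = Seq prepare (Seq emit_all
    (Seq (Arith 18 Sub 1 2) (Seq (Query 19 2 18) (Arith 0 Sub 4 19))))"

lemma length_reduction_word:
  assumes "1 \<le> k"
  shows "length (reduction_word k X B J) = 367 + 152 * k + 16 * (k * k)"
proof -
  have pairs: "length (concat (replicate n [0, 1 :: int])) = 2 * n" for n
    by (induction n) auto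
  have coeff: "length (concat (map (\<lambda>l. pair_word k J (f l)) xs)) = 4 * length xs" for f and xs :: "nat list"
    by (induction xs) (auto simp: pair_word_def)
  have chain: "length (chain_rows_word k X B J i) = 80 + 16 * k" for i
    unfolding chain_rows_word_def chain_word_def disabled_word_def length_append pairs coeff
    by (simp add: pair_word_def)
  have rows: "length (concat (map (chain_rows_word k X B J) xs)) = (80 + 16 * k) * length xs" for xs
    by (induction xs) (auto simp: chain)
  have special: "length (special_word k r) = 20 + 4 * k" for r
    unfolding special_word_def length_append pairs length_special_prefix using assms by simp
  have "length (concat (map (special_word k) rs)) = (20 + 4 * k) * length rs" for rs
    by (induction rs) (auto simp: special)
  moreover have "length special_rows = 18"
    by (simp add: special_rows_def)
  ultimately show ?thesis
    unfolding reduction_word_def length_append rows by (simp add: algebra_simps)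
qed

section \<open>Bit lengths and positions in the input word\<close>

lemma abs_less_power_int_size: "\<bar>x\<bar> < 2 ^ int_size x"
proof -
  have "nat \<bar>x\<bar> < 2 ^ floorlog 2 (nat \<bar>x\<bar>)"
    using floorlog_bounds[of "nat \<bar>x\<bar>" 2] by (cases "x = 0") auto
  then have "\<bar>x\<bar> < 2 ^ floorlog 2 (nat \<bar>x\<bar>)"
    by (simp add: nat_less_iff)
  also have "\<dots> \<le> 2 ^ int_size x"
    by (intro power_increasing) (auto simp: int_size_def)
  finally show ?thesis .
qed

lemma int_size_le_word_size: "x \<in> set w \<Longrightarrow> int_size x \<le> word_size w"
  unfolding word_size_def by (intro member_le_sum_list) simp_all

lemma abs_less_power_word_size: "x \<in> set w \<Longrightarrow> \<bar>x\<bar> < 2 ^ word_size w"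
  by (rule less_le_trans[OF abs_less_power_int_size power_increasing[OF int_size_le_word_size]]) simp_all

lemma length_le_word_size: "length w \<le> word_size w"
  by (induction w) (auto simp: word_size_def int_size_def)

lemma word_size_eq_sum: "word_size w = (\<Sum>i<length w. int_size (w ! i))"
  unfolding word_size_def by (simp add: sum_list_sum_nth atLeast0LessThan)

lemma abs_div_le: "0 < d \<Longrightarrow> \<bar>x div d\<bar> \<le> \<bar>x :: int\<bar>"
proof -
  assume d: "0 < d"
  show ?thesis
  proof (cases "0 \<le> x")
    case True
    then show ?thesis
      using d zdiv_mono2[of x 1 d] by (simp add: pos_imp_zdiv_nonneg_iff)
  next
    case False
    have "x div 1 \<le> x div d"
      using False d by (intro zdiv_mono2_neg) auto
    moreover have "x div d < 0"
      using False d by (simp add: div_neg_pos_less0)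
    ultimately show ?thesis
      by simp
  qed
qed

lemma positivity_word_alt:
  "positivity_word (\<alpha>, \<beta>) = int (length \<alpha>) # concat (map rat_word (\<alpha> @ \<beta>))"
  by (simp add: positivity_word_def)

lemma nth_concat_rat_word:
  assumes "j < length xs"
  shows "concat (map rat_word xs) ! (2 * j) = fst (quotient_of (xs ! j))"
    and "concat (map rat_word xs) ! Suc (2 * j) = snd (quotient_of (xs ! j))"
  using assms
proof (induction xs arbitrary: j)
  case (Cons x xs)
  {
    case 1
    then show ?case
      using Cons.IH(1)[of "j - 1"] by (cases j) (auto simp: rat_word_def)
  next
    case 2
    then show ?case
      using Cons.IH(2)[of "j - 1"] by (cases j) (auto simp: rat_word_def)
  }
qed auto

lemma concat_rat_word_inject: "concat (map rat_word xs) = concat (map rat_word ys) \<Longrightarrow> xs = ys"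
proof (induction xs arbitrary: ys)
  case Nil
  then show ?case
    by (cases ys) (auto simp: rat_word_def)
next
  case (Cons x xs)
  then obtain y ys' where ys: "ys = y # ys'"
    by (cases ys) (auto simp: rat_word_def)
  with Cons.prems have "rat_word x = rat_word y" "concat (map rat_word xs) = concat (map rat_word ys')"
    by simp_all
  with Cons.IH ys show ?case
    by (simp add: rat_word_inject)
qed

text \<open>A word is a yes-instance if some positive instance encodes to it; injectivity ties this
  to the instance at hand.\<close>

lemma inj_on_positivity_word: "inj_on positivity_word positivity_instances"
proof (rule inj_onI, clarify)
  fix \<alpha> \<beta> \<alpha>' \<beta>'
  assume "(\<alpha>, \<beta>) \<in> positivity_instances" "(\<alpha>', \<beta>') \<in> positivity_instances"
    "positivity_word (\<alpha>, \<beta>) = positivity_word (\<alpha>', \<beta>')"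
  then have "length \<alpha> = length \<alpha>'" "concat (map rat_word (\<alpha> @ \<beta>)) = concat (map rat_word (\<alpha>' @ \<beta>'))"
    unfolding positivity_word_alt by simp_all
  then show "\<alpha> = \<alpha>' \<and> \<beta> = \<beta>'"
    using concat_rat_word_inject append_eq_append_conv by metis
qed

text \<open>The first factor bounds the number of instructions in terms of the input size
  \<open>s\<close>, the second is the charge \<open>2 * S + 2\<close> per instruction for
  \<open>S = 13 * s\<close>.\<close>

definition time_bound :: "nat poly" where
  "time_bound = [:2100, 1300, 200:] * [:2, 26:]"

lemma reduction_program_correct:
  assumes inst: "(\<alpha>, \<beta>) \<in> positivity_instances"
    and A: "fst threshold_problem \<subseteq> A" "snd threshold_problem \<inter> A = {}"
  defines "w \<equiv> positivity_word (\<alpha>, \<beta>)"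
  shows "\<exists>t R M. exec A reduction_program (input_store w) t (R, M) \<and> t \<le> poly time_bound (word_size w) \<and>
    (0 < R 0 \<longleftrightarrow> positive (\<alpha>, \<beta>))"
proof -
  define k where "k = length \<alpha>"
  have k: "2 \<le> k" and len: "length \<alpha> = k" "length \<beta> = k"
    using inst by (simp_all add: positivity_instances_def k_def)
  define \<gamma> where "\<gamma> = \<alpha> @ \<beta>"
  have len_\<gamma>: "length \<gamma> = 2 * k"
    using len by (simp add: \<gamma>_def)
  define num where "num j = fst (quotient_of (\<gamma> ! j))" for j
  define den where "den j = snd (quotient_of (\<gamma> ! j))" for j
  define s where "s = word_size w"
  \<comment> \<open>The exponent follows a chain of bounds: \<open>L\<close> is at most
    \<open>2 ^ s\<close>, the values \<open>val j\<close> at most \<open>2 ^ (2 * s)\<close>, their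
    squares at most \<open>2 ^ (4 * s)\<close>, \<open>J\<close> at most \<open>2 ^ (5 * s)\<close>
    and \<open>Q\<close> at most \<open>2 ^ (6 * s)\<close>; so \<open>2 * Q * Q\<close> is at most
    \<open>2 ^ (12 * s + 1)\<close>.\<close>
  define S where "S = 13 * s"
  have w: "w = int k # concat (map rat_word \<gamma>)"
    by (simp add: w_def positivity_word_alt k_def \<gamma>_def)
  have "length (concat (map rat_word xs)) = 2 * length xs" for xs
    by (induction xs) auto
  then have len_w: "length w = 4 * k + 1"
    by (simp add: w len_\<gamma>)
  have w_num: "w ! (1 + 2 * j) = num j" and w_den: "w ! (2 + 2 * j) = den j" if "j < 2 * k" for j
    using nth_concat_rat_word[of j \<gamma>] that by (simp_all add: w num_def den_def len_\<gamma>)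
  have ks: "4 * k + 1 \<le> s" and s: "9 \<le> s"
    using length_le_word_size[of w] k len_w by (simp_all add: s_def)
  have den_pos: "0 < den j" for j
    by (simp add: den_def quotient_of_denom_pos')
  define L where "L = (\<Prod>j<2 * k. den j)"
  define val where "val j = num j * L div den j" for j
  define J where "J = 1 + L * L + (\<Sum>j<2 * k. val j * val j)"
  have pow: "(2 :: int) ^ m \<le> 2 ^ n" if "m \<le> n" for m n
    using that by (intro power_increasing) auto
  have num_less: "\<bar>num j\<bar> < 2 ^ s" if "j < 2 * k" for j
    using abs_less_power_word_size[of "num j" w] w_num[OF that] that len_w nth_mem[of "1 + 2 * j" w] by (simp add: s_def)
  \<comment> \<open>The denominators occupy distinct cells of the input word, so the exponents
    bounding them add up to at most \<open>s\<close>.\<close>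
  have L_le: "L \<le> 2 ^ s"
  proof -
    have "L \<le> (\<Prod>j<2 * k. 2 ^ int_size (den j))"
      unfolding L_def
      by (intro prod_mono) (use den_pos abs_less_power_int_size in \<open>auto simp: less_imp_le abs_of_pos\<close>, metis abs_less_power_int_size abs_of_pos den_pos less_imp_le)
    also have "\<dots> = 2 ^ (\<Sum>j<2 * k. int_size (den j))"
      by (simp add: power_sum)
    also have "(\<Sum>j<2 * k. int_size (den j)) \<le> s"
    proof -
      have "(\<Sum>j<2 * k. int_size (den j)) = (\<Sum>j<2 * k. int_size (w ! (2 + 2 * j)))"
        by (intro sum.cong refl) (simp only: w_den lessThan_iff)
      also have "\<dots> = (\<Sum>i\<in>(\<lambda>j. 2 + 2 * j) ` {..<2 * k}. int_size (w ! i))"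
        by (subst sum.reindex) (auto simp: inj_on_def)
      also have "\<dots> \<le> (\<Sum>i<length w. int_size (w ! i))"
        using len_w by (intro sum_mono2) auto
      finally show ?thesis
        by (simp add: s_def word_size_eq_sum)
    qed
    finally show ?thesis
      using pow by simp
  qed
  have L_pos: "0 < L"
    unfolding L_def by (intro prod_pos) (simp add: den_pos)
  have numL: "\<bar>num j * L\<bar> \<le> 2 ^ (2 * s)" if "j < 2 * k" for j
  proof -
    have "\<bar>num j * L\<bar> \<le> 2 ^ s * 2 ^ s"
      unfolding abs_mult using num_less[OF that] L_le L_pos by (intro mult_mono) auto
    then show ?thesis
      by (simp add: mult_2 power_add)
  qed
  have val2: "val j * val j \<le> 2 ^ (4 * s)" if "j < 2 * k" for j
  proof -
    have "\<bar>val j\<bar> \<le> 2 ^ (2 * s)"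
      unfolding val_def using abs_div_le[OF den_pos] numL[OF that] by (rule order_trans)
    then have "\<bar>val j\<bar> * \<bar>val j\<bar> \<le> 2 ^ (2 * s) * 2 ^ (2 * s)"
      by (intro mult_mono) auto
    then show ?thesis
      by (simp add: abs_mult_self_eq flip: power_add)
  qed
  have s_less: "int s \<le> 2 ^ s"
    using less_exp[of s] by (metis less_imp_le of_nat_le_iff of_nat_numeral of_nat_power)
  have J_le: "J \<le> 2 ^ (5 * s)"
  proof -
    have "(\<Sum>j<2 * k. val j * val j) \<le> (\<Sum>j<2 * k. 2 ^ (4 * s))"
      using val2 by (intro sum_mono) auto
    then have "(\<Sum>j<2 * k. val j * val j) \<le> 2 * int k * 2 ^ (4 * s)"
      by simp
    moreover have "(1 :: int) \<le> 2 ^ (4 * s)"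
      by simp
    moreover have "L * L \<le> 2 ^ s * 2 ^ s"
      using L_le L_pos by (intro mult_mono) auto
    moreover have "(2 :: int) ^ s * 2 ^ s \<le> 2 ^ (4 * s)"
      unfolding power_add[symmetric] by (rule pow) simp
    ultimately have "J \<le> (2 + 2 * int k) * 2 ^ (4 * s)"
      unfolding J_def distrib_right by linarith
    also have "\<dots> \<le> 2 ^ s * 2 ^ (4 * s)"
    proof (rule mult_right_mono)
      have "2 + 2 * int k \<le> int s"
        using ks k by linarith
      then show "2 + 2 * int k \<le> 2 ^ s"
        using s_less by linarith
    qed simp
    also have "\<dots> = 2 ^ (5 * s)"
      by (simp flip: power_add)
    finally show ?thesis .
  qed
  have J_ge: "0 \<le> J"
    unfolding J_def by (intro add_nonneg_nonneg sum_nonneg) auto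
  have big: "2 * scale k J * scale k J < 2 ^ S"
  proof -
    have "2 * int k \<le> 2 ^ s"
      using ks s_less by linarith
    then have "scale k J \<le> 2 ^ s * 2 ^ (5 * s)" "0 \<le> scale k J"
      unfolding scale_def using J_le J_ge by (auto intro!: mult_mono)
    then have "scale k J * scale k J \<le> (2 ^ s * 2 ^ (5 * s)) * (2 ^ s * 2 ^ (5 * s))"
      by (intro mult_mono) auto
    also have "\<dots> = 2 ^ (12 * s)"
      by (simp flip: power_add)
    finally have "2 * (scale k J * scale k J) \<le> 2 ^ (1 + 12 * s)"
      by simp
    also have "\<dots> < 2 ^ S"
      using s by (intro power_strict_increasing) (auto simp: S_def)
    finally show ?thesis
      by (simp add: mult.assoc)
  qed
  let ?lim = "367 + 152 * k + 16 * (k * k)"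
  have lim: "4 * int k + 1 + int ?lim < 2 ^ S"
  proof -
    have "16 * (k * k) \<le> s * s" "156 * k \<le> 39 * s" "368 \<le> 41 * s" "80 * s \<le> 9 * s * s" "0 < s * s"
      using ks s mult_mono[of "4 * k" s "4 * k" s] by auto
    then have "4 * k + 1 + ?lim < 16 * (s * s)"
      by linarith
    then have "int (4 * k + 1 + ?lim) < int (16 * (s * s))"
      by (simp only: of_nat_less_iff)
    also have "\<dots> \<le> 2 ^ 4 * (2 ^ s * 2 ^ s)"
      using s_less by (simp add: mult_mono)
    also have "\<dots> = 2 ^ (4 + (s + s))"
      by (simp only: power_add)
    also have "\<dots> \<le> 2 ^ S"
      using s by (intro pow) (simp add: S_def)
    finally show ?thesis
      by simp
  qed
  moreover have "0 \<le> int k * int k"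
    by simp
  ultimately have small: "16 < (2 :: int) ^ S" "4 * int k + 10 < 2 ^ S"
    unfolding of_nat_add of_nat_mult of_nat_numeral by linarith+
  have numL_less: "\<bar>num j * L\<bar> < 2 ^ S" if "j < 2 * k" for j
  proof -
    have "(2 :: int) ^ (2 * s) < 2 ^ S"
      using s by (intro power_strict_increasing) (auto simp: S_def)
    with numL[OF that] show ?thesis
      by (rule le_less_trans)
  qed
  interpret data: input_data A S k num den L J val
    by unfold_locales (use k den_pos numL_less small big in \<open>simp_all add: L_def val_def J_def\<close>)
  define a where "a l = val (k - 1 - l)" for l
  define b where "b i = val (k + i)" for i
  have val: "of_int (val j) = of_int L * \<gamma> ! j" if "j < 2 * k" for j
  proof -
    have "den j dvd L"
      unfolding L_def using that by (intro dvd_prodI) auto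
    then have "val j * den j = num j * L"
      by (simp add: val_def)
    then have "of_int (val j) * of_int (den j) = of_int (num j) * (of_int L :: rat)"
      by (simp flip: of_int_mult)
    moreover have "\<gamma> ! j = of_int (num j) / of_int (den j)"
      by (rule quotient_of_div) (simp add: num_def den_def)
    ultimately have "of_int (val j) = of_int (num j) * of_int L / (of_int (den j) :: rat)"
      using den_pos[of j] by (simp add: eq_divide_eq)
    then show ?thesis
      using \<open>\<gamma> ! j = of_int (num j) / of_int (den j)\<close> by simp
  qed
  let ?X = "coefficient k L a"
  interpret red: reduction k ?X b J
  proof
    show "\<bar>?X i l\<bar> < J" if "i < k" "l < k" for i l
      using that data.abs_val_less[of "k - 1 - l"] data.J_facts data.L_pos by (auto simp: coefficient_def a_def)
    show "\<bar>b i\<bar> < J" if "i < k" for i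
      using that data.abs_val_less[of "k + i"] by (simp add: b_def)
  qed (use k in simp)
  have pos: "positive (\<alpha>, \<beta>) \<longleftrightarrow> \<not> exceeds_threshold (reduction_mdp k ?X b J, 15 / 4)"
  proof (rule red.positive_iff[OF len refl])
    show "of_int (a l) = of_int L * \<alpha> ! (k - 1 - l)" if "l < k" for l
      using val[of "k - 1 - l"] that len by (simp add: a_def \<gamma>_def nth_append)
    show "of_int (b i) = of_int L * \<beta> ! i" if "i < k" for i
      using val[of "k + i"] that len by (simp add: b_def \<gamma>_def nth_append)
  qed (use data.L_pos in simp)
  let ?w = "reduction_word k ?X b J"
  \<comment> \<open>The oracle is reliable on instances only; by \<open>threshold_instance\<close>
    the constructed process is one, and the output word is its exact encoding.\<close>
  have query: "?w \<in> A \<longleftrightarrow> exceeds_threshold (reduction_mdp k ?X b J, 15 / 4)"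
    using A red.threshold_instance[of "15 / 4"] unfolding red.threshold_word_mdp[symmetric]
    by (auto simp: threshold_problem_def decision_problem_def)
  have len': "length ?w = ?lim"
    using k by (intro length_reduction_word) simp
  obtain R0 M0 where store: "input_store w = (R0, M0)"
    by (cases "input_store w")
  have R0: "R0 0 = 4 * int k + 1" "R0 7 = 0" and M0: "M0 = (\<lambda>i. if 0 \<le> i \<and> i < int (length w) then w ! nat i else 0)"
    using store len_w by (auto simp: input_store_def)
  have bounded: "bounded S (R0, M0)"
  proof -
    have "\<bar>x\<bar> < 2 ^ S" if "x \<in> set w" for x
    proof -
      have "\<bar>x\<bar> < 2 ^ s"
        using abs_less_power_word_size[OF that] by (simp add: s_def)
      also have "(2 :: int) ^ s \<le> 2 ^ S"
        by (rule pow) (simp add: S_def)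
      finally show ?thesis .
    qed
    then show ?thesis
      using store small len_w by (auto simp: bounded_def input_store_def)
  qed
  have "runs A S reduction_program ((32 + 32 * k) + ((1600 + 1000 * k + 100 * k * k) + (1 + ((length ?w + 1) + 1))))
    (\<lambda>(R, M). 0 < R 0 \<longleftrightarrow> positive (\<alpha>, \<beta>)) (R0, M0)"
    unfolding reduction_program_def
  proof (rule runs_Seq, rule data.runs_prepare[where st="4 * int k + 1"])
    show "M0 0 = int k"
      using len_w by (simp add: M0 w)
    show "M0 (1 + 2 * int j) = num j" "M0 (2 + 2 * int j) = den j" if "j < 2 * k" for j
      using w_num[OF that] w_den[OF that] that len_w by (auto simp: M0 nat_add_distrib nat_mult_distrib)
    fix R1 M1
    assume R1: "R1 1 = 4 * int k + 1" "R1 2 = 4 * int k + 1" and c: "constants k L J R1"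
      and M1: "\<And>j. j < 2 * k \<Longrightarrow> M1 (1 + 2 * int j) = val j"
    \<comment> \<open>The memory left by the preparation, \<open>M1\<close>, plays the role of the
      fixed lower part from which the writing fragments read their coefficients.\<close>
    interpret row_emitter A S "4 * int k + 1" ?lim M1 k L J a b
    proof
      show "M1 (2 * int k - 1 - 2 * int l) = a l" if "l < k" for l
      proof -
        have cell: "2 * int k - 1 - 2 * int l = 1 + 2 * int (k - 1 - l)"
          using that by (simp add: of_nat_diff)
        show ?thesis
          unfolding cell a_def using that by (intro M1) simp
      qed
      show "M1 (2 * int k + 1 + 2 * int i) = b i" if "i < k" for i
      proof -
        have cell: "2 * int k + 1 + 2 * int i = 1 + 2 * int (k + i)"
          by simp
        show ?thesis
          unfolding cell b_def using that by (intro M1) simp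
      qed
      show "\<bar>a l\<bar> < J" if "l < k" for l
        using that data.abs_val_less[of "k - 1 - l"] by (simp add: a_def)
      show "\<bar>b i\<bar> < J" if "i < k" for i
        using that data.abs_val_less[of "k + i"] by (simp add: b_def)
      show "\<bar>L\<bar> < J"
        using data.J_facts data.L_pos by simp
    qed (use lim big k in auto)
    have em: "emits_at volatile_all R1 emit_all (1600 + 1000 * k + 100 * k * k) ?w"
      using c small by (intro emits_at_emit_all)
    show "runs A S (Seq emit_all (Seq (Arith 18 Sub 1 2) (Seq (Query 19 2 18) (Arith 0 Sub 4 19))))
      ((1600 + 1000 * k + 100 * k * k) + (1 + ((length ?w + 1) + 1))) (\<lambda>(R, M). 0 < R 0 \<longleftrightarrow> positive (\<alpha>, \<beta>)) (R1, M1)"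
    proof (rule runs_Seq, rule emits_atD[OF em, of "[]"])
      show "emitted (4 * int k + 1) M1 [] (R1, M1)"
        using R1 by (simp add: emitted_def)
      show "length [] + length ?w \<le> ?lim"
        by (simp add: len')
      fix R2 M2
      assume k2: "keeps volatile_all R1 R2" and e: "emitted (4 * int k + 1) M1 ([] @ ?w) (R2, M2)"
      have R2: "R2 1 = 4 * int k + 1 + int (length ?w)" "R2 2 = 4 * int k + 1" "R2 4 = 1"
        using k2 e R1 c by (simp_all add: keeps_def emitted_def constants_def Let_def)
      let ?R3 = "R2(18 := int (length ?w))"
      have w': "?w = map (\<lambda>i. M2 (?R3 2 + int i)) [0..<nat (?R3 18)]"
        using e R2 by (intro nth_equalityI) (simp_all add: emitted_def)
      show "runs A S (Seq (Arith 18 Sub 1 2) (Seq (Query 19 2 18) (Arith 0 Sub 4 19)))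
        (1 + ((length ?w + 1) + 1)) (\<lambda>(R, M). 0 < R 0 \<longleftrightarrow> positive (\<alpha>, \<beta>)) (R2, M2)"
      proof (rule runs_Seq, rule runs_Arith_eq[where v="int (length ?w)"])
        show "\<bar>int (length ?w)\<bar> < 2 ^ S"
          using lim unfolding len' by linarith
        show "runs A S (Seq (Query 19 2 18) (Arith 0 Sub 4 19)) ((length ?w + 1) + 1)
          (\<lambda>(R, M). 0 < R 0 \<longleftrightarrow> positive (\<alpha>, \<beta>)) (?R3, M2)"
        proof (rule runs_Seq, rule runs_Query[OF w'])
          show "runs A S (Arith 0 Sub 4 19) 1 (\<lambda>(R, M). 0 < R 0 \<longleftrightarrow> positive (\<alpha>, \<beta>))
            (?R3(19 := of_bool (?w \<in> A)), M2)"
          proof (rule runs_Arith_eq[where v="1 - of_bool (?w \<in> A)"])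
            show "case ((?R3(19 := of_bool (?w \<in> A)))(0 := 1 - of_bool (?w \<in> A)), M2) of
                (R, M) \<Rightarrow> 0 < R 0 \<longleftrightarrow> positive (\<alpha>, \<beta>)"
              by (simp add: query pos)
          qed (use R2 small in simp_all)
          show "1 \<le> S"
            using s by (simp add: S_def)
        qed
      qed (use R2 in simp)
    qed
  qed (use R0 small in simp_all)
  then obtain t R M where ex: "exec A reduction_program (R0, M0) t (R, M)" "0 < R 0 \<longleftrightarrow> positive (\<alpha>, \<beta>)"
    and t: "t \<le> ((32 + 32 * k) + ((1600 + 1000 * k + 100 * k * k) + (1 + ((length ?w + 1) + 1)))) * (2 * S + 2)"
    using bounded unfolding runs_def by auto
  have "k \<le> s"
    using ks by linarith
  then have "k * k \<le> s * s"
    by (intro mult_le_mono)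
  then have "(32 + 32 * k) + ((1600 + 1000 * k + 100 * k * k) + (1 + ((length ?w + 1) + 1))) \<le> 2100 + 1300 * s + 200 * (s * s)"
    using \<open>k \<le> s\<close> unfolding len' mult.assoc by linarith
  from order_trans[OF t mult_le_mono1[OF this]] have "t \<le> (2100 + 1300 * s + 200 * (s * s)) * (2 * S + 2)" .
  also have "\<dots> = poly time_bound s"
    by (simp add: time_bound_def S_def algebra_simps)
  finally show ?thesis
    using ex by (auto simp: store s_def)
qed

theorem theorem4:
  shows "poly_time_reducible positivity_problem threshold_problem"
  unfolding poly_time_reducible_def
proof (rule exI[of _ reduction_program], rule exI[of _ time_bound], intro allI impI ballI)
  fix A w
  assume A: "fst threshold_problem \<subseteq> A \<and> snd threshold_problem \<inter> A = {}"
    and w: "w \<in> fst positivity_problem \<union> snd positivity_problem"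
  then obtain \<alpha> \<beta> where x: "(\<alpha>, \<beta>) \<in> positivity_instances" "w = positivity_word (\<alpha>, \<beta>)"
    by (auto simp: positivity_problem_def decision_problem_def)
  have "w \<in> fst positivity_problem \<longleftrightarrow> positive (\<alpha>, \<beta>)"
    using inj_onD[OF inj_on_positivity_word _ x(1)] x
    by (auto simp: positivity_problem_def decision_problem_def)
  then show "\<exists>t R M. exec A reduction_program (input_store w) t (R, M) \<and> t \<le> poly time_bound (word_size w) \<and>
      (0 < R 0 \<longleftrightarrow> w \<in> fst positivity_problem)"
    using reduction_program_correct[OF x(1), of A] A x(2) by simp
qed

end
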